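(* Let $\varepsilon_n=\sqrt{\ln(p)/n}$ and suppose the following hold. (1) $b_j\in\Gamma$ for all $j$, and for every $\alpha\in\Gamma$ and $\varepsilon>0$ there are $p$ and $\rho\in\mathbb{R}^p$ with $\mathrm{E}[\{\alpha(X)-\sum_{j=1}^p\rho_jb_j(X)\}^2]<\varepsilon$. (2) There exist $C>1$, $\xi>0$ such that for each positive integer $s\le C\varepsilon_n^{-2/(2\xi+1)}$ there is $\bar\rho\in\mathbb{R}^p$ with $s$ nonzero elements such that $\Vert\bar\alpha-b'\bar\rho\Vert\le Cs^{-\xi}$. (3) $G$ has largest eigenvalue bounded uniformly in $n$, and there are $C,c>0$ such that for each $\ell$ and all integers $s=s_n\approx C\varepsilon_n^{-2}$ (i.e. $s_n\varepsilon_n^2\to C$), with probability approaching one, $$\min_{J\subset\{1,\dots,p\},\,|J|\le s}\ \min_{\Vert\rho_{J^c}\Vert_1\le3\Vert\rho_J\Vert_1,\ \rho_J\ne0}\frac{\rho'\hat G_\ell\rho}{\rho_J'\rho_J}\ge c.$$ (4) There is $C>0$ such that with probability one $\sup_j|b_j(X)|\le C$. (5) $\varepsilon_n=o(r)$, $r=o(n^c\varepsilon_n)$ for all $c>0$, and there exists $C>0$ such that $p\le Cn^C$. (6) There is $C>0$ such that with probability one $\max_{j\le p}|m(W,b_j)|\le C$. (7) $\mathrm{E}[\{Y-\bar\gamma(X)\}^2|X]$ and $\bar\alpha(X)$ are bounded. (8) $\mathrm{E}[m(W,\bar\gamma)^2]<\infty$ and, for each $\ell$, $\int[m(w,\hat\gamma_\ell)-m(w,\bar\gamma)]^2F_W(dw)\overset{p}{\to}0$.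 (9) With probability approaching one $\hat\gamma_\ell\in\Gamma$, and there is $d_\gamma>0$ such that $\Vert\hat\gamma_\ell-\bar\gamma\Vert=O_p(n^{-d_\gamma})$ for each $\ell$, and either (2) and (3) are satisfied with $\frac{\xi}{2\xi+1}+d_\gamma>\frac12$, or condition (S) below is satisfied and $d_\gamma>1/4$. Condition (S): $\bar\alpha(X)=\sum_{j=1}^\infty\rho_{j0}b_j(X)$, $\sum_{j=1}^\infty|\rho_{j0}|<\infty$, and for some $C>0$ and $\bar s=C\sqrt n$ the $b_j(x)$ corresponding to the largest $\bar s$ values of $|\rho_{j0}|$ are included in $b(x)$. Then $\sqrt n(\hat\theta-\bar\theta)\overset{d}{\to}N(0,V)$. If in addition condition (S) is satisfied then $\hat V\overset{p}{\to}V$.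
   Context: $W_1,\dots,W_n$ are i.i.d. copies of a data observation $W$ that includes a scalar $Y$ with $\mathrm{E}[Y^2]<\infty$ and a covariate vector $X$. $\Gamma$ is a closed linear subspace of the space of functions $\gamma(X)$ with $\mathrm{E}[\gamma(X)^2]<\infty$. $m(w,\gamma)$ is a functional of functions $\gamma$ of $x$, linear in $\gamma$, and there is $\alpha_0(X)$ with $\mathrm{E}[\alpha_0(X)^2]<\infty$ and $\mathrm{E}[m(W,\gamma)]=\mathrm{E}[\alpha_0(X)\gamma(X)]$ for all $\gamma$ with $\mathrm{E}[\gamma(X)^2]<\infty$. $\bar\alpha=\arg\min_{\alpha\in\Gamma}\mathrm{E}[\{\alpha_0(X)-\alpha(X)\}^2]$, $\bar\gamma=\arg\min_{\gamma\in\Gamma}\mathrm{E}[\{Y-\gamma(X)\}^2]$, and $$\bar\theta=\mathrm{E}[m(W,\bar\gamma)],\quad \psi(w)=m(w,\bar\gamma)-\bar\theta+\bar\alpha(x)[y-\bar\gamma(x)],\quad V=\mathrm{E}[\psi(W)^2].$$ $(b_j)_{j\ge1}$ is a sequence of functions of $x$; for each $n$, $b(x)=(b_1(x),\dots,b_p(x))'$ with $p=p_n\ge2$; $m(w,b)=(m(w,b_1),\dots,m(w,b_p))'$; $G=\mathrm{E}[b(X)b(X)']$. Cross-fitting: $L\ge2$ is fixed and $I_1,\dots,I_L$ is a partition of $\{1,\dots,n\}$ into sets of about equal size, with $n_\ell=|I_\ell|$. For each $\ell$, $\hat\gamma_\ell$ is a regression learner computed only from observations not in $I_\ell$. With $r=r_n>0$,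 $$\hat M_\ell=\frac1{n-n_\ell}\sum_{i\notin I_\ell}m(W_i,b),\quad \hat G_\ell=\frac1{n-n_\ell}\sum_{i\notin I_\ell}b(X_i)b(X_i)',$$ $$\hat\rho_\ell\in\arg\min_{\rho\in\mathbb{R}^p}\{-2\hat M_\ell'\rho+\rho'\hat G_\ell\rho+2r\Vert\rho\Vert_1\},\quad \hat\alpha_\ell(x)=b(x)'\hat\rho_\ell .$$ The estimators are $$\hat\theta=\frac1n\sum_{\ell=1}^L\sum_{i\in I_\ell}\{m(W_i,\hat\gamma_\ell)+\hat\alpha_\ell(X_i)[Y_i-\hat\gamma_\ell(X_i)]\},$$ $$\hat V=\frac1n\sum_{\ell=1}^L\sum_{i\in I_\ell}\hat\psi_{i\ell}^2,\quad \hat\psi_{i\ell}=m(W_i,\hat\gamma_\ell)-\hat\theta+\hat\alpha_\ell(X_i)[Y_i-\hat\gamma_\ell(X_i)].$$ $\Vert a\Vert=\sqrt{\mathrm{E}[a(W)^2]}$, where for an estimated function the expectation is over a $W$ independent of the data with the estimate held fixed. $\Vert\cdot\Vert_1$ is the sum of absolute values of the entries. $\rho_J$ is the subvector of $\rho$ with indices in $J$, $\rho_{J^c}$ the remaining subvector. $F_W$ is the distribution of $W$. Limits are as $n\to\infty$. *)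

theory Defs
  imports "HOL-Probability.Probability" "HOL-Library.Landau_Symbols" "Jordan_Normal_Form.Char_Poly"
begin

text \<open>
  Everything is indexed from 0: observations \<open>i < n\<close>, folds \<open>l < L\<close>, dictionary functions
  \<open>b j\<close> with \<open>j < p n\<close>.  \<open>F\<close> is the distribution of one observation, so the expectation of
  \<open>f(W)\<close> is \<open>\<integral>w. f w \<partial>F\<close>; the coordinate maps \<open>X\<close> and \<open>Y\<close> extract the covariates and the outcome.
  The space \<open>\<real>\<^sup>p\<close> is \<open>carrier_vec p\<close>, because \<open>p\<close> depends on \<open>n\<close>.
\<close>

no_notation inner (infix "\<bullet>" 70)
no_notation vec_nth (infixl "$" 90)

definition wp_approaching_one :: "'a measure \<Rightarrow> (nat \<Rightarrow> 'a \<Rightarrow> bool) \<Rightarrow> bool" where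
  "wp_approaching_one M P \<longleftrightarrow> (\<lambda>n. measure M {\<omega> \<in> space M. P n \<omega>}) \<longlonglongrightarrow> 1"

definition tendsto_in_prob :: "'a measure \<Rightarrow> (nat \<Rightarrow> 'a \<Rightarrow> real) \<Rightarrow> real \<Rightarrow> bool" where
  "tendsto_in_prob M Z c \<longleftrightarrow>
     (\<forall>e>0. (\<lambda>n. measure M {\<omega> \<in> space M. \<bar>Z n \<omega> - c\<bar> > e}) \<longlonglongrightarrow> 0)"

text \<open>Convergence in probability to 0 for nonnegative variables that may take the value \<open>\<infinity>\<close>.\<close>

definition tendsto_in_prob_0 :: "'a measure \<Rightarrow> (nat \<Rightarrow> 'a \<Rightarrow> ennreal) \<Rightarrow> bool" where
  "tendsto_in_prob_0 M Z \<longleftrightarrow>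
     (\<forall>e>0. (\<lambda>n. measure M {\<omega> \<in> space M. Z n \<omega> > ennreal e}) \<longlonglongrightarrow> 0)"

definition bigo_in_prob :: "'a measure \<Rightarrow> (nat \<Rightarrow> 'a \<Rightarrow> real) \<Rightarrow> (nat \<Rightarrow> real) \<Rightarrow> bool" where
  "bigo_in_prob M Z a \<longleftrightarrow>
     (\<forall>\<delta>>0. \<exists>K>0. eventually (\<lambda>n. measure M {\<omega> \<in> space M. \<bar>Z n \<omega>\<bar> > K * \<bar>a n\<bar>} < \<delta>) sequentially)"

text \<open>The normal law with mean \<open>\<mu>\<close> and variance \<open>v\<close>; for \<open>v = 0\<close> it is the point mass at \<open>\<mu>\<close>
  (where \<open>normal_density \<mu> 0\<close> would be identically 0).\<close>

definition normal_law :: "real \<Rightarrow> real \<Rightarrow> real measure" where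
  "normal_law \<mu> v = (if v = 0 then return borel \<mu> else density lborel (normal_density \<mu> (sqrt v)))"

definition tendsto_in_dist :: "'a measure \<Rightarrow> (nat \<Rightarrow> 'a \<Rightarrow> real) \<Rightarrow> real measure \<Rightarrow> bool" where
  "tendsto_in_dist M Z \<mu> \<longleftrightarrow> weak_conv_m (\<lambda>n. distr M borel (Z n)) \<mu>"

text \<open>Only meaningful for square-integrable \<open>a\<close>: the Bochner integral of a non-integrable function
  is 0.\<close>

definition L2_norm_of :: "'w measure \<Rightarrow> ('w \<Rightarrow> real) \<Rightarrow> real" where
  "L2_norm_of F a = sqrt (\<integral>w. (a w)\<^sup>2 \<partial>F)"

definition L2_fun :: "'w measure \<Rightarrow> ('w \<Rightarrow> 'x::euclidean_space) \<Rightarrow> ('x \<Rightarrow> real) set" where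
  "L2_fun F X = {\<gamma> \<in> borel_measurable borel. integrable F (\<lambda>w. (\<gamma> (X w))\<^sup>2)}"

text \<open>Elements are functions rather than equivalence classes; sequential closedness (with constant
  sequences) makes \<open>\<Gamma>\<close> invariant under changes on null sets.\<close>

definition closed_linear_subspace ::
  "'w measure \<Rightarrow> ('w \<Rightarrow> 'x::euclidean_space) \<Rightarrow> ('x \<Rightarrow> real) set \<Rightarrow> bool" where
  "closed_linear_subspace F X \<Gamma> \<longleftrightarrow>
     \<Gamma> \<subseteq> L2_fun F X \<and> (\<lambda>x. 0) \<in> \<Gamma> \<and>
     (\<forall>g\<in>\<Gamma>. \<forall>h\<in>\<Gamma>. (\<lambda>x. g x + h x) \<in> \<Gamma>) \<and>
     (\<forall>a. \<forall>g\<in>\<Gamma>. (\<lambda>x. a * g x) \<in> \<Gamma>) \<and>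
     (\<forall>g. \<forall>\<gamma>\<in>L2_fun F X. (\<forall>k::nat. g k \<in> \<Gamma>) \<and>
        (\<lambda>k. L2_norm_of F (\<lambda>w. g k (X w) - \<gamma> (X w))) \<longlonglongrightarrow> 0 \<longrightarrow> \<gamma> \<in> \<Gamma>)"

definition linear_functional_on ::
  "('x \<Rightarrow> real) set \<Rightarrow> (('x \<Rightarrow> real) \<Rightarrow> real) \<Rightarrow> bool" where
  "linear_functional_on S f \<longleftrightarrow>
     (\<forall>g\<in>S. \<forall>h\<in>S. f (\<lambda>x. g x + h x) = f g + f h) \<and>
     (\<forall>a. \<forall>g\<in>S. f (\<lambda>x. a * g x) = a * f g)"

definition dict_vec :: "(nat \<Rightarrow> 'x \<Rightarrow> real) \<Rightarrow> nat \<Rightarrow> 'x \<Rightarrow> real Matrix.vec" where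
  "dict_vec b p x = Matrix.vec p (\<lambda>j. b j x)"

definition pop_gram ::
  "'w measure \<Rightarrow> ('w \<Rightarrow> 'x) \<Rightarrow> (nat \<Rightarrow> 'x \<Rightarrow> real) \<Rightarrow> nat \<Rightarrow> real Matrix.mat" where
  "pop_gram F X b p = Matrix.mat p p (\<lambda>(j, k). \<integral>w. b j (X w) * b k (X w) \<partial>F)"

text \<open>In the next two definitions \<open>d\<close> is a sample and \<open>T\<close> the set of indices averaged over.\<close>

definition emp_moment ::
  "('w \<Rightarrow> ('x \<Rightarrow> real) \<Rightarrow> real) \<Rightarrow> (nat \<Rightarrow> 'x \<Rightarrow> real) \<Rightarrow> nat \<Rightarrow> nat set \<Rightarrow> (nat \<Rightarrow> 'w)
    \<Rightarrow> real Matrix.vec" where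
  "emp_moment m b p T d = Matrix.vec p (\<lambda>j. (\<Sum>i\<in>T. m (d i) (b j)) / real (card T))"

definition emp_gram ::
  "('w \<Rightarrow> 'x) \<Rightarrow> (nat \<Rightarrow> 'x \<Rightarrow> real) \<Rightarrow> nat \<Rightarrow> nat set \<Rightarrow> (nat \<Rightarrow> 'w) \<Rightarrow> real Matrix.mat" where
  "emp_gram X b p T d =
     Matrix.mat p p (\<lambda>(j, k). (\<Sum>i\<in>T. b j (X (d i)) * b k (X (d i))) / real (card T))"

definition l1_norm :: "real Matrix.vec \<Rightarrow> real" where
  "l1_norm \<rho> = (\<Sum>j<dim_vec \<rho>. \<bar>\<rho> $ j\<bar>)"

definition lasso_objective ::
  "real Matrix.vec \<Rightarrow> real Matrix.mat \<Rightarrow> real \<Rightarrow> real Matrix.vec \<Rightarrow> real" where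
  "lasso_objective \<mu> G r \<rho> = - 2 * (\<mu> \<bullet> \<rho>) + \<rho> \<bullet> (G *\<^sub>v \<rho>) + 2 * r * l1_norm \<rho>"

text \<open>The double minimum, over \<open>J\<close> and then over the cone of \<open>\<rho>\<close>, is at least \<open>c\<close>; written out as a
  bound for every admissible pair.\<close>

definition restricted_eig_ge :: "real Matrix.mat \<Rightarrow> nat \<Rightarrow> nat \<Rightarrow> real \<Rightarrow> bool" where
  "restricted_eig_ge G p s c \<longleftrightarrow>
     (\<forall>J \<subseteq> {..<p}. card J \<le> s \<longrightarrow>
       (\<forall>\<rho> \<in> carrier_vec p.
          (\<Sum>j\<in>{..<p} - J. \<bar>\<rho> $ j\<bar>) \<le> 3 * (\<Sum>j\<in>J. \<bar>\<rho> $ j\<bar>) \<and> (\<exists>j\<in>J. \<rho> $ j \<noteq> 0) \<longrightarrow>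
          (\<rho> \<bullet> (G *\<^sub>v \<rho>)) / (\<Sum>j\<in>J. (\<rho> $ j)\<^sup>2) \<ge> c))"

text \<open>\<open>I n l\<close> is the \<open>l\<close>-th fold of \<open>{..<n}\<close>.  A learner for fold \<open>l\<close> is a function of the
  observations outside that fold, represented as an element of a product space.\<close>

definition cross_fit_folds :: "nat \<Rightarrow> (nat \<Rightarrow> nat \<Rightarrow> nat set) \<Rightarrow> bool" where
  "cross_fit_folds L I \<longleftrightarrow>
     (\<forall>n. (\<Union>l<L. I n l) = {..<n} \<and> disjoint_family_on (I n) {..<L}) \<and>
     (\<forall>l<L. (\<lambda>n. real (card (I n l)) / real n) \<longlonglongrightarrow> 1 / real L)"

definition out_fold :: "(nat \<Rightarrow> nat \<Rightarrow> nat set) \<Rightarrow> nat \<Rightarrow> nat \<Rightarrow> nat set" where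
  "out_fold I n l = {..<n} - I n l"

definition train_sample ::
  "(nat \<Rightarrow> 'a \<Rightarrow> 'w) \<Rightarrow> (nat \<Rightarrow> nat \<Rightarrow> nat set) \<Rightarrow> nat \<Rightarrow> nat \<Rightarrow> 'a \<Rightarrow> nat \<Rightarrow> 'w" where
  "train_sample W I n l \<omega> = (\<lambda>i\<in>out_fold I n l. W i \<omega>)"

definition gamma_hat ::
  "(nat \<Rightarrow> 'a \<Rightarrow> 'w) \<Rightarrow> (nat \<Rightarrow> nat \<Rightarrow> nat set) \<Rightarrow> (nat \<Rightarrow> nat \<Rightarrow> (nat \<Rightarrow> 'w) \<Rightarrow> 'x \<Rightarrow> real)
    \<Rightarrow> nat \<Rightarrow> nat \<Rightarrow> 'a \<Rightarrow> 'x \<Rightarrow> real" where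
  "gamma_hat W I learn n l \<omega> = learn n l (train_sample W I n l \<omega>)"

definition G_hat ::
  "('w \<Rightarrow> 'x) \<Rightarrow> (nat \<Rightarrow> 'x \<Rightarrow> real) \<Rightarrow> (nat \<Rightarrow> nat) \<Rightarrow> (nat \<Rightarrow> 'a \<Rightarrow> 'w) \<Rightarrow> (nat \<Rightarrow> nat \<Rightarrow> nat set)
    \<Rightarrow> nat \<Rightarrow> nat \<Rightarrow> 'a \<Rightarrow> real Matrix.mat" where
  "G_hat X b p W I n l \<omega> = emp_gram X b (p n) (out_fold I n l) (\<lambda>i. W i \<omega>)"

definition M_hat ::
  "('w \<Rightarrow> ('x \<Rightarrow> real) \<Rightarrow> real) \<Rightarrow> (nat \<Rightarrow> 'x \<Rightarrow> real) \<Rightarrow> (nat \<Rightarrow> nat) \<Rightarrow> (nat \<Rightarrow> 'a \<Rightarrow> 'w)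
    \<Rightarrow> (nat \<Rightarrow> nat \<Rightarrow> nat set) \<Rightarrow> nat \<Rightarrow> nat \<Rightarrow> 'a \<Rightarrow> real Matrix.vec" where
  "M_hat m b p W I n l \<omega> = emp_moment m b (p n) (out_fold I n l) (\<lambda>i. W i \<omega>)"

definition rho_hat ::
  "(nat \<Rightarrow> 'a \<Rightarrow> 'w) \<Rightarrow> (nat \<Rightarrow> nat \<Rightarrow> nat set) \<Rightarrow> (nat \<Rightarrow> nat \<Rightarrow> (nat \<Rightarrow> 'w) \<Rightarrow> real Matrix.vec)
    \<Rightarrow> nat \<Rightarrow> nat \<Rightarrow> 'a \<Rightarrow> real Matrix.vec" where
  "rho_hat W I lasso n l \<omega> = lasso n l (train_sample W I n l \<omega>)"

definition alpha_hat ::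
  "(nat \<Rightarrow> 'x \<Rightarrow> real) \<Rightarrow> (nat \<Rightarrow> nat) \<Rightarrow> (nat \<Rightarrow> 'a \<Rightarrow> 'w) \<Rightarrow> (nat \<Rightarrow> nat \<Rightarrow> nat set)
    \<Rightarrow> (nat \<Rightarrow> nat \<Rightarrow> (nat \<Rightarrow> 'w) \<Rightarrow> real Matrix.vec) \<Rightarrow> nat \<Rightarrow> nat \<Rightarrow> 'a \<Rightarrow> 'x \<Rightarrow> real" where
  "alpha_hat b p W I lasso n l \<omega> x = dict_vec b (p n) x \<bullet> rho_hat W I lasso n l \<omega>"

text \<open>A regression learner must be jointly measurable in the training sample and the evaluation
  point, also after applying \<open>m\<close>; this makes the estimators below random variables.\<close>

definition measurable_regression_learner ::
  "'w measure \<Rightarrow> ('w \<Rightarrow> ('x::euclidean_space \<Rightarrow> real) \<Rightarrow> real) \<Rightarrow> (nat \<Rightarrow> nat \<Rightarrow> nat set) \<Rightarrow> nat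
    \<Rightarrow> (nat \<Rightarrow> nat \<Rightarrow> (nat \<Rightarrow> 'w) \<Rightarrow> 'x \<Rightarrow> real) \<Rightarrow> bool" where
  "measurable_regression_learner F m I L learn \<longleftrightarrow>
     (\<forall>n>0. \<forall>l<L.
        (\<lambda>(d, x). learn n l d x)
          \<in> borel_measurable (PiM (out_fold I n l) (\<lambda>_. F) \<Otimes>\<^sub>M borel) \<and>
        (\<lambda>(d, w). m w (learn n l d))
          \<in> borel_measurable (PiM (out_fold I n l) (\<lambda>_. F) \<Otimes>\<^sub>M F))"

definition measurable_coefficients ::
  "'w measure \<Rightarrow> (nat \<Rightarrow> nat) \<Rightarrow> (nat \<Rightarrow> nat \<Rightarrow> nat set) \<Rightarrow> nat
    \<Rightarrow> (nat \<Rightarrow> nat \<Rightarrow> (nat \<Rightarrow> 'w) \<Rightarrow> real Matrix.vec) \<Rightarrow> bool" where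
  "measurable_coefficients F p I L lasso \<longleftrightarrow>
     (\<forall>n>0. \<forall>l<L.
        (\<forall>d. lasso n l d \<in> carrier_vec (p n)) \<and>
        (\<forall>j<p n. (\<lambda>d. lasso n l d $ j) \<in> borel_measurable (PiM (out_fold I n l) (\<lambda>_. F))))"

text \<open>The debiased moment before centering; \<open>\<psi>\<close> is this function at the population
  \<open>\<gamma>\<close> and \<open>\<alpha>\<close>, minus \<open>\<theta>\<close>.\<close>

definition debiased_moment ::
  "('w \<Rightarrow> ('x \<Rightarrow> real) \<Rightarrow> real) \<Rightarrow> ('w \<Rightarrow> 'x) \<Rightarrow> ('w \<Rightarrow> real) \<Rightarrow> ('x \<Rightarrow> real) \<Rightarrow> ('x \<Rightarrow> real)
    \<Rightarrow> 'w \<Rightarrow> real" where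
  "debiased_moment m X Y \<gamma> \<alpha> w = m w \<gamma> + \<alpha> (X w) * (Y w - \<gamma> (X w))"

definition theta_bar ::
  "'w measure \<Rightarrow> ('w \<Rightarrow> ('x \<Rightarrow> real) \<Rightarrow> real) \<Rightarrow> ('x \<Rightarrow> real) \<Rightarrow> real" where
  "theta_bar F m \<gamma> = (\<integral>w. m w \<gamma> \<partial>F)"

definition asym_var ::
  "'w measure \<Rightarrow> ('w \<Rightarrow> ('x \<Rightarrow> real) \<Rightarrow> real) \<Rightarrow> ('w \<Rightarrow> 'x) \<Rightarrow> ('w \<Rightarrow> real)
    \<Rightarrow> ('x \<Rightarrow> real) \<Rightarrow> ('x \<Rightarrow> real) \<Rightarrow> real" where
  "asym_var F m X Y \<gamma> \<alpha> = (\<integral>w. (debiased_moment m X Y \<gamma> \<alpha> w - theta_bar F m \<gamma>)\<^sup>2 \<partial>F)"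

text \<open>In the next two definitions \<open>gh n l \<omega>\<close> and \<open>ah n l \<omega>\<close> are the fitted functions for fold \<open>l\<close>.\<close>

definition theta_hat ::
  "('w \<Rightarrow> ('x \<Rightarrow> real) \<Rightarrow> real) \<Rightarrow> ('w \<Rightarrow> 'x) \<Rightarrow> ('w \<Rightarrow> real) \<Rightarrow> (nat \<Rightarrow> 'a \<Rightarrow> 'w)
    \<Rightarrow> nat \<Rightarrow> (nat \<Rightarrow> nat \<Rightarrow> nat set)
    \<Rightarrow> (nat \<Rightarrow> nat \<Rightarrow> 'a \<Rightarrow> 'x \<Rightarrow> real) \<Rightarrow> (nat \<Rightarrow> nat \<Rightarrow> 'a \<Rightarrow> 'x \<Rightarrow> real) \<Rightarrow> nat \<Rightarrow> 'a \<Rightarrow> real" where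
  "theta_hat m X Y W L I gh ah n \<omega> =
     (\<Sum>l<L. \<Sum>i\<in>I n l. debiased_moment m X Y (gh n l \<omega>) (ah n l \<omega>) (W i \<omega>)) / real n"

definition V_hat ::
  "('w \<Rightarrow> ('x \<Rightarrow> real) \<Rightarrow> real) \<Rightarrow> ('w \<Rightarrow> 'x) \<Rightarrow> ('w \<Rightarrow> real) \<Rightarrow> (nat \<Rightarrow> 'a \<Rightarrow> 'w)
    \<Rightarrow> nat \<Rightarrow> (nat \<Rightarrow> nat \<Rightarrow> nat set)
    \<Rightarrow> (nat \<Rightarrow> nat \<Rightarrow> 'a \<Rightarrow> 'x \<Rightarrow> real) \<Rightarrow> (nat \<Rightarrow> nat \<Rightarrow> 'a \<Rightarrow> 'x \<Rightarrow> real) \<Rightarrow> nat \<Rightarrow> 'a \<Rightarrow> real" where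
  "V_hat m X Y W L I gh ah n \<omega> =
     (\<Sum>l<L. \<Sum>i\<in>I n l. (debiased_moment m X Y (gh n l \<omega>) (ah n l \<omega>) (W i \<omega>)
                         - theta_hat m X Y W L I gh ah n \<omega>)\<^sup>2) / real n"

definition eps :: "(nat \<Rightarrow> nat) \<Rightarrow> nat \<Rightarrow> real" where
  "eps p n = sqrt (ln (real (p n)) / real n)"

definition sparse_approximation ::
  "'w measure \<Rightarrow> ('w \<Rightarrow> 'x) \<Rightarrow> (nat \<Rightarrow> 'x \<Rightarrow> real) \<Rightarrow> (nat \<Rightarrow> nat) \<Rightarrow> ('x \<Rightarrow> real) \<Rightarrow> real \<Rightarrow> bool" where
  "sparse_approximation F X b p \<alpha> \<xi> \<longleftrightarrow>
     (\<exists>C>1. \<forall>n>0. \<forall>s::nat. 0 < s \<and> real s \<le> C * eps p n powr (- 2 / (2 * \<xi> + 1)) \<longrightarrow>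
        (\<exists>\<rho> \<in> carrier_vec (p n). card {j. j < p n \<and> \<rho> $ j \<noteq> 0} = s \<and>
           L2_norm_of F (\<lambda>w. \<alpha> (X w) - dict_vec b (p n) (X w) \<bullet> \<rho>) \<le> C * real s powr (- \<xi>)))"

definition gram_conditions ::
  "'a measure \<Rightarrow> 'w measure \<Rightarrow> ('w \<Rightarrow> 'x) \<Rightarrow> (nat \<Rightarrow> 'x \<Rightarrow> real) \<Rightarrow> (nat \<Rightarrow> nat)
    \<Rightarrow> (nat \<Rightarrow> 'a \<Rightarrow> 'w) \<Rightarrow> nat \<Rightarrow> (nat \<Rightarrow> nat \<Rightarrow> nat set) \<Rightarrow> bool" where
  "gram_conditions M F X b p W L I \<longleftrightarrow>
     (\<exists>C. \<forall>n>0. \<forall>k. eigenvalue (pop_gram F X b (p n)) k \<longrightarrow> k \<le> C) \<and>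
     (\<exists>C>0. \<exists>c>0. \<forall>l<L. \<forall>s::nat \<Rightarrow> nat. (\<lambda>n. real (s n) * (eps p n)\<^sup>2) \<longlonglongrightarrow> C \<longrightarrow>
        wp_approaching_one M (\<lambda>n \<omega>. restricted_eig_ge (G_hat X b p W I n l \<omega>) (p n) (s n) c))"

text \<open>\<open>J\<close> is a set of \<open>\<lfloor>C \<surd>n\<rfloor>\<close> indices with the largest values of \<open>\<bar>\<rho>0 j\<bar>\<close>, all below \<open>p n\<close>;
  the existential quantifier over \<open>J\<close> only matters for ties.\<close>

definition abs_summable_representation ::
  "'w measure \<Rightarrow> ('w \<Rightarrow> 'x) \<Rightarrow> (nat \<Rightarrow> 'x \<Rightarrow> real) \<Rightarrow> (nat \<Rightarrow> nat) \<Rightarrow> ('x \<Rightarrow> real) \<Rightarrow> bool" where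
  "abs_summable_representation F X b p \<alpha> \<longleftrightarrow>
     (\<exists>\<rho>0 :: nat \<Rightarrow> real.
        (AE w in F. (\<lambda>j. \<rho>0 j * b j (X w)) sums \<alpha> (X w)) \<and> summable (\<lambda>j. \<bar>\<rho>0 j\<bar>) \<and>
        (\<exists>C>0. \<forall>n>0. \<exists>J \<subseteq> {..<p n}. card J = nat \<lfloor>C * sqrt (real n)\<rfloor> \<and>
           (\<forall>j\<in>J. \<forall>k. k \<notin> J \<longrightarrow> \<bar>\<rho>0 k\<bar> \<le> \<bar>\<rho>0 j\<bar>)))"

end

theory Submission
  imports Defs "HOL-Real_Asymp.Real_Asymp"
begin

text \<open>
  Given the observations outside a fold, the error of the estimated moment function on that fold
  splits into two terms of conditional mean zero (\<open>\<alpha>\<close> and \<open>\<gamma>\<close> are projections on \<open>\<Gamma>\<close>) and the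
  product of the errors of the two learners. The former are negligible after scaling with \<open>\<surd>n\<close> as
  soon as both learners are consistent, the latter is because the two rates multiply to
  \<open>o(1/\<surd>n)\<close>; what is left is the central limit theorem for \<open>\<psi>\<close>.

  The rate of the lasso starts from a basic inequality in which the approximation error enters only
  through its empirical norm. Under absolute summability the \<open>\<ell>\<^sub>1\<close> norm of the coefficients stays
  bounded, which gives the rate \<open>\<surd>r\<close>. Under sparse approximation the restricted eigenvalue condition,
  available for sets of size \<open>\<epsilon>\<^sup>-\<^sup>2\<close> much larger than the sparsity used, is transferred from sparse
  to arbitrary vectors by Maurey's empirical method; this bounds the Euclidean error of the
  coefficients, and the largest eigenvalue of \<open>G\<close> turns it into a bound on \<open>\<alpha>\<close>.
\<close>

section \<open>Convergence in probability\<close>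

text \<open>The obstacle is the sparse approximant of \<open>\<alpha>bar\<close>: it comes with an
  L2 error but no bound on its sup norm or on the l1 norm of its coefficients, so exponential
  inequalities do not apply to it. Its population error is carried to the sample by Markov's
  inequality, and \<open>eps p \<in> o(r)\<close> pays for the loss: at the chosen sparsity s the
  squared bias is of order eps^2 s, the target is r^2 s. The same slack keeps the noise in the score
  below a fixed fraction of the penalty.

  Rates are finally weakened to powers of n. As r and eps are at most n^(-1/2) up to arbitrarily
  small powers, constants and logarithms disappear, and only the strict inequalities between
  exponents matter.

  Conditioning on the training observations is done by Fubini's theorem for the product law of two
  disjoint blocks, with the training block frozen inside a measurable set of good samples.

  The variance estimator asks for more than the limit law does: a product of two functions small in
  L2 need not be small in L2. A sup bound on the fitted \<alpha> closes the gap; under absolute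
  summability it follows from the bounded l1 norm and the bounded dictionary.\<close>

text \<open>An inner probability, so that no event has to be measurable. It is implied by
  \<open>wp_approaching_one\<close> because \<open>measure\<close> is 0 on non-measurable sets.\<close>

definition whp :: "'a measure \<Rightarrow> (nat \<Rightarrow> 'a \<Rightarrow> bool) \<Rightarrow> bool" where
  "whp M P \<longleftrightarrow> (\<exists>A. (\<forall>n. A n \<in> sets M) \<and> (\<forall>n. \<forall>\<omega>\<in>A n. P n \<omega>) \<and>
      (\<lambda>n. measure M (A n)) \<longlonglongrightarrow> 1)"

lemma whp_of_wp_approaching_one:
  assumes "wp_approaching_one M P"
  shows "whp M P"
proof -
  let ?S = "\<lambda>n. {\<omega> \<in> space M. P n \<omega>}"
  define A where "A n = (if ?S n \<in> sets M then ?S n else {})" for n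
  have "measure M (A n) = measure M (?S n)" for n
    by (simp add: A_def measure_notin_sets)
  then have "(\<lambda>n. measure M (A n)) \<longlonglongrightarrow> 1"
    using assms by (simp add: wp_approaching_one_def)
  moreover have "A n \<in> sets M" "\<And>\<omega>. \<omega> \<in> A n \<Longrightarrow> P n \<omega>" for n
    by (auto simp: A_def split: if_splits)
  ultimately show ?thesis
    unfolding whp_def by blast
qed

lemma whp_mono:
  assumes "whp M P" and ev: "\<forall>\<^sub>F n in sequentially. \<forall>\<omega>\<in>space M. P n \<omega> \<longrightarrow> Q n \<omega>"
  shows "whp M Q"
proof -
  obtain A where A: "\<And>n. A n \<in> sets M" "\<And>n \<omega>. \<omega> \<in> A n \<Longrightarrow> P n \<omega>" "(\<lambda>n. measure M (A n)) \<longlonglongrightarrow> 1"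
    using assms(1) unfolding whp_def by blast
  \<comment> \<open>The implication fails for finitely many \<open>n\<close> only; there the empty
    set serves as witness, which leaves the limit unchanged.\<close>
  define B where "B n = (if (\<forall>\<omega>\<in>space M. P n \<omega> \<longrightarrow> Q n \<omega>) then A n else {})" for n
  have "\<forall>\<^sub>F n in sequentially. measure M (A n) = measure M (B n)"
    using ev by eventually_elim (simp add: B_def)
  then have "(\<lambda>n. measure M (B n)) \<longlonglongrightarrow> 1"
    using A(3) by (rule Lim_transform_eventually[rotated])
  moreover have "B n \<in> sets M" for n
    using A(1) by (simp add: B_def)
  moreover have "Q n \<omega>" if "\<omega> \<in> B n" for n \<omega>
    using that A(2)[of \<omega> n] sets.sets_into_space[OF A(1)[of n]] by (auto simp: B_def split: if_splits)
  ultimately show ?thesis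
    unfolding whp_def by blast
qed

lemma whp_mono_ev:
  "whp M P \<Longrightarrow> \<forall>\<^sub>F n in sequentially. E n \<Longrightarrow>
    (\<And>n \<omega>. \<omega> \<in> space M \<Longrightarrow> E n \<Longrightarrow> P n \<omega> \<Longrightarrow> Q n \<omega>) \<Longrightarrow> whp M Q"
  by (erule whp_mono) (auto elim: eventually_mono)

lemma whp_mono': "whp M P \<Longrightarrow> (\<And>n \<omega>. \<omega> \<in> space M \<Longrightarrow> P n \<omega> \<Longrightarrow> Q n \<omega>) \<Longrightarrow> whp M Q"
  by (erule whp_mono) auto

context prob_space
begin

lemma whp_conj:
  assumes "whp M P" "whp M Q"
  shows "whp M (\<lambda>n \<omega>. P n \<omega> \<and> Q n \<omega>)"
proof -
  obtain A where A: "\<And>n. A n \<in> sets M" "\<And>n \<omega>. \<omega> \<in> A n \<Longrightarrow> P n \<omega>" "(\<lambda>n. measure M (A n)) \<longlonglongrightarrow> 1"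
    using assms(1) unfolding whp_def by blast
  obtain B where B: "\<And>n. B n \<in> sets M" "\<And>n \<omega>. \<omega> \<in> B n \<Longrightarrow> Q n \<omega>" "(\<lambda>n. measure M (B n)) \<longlonglongrightarrow> 1"
    using assms(2) unfolding whp_def by blast
  have lower: "prob (A n) + prob (B n) - 1 \<le> prob (A n \<inter> B n)" for n
  proof -
    have "prob (A n \<union> B n) \<le> 1" by simp
    moreover have "prob (A n \<union> B n) = prob (A n) + prob (B n) - prob (A n \<inter> B n)"
      using A(1) B(1) by (intro measure_Un3) (auto simp: fmeasurable_eq_sets)
    ultimately show ?thesis by simp
  qed
  have "(\<lambda>n. prob (A n) + prob (B n) - 1) \<longlonglongrightarrow> 1 + 1 - 1"
    by (intro tendsto_intros A B)
  then have "(\<lambda>n. prob (A n \<inter> B n)) \<longlonglongrightarrow> 1"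
    using tendsto_sandwich[OF always_eventually[OF allI[OF lower]] always_eventually _ tendsto_const[of 1]]
    by simp
  then show ?thesis
    unfolding whp_def using A B by (intro exI[of _ "\<lambda>n. A n \<inter> B n"]) auto
qed

lemma whp_all_less:
  assumes "\<And>l. l < (k::nat) \<Longrightarrow> whp M (P l)"
  shows "whp M (\<lambda>n \<omega>. \<forall>l<k. P l n \<omega>)"
  using assms
proof (induction k)
  case 0
  show ?case
    unfolding whp_def by (intro exI[of _ "\<lambda>_. space M"]) (auto simp: prob_space)
next
  case (Suc k)
  have "whp M (\<lambda>n \<omega>. (\<forall>l<k. P l n \<omega>) \<and> P k n \<omega>)"
    by (intro whp_conj Suc) auto
  then show ?case
    by (rule whp_mono') (auto simp: less_Suc_eq)
qed

text \<open>Probability inequalities bound the measure of the bad event. Its measurability belongs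
  to the hypothesis because \<open>measure\<close> is 0 on non-measurable sets, where a bound says
  nothing.\<close>

lemma whpI_bound:
  assumes ev: "\<forall>\<^sub>F n in sequentially. {\<omega>\<in>space M. \<not> P n \<omega>} \<in> events \<and> prob {\<omega>\<in>space M. \<not> P n \<omega>} \<le> q n"
    and q: "q \<longlonglongrightarrow> 0"
  shows "whp M P"
proof -
  define B where "B n = {\<omega>\<in>space M. \<not> P n \<omega>}" for n
  define A where "A n = (if B n \<in> events then space M - B n else {})" for n
  have lower: "\<forall>\<^sub>F n in sequentially. 1 - q n \<le> prob (A n)"
    using ev
  proof eventually_elim
    case (elim n)
    then have "B n \<in> events" "prob (B n) \<le> q n"
      by (auto simp: B_def)
    then show ?case
      by (simp add: A_def prob_compl)
  qed
  have "(\<lambda>n. 1 - q n) \<longlonglongrightarrow> 1 - 0"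
    by (intro tendsto_intros q)
  then have "(\<lambda>n. prob (A n)) \<longlonglongrightarrow> 1"
    using tendsto_sandwich[OF lower always_eventually _ tendsto_const[of 1]] by simp
  moreover have "A n \<in> events" "\<And>\<omega>. \<omega> \<in> A n \<Longrightarrow> P n \<omega>" for n
    by (auto simp: A_def B_def split: if_splits)
  ultimately show ?thesis
    unfolding whp_def by blast
qed

lemma whp_AE:
  assumes "\<And>n. AE \<omega> in M. P n \<omega>"
  shows "whp M P"
proof -
  have "\<exists>A. A \<in> events \<and> (\<forall>\<omega>\<in>A. P n \<omega>) \<and> prob A = 1" for n
  proof -
    obtain A where "A \<subseteq> {\<omega> \<in> space M. P n \<omega>}" "A \<in> events" "prob A = 1"
      using AE_E_prob[OF assms[of n]] .
    then show ?thesis by blast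
  qed
  then obtain A where "\<And>n. A n \<in> events \<and> (\<forall>\<omega>\<in>A n. P n \<omega>) \<and> prob (A n) = 1"
    by metis
  then show ?thesis
    unfolding whp_def by (intro exI[of _ A]) auto
qed

text \<open>A measurable bad event lies in the complement of the witness, and a non-measurable one
  has measure 0 by convention.\<close>

lemma prob_bad_tendsto_0:
  assumes "whp M P"
  shows "(\<lambda>n. prob {\<omega>\<in>space M. \<not> P n \<omega>}) \<longlonglongrightarrow> 0"
proof -
  obtain A where A: "\<And>n. A n \<in> sets M" "\<And>n \<omega>. \<omega> \<in> A n \<Longrightarrow> P n \<omega>" "(\<lambda>n. measure M (A n)) \<longlonglongrightarrow> 1"
    using assms(1) unfolding whp_def by blast
  have upper: "prob {\<omega>\<in>space M. \<not> P n \<omega>} \<le> 1 - prob (A n)" for n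
  proof (cases "{\<omega>\<in>space M. \<not> P n \<omega>} \<in> events")
    case True
    have "prob {\<omega>\<in>space M. \<not> P n \<omega>} \<le> prob (space M - A n)"
      using A by (intro finite_measure_mono) auto
    then show ?thesis
      using A(1) by (simp add: prob_compl)
  qed (simp add: measure_notin_sets)
  have "(\<lambda>n. 1 - prob (A n)) \<longlonglongrightarrow> 1 - 1"
    by (intro tendsto_intros A)
  then show ?thesis
    using tendsto_sandwich[OF always_eventually always_eventually[OF allI[OF upper]] tendsto_const[of 0]]
    by simp
qed

lemma tendsto_in_prob_whp:
  assumes "\<And>e. e > 0 \<Longrightarrow> whp M (\<lambda>n \<omega>. \<bar>Z n \<omega> - c\<bar> \<le> e)"
  shows "tendsto_in_prob M Z c"
  using prob_bad_tendsto_0[OF assms] by (simp add: tendsto_in_prob_def not_le)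

text \<open>The guard \<open>n > 0\<close> recurs below: learners are measurable by assumption for
  positive \<open>n\<close> only.\<close>

lemma whp_of_tendsto_in_prob_0:
  assumes "tendsto_in_prob_0 M Z" and "\<And>n. n > 0 \<Longrightarrow> Z n \<in> borel_measurable M" and "e > 0"
  shows "whp M (\<lambda>n \<omega>. Z n \<omega> \<le> ennreal e)"
proof (rule whpI_bound)
  show "(\<lambda>n. prob {\<omega> \<in> space M. Z n \<omega> > ennreal e}) \<longlonglongrightarrow> 0"
    using assms by (simp add: tendsto_in_prob_0_def)
  show "\<forall>\<^sub>F n in sequentially. {\<omega> \<in> space M. \<not> Z n \<omega> \<le> ennreal e} \<in> events \<and>
      prob {\<omega> \<in> space M. \<not> Z n \<omega> \<le> ennreal e} \<le> prob {\<omega> \<in> space M. Z n \<omega> > ennreal e}"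
    using eventually_gt_at_top[of 0]
  proof eventually_elim
    case (elim n)
    note [measurable] = assms(2)[OF elim]
    show ?case by (auto simp: not_le)
  qed
qed

text \<open>Giving up a power of \<open>n\<close>, however small, absorbs the constant
  \<open>K\<close> of the stochastic order, which depends on the tolerated probability.\<close>

lemma whp_of_bigo_in_prob:
  assumes O: "bigo_in_prob M Z (\<lambda>n. real n powr (- d))"
    and meas: "\<And>n. n > 0 \<Longrightarrow> Z n \<in> borel_measurable M" and "d' < d"
  shows "whp M (\<lambda>n \<omega>. \<bar>Z n \<omega>\<bar> \<le> real n powr (- d'))"
proof (rule whpI_bound[where q = "\<lambda>n. prob {\<omega> \<in> space M. \<bar>Z n \<omega>\<bar> > real n powr (- d')}"])
  show "\<forall>\<^sub>F n in sequentially. {\<omega> \<in> space M. \<not> \<bar>Z n \<omega>\<bar> \<le> real n powr (- d')} \<in> events \<and>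
      prob {\<omega> \<in> space M. \<not> \<bar>Z n \<omega>\<bar> \<le> real n powr (- d')} \<le> prob {\<omega> \<in> space M. \<bar>Z n \<omega>\<bar> > real n powr (- d')}"
    using eventually_gt_at_top[of 0]
  proof eventually_elim
    case (elim n)
    note [measurable] = meas[OF elim]
    show ?case by (auto simp: not_le)
  qed
  show "(\<lambda>n. prob {\<omega> \<in> space M. \<bar>Z n \<omega>\<bar> > real n powr (- d')}) \<longlonglongrightarrow> 0"
  proof (rule tendstoI)
    fix \<delta> :: real assume "\<delta> > 0"
    then obtain K where K: "K > 0"
      "\<forall>\<^sub>F n in sequentially. prob {\<omega> \<in> space M. \<bar>Z n \<omega>\<bar> > K * \<bar>real n powr (- d)\<bar>} < \<delta>"
      using O unfolding bigo_in_prob_def by blast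
    have "(\<lambda>n. real n powr (d' - d)) \<longlonglongrightarrow> 0"
      using \<open>d' < d\<close> by (intro tendsto_neg_powr filterlim_real_sequentially) auto
    then have "\<forall>\<^sub>F n in sequentially. real n powr (d' - d) < 1 / K"
      using K(1) by (intro order_tendstoD(2)) auto
    then show "\<forall>\<^sub>F n in sequentially. dist (prob {\<omega> \<in> space M. \<bar>Z n \<omega>\<bar> > real n powr (- d')}) 0 < \<delta>"
      using K(2) eventually_gt_at_top[of 0]
    proof eventually_elim
      case (elim n)
      note [measurable] = meas[OF elim(3)]
      have "K * real n powr (- d) = K * real n powr (d' - d) * real n powr (- d')"
        using elim(3) by (simp flip: powr_add)
      also have "\<dots> \<le> 1 * real n powr (- d')"
        using elim(1) K(1) by (intro mult_right_mono) (auto simp: field_simps)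
      finally have "prob {\<omega> \<in> space M. \<bar>Z n \<omega>\<bar> > real n powr (- d')}
          \<le> prob {\<omega> \<in> space M. \<bar>Z n \<omega>\<bar> > K * \<bar>real n powr (- d)\<bar>}"
        by (intro finite_measure_mono) auto
      with elim(2) show ?case by simp
    qed
  qed
qed

end

section \<open>Independent samples and sample splitting\<close>

locale iid_sample = prob_space M for M :: "'a measure" +
  fixes F :: "'w measure" and W :: "nat \<Rightarrow> 'a \<Rightarrow> 'w"
  assumes indep: "indep_vars (\<lambda>_. F) W UNIV"
    and ident: "\<And>i. distr M F (W i) = F"
begin

lemma measurable_W [measurable]: "W i \<in> measurable M F"
  using indep by (simp add: indep_vars_def)

lemma prob_space_F: "prob_space F"
  using prob_space_distr[OF measurable_W[of 0]] by (simp add: ident)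

lemma integrable_W_iff: "f \<in> borel_measurable F \<Longrightarrow> integrable M (\<lambda>\<omega>. f (W i \<omega>)) \<longleftrightarrow> integrable F f"
  for f :: "'w \<Rightarrow> real"
  using integrable_distr_eq[OF measurable_W[of i], of f] by (simp add: ident)

lemma integrable_W: "integrable F f \<Longrightarrow> integrable M (\<lambda>\<omega>. f (W i \<omega>))"
  for f :: "'w \<Rightarrow> real"
  by (simp add: integrable_W_iff)

lemma integral_W: "f \<in> borel_measurable F \<Longrightarrow> (\<integral>\<omega>. f (W i \<omega>) \<partial>M) = (\<integral>w. f w \<partial>F)"
  for f :: "'w \<Rightarrow> real"
  using integral_distr[OF measurable_W[of i], of f] by (simp add: ident)

lemma AE_W: "AE w in F. P w \<Longrightarrow> AE \<omega> in M. P (W i \<omega>)"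
  by (rule AE_distrD[OF measurable_W, unfolded ident])

lemma indep_vars_comp:
  assumes "f \<in> borel_measurable F"
  shows "indep_vars (\<lambda>_. borel) (\<lambda>i \<omega>. f (W i \<omega>)) T"
proof -
  have "indep_vars (\<lambda>_. F) W T"
    using indep by (rule indep_vars_subset) simp
  then show ?thesis
    using assms by (rule indep_vars_compose2)
qed

text \<open>By independence and centering, products with different indices integrate to zero and
  only the diagonal survives.\<close>

lemma second_moment_sum:
  fixes f :: "'w \<Rightarrow> real"
  assumes meas [measurable]: "f \<in> borel_measurable F" and sq: "integrable F (\<lambda>w. (f w)\<^sup>2)"
    and mean: "(\<integral>w. f w \<partial>F) = 0" and T: "finite T"
  shows "integrable M (\<lambda>\<omega>. (\<Sum>i\<in>T. f (W i \<omega>))\<^sup>2)"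
    and "(\<integral>\<omega>. (\<Sum>i\<in>T. f (W i \<omega>))\<^sup>2 \<partial>M) = card T * (\<integral>w. (f w)\<^sup>2 \<partial>F)"
proof -
  interpret F: prob_space F by (rule prob_space_F)
  have f: "integrable F f"
    using sq by (rule F.square_integrable_imp_integrable[OF meas])
  have cross: "integrable M (\<lambda>\<omega>. f (W i \<omega>) * f (W j \<omega>)) \<and>
      (\<integral>\<omega>. f (W i \<omega>) * f (W j \<omega>) \<partial>M) = (if i = j then \<integral>w. (f w)\<^sup>2 \<partial>F else 0)" for i j
  proof (cases "i = j")
    case True
    then show ?thesis
      using integrable_W[OF sq, of j] integral_W[of "\<lambda>w. (f w)\<^sup>2" j] by (simp add: power2_eq_square)
  next
    case False
    \<comment> \<open>Pairwise independence is obtained from the blocks \<open>{i}\<close> and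
      \<open>{j}\<close>, composed with evaluation at the only index of each.\<close>
    have "indep_var borel ((\<lambda>d. f (d i)) \<circ> (\<lambda>\<omega>. \<lambda>i\<in>{i}. W i \<omega>)) borel ((\<lambda>d. f (d j)) \<circ> (\<lambda>\<omega>. \<lambda>i\<in>{j}. W i \<omega>))"
      using False by (intro indep_var_compose[OF indep_var_restrict[OF indep]]) auto
    then have ind: "indep_var borel (\<lambda>\<omega>. f (W i \<omega>)) borel (\<lambda>\<omega>. f (W j \<omega>))"
      by (simp add: comp_def)
    show ?thesis
      using indep_var_lebesgue_integral[OF ind integrable_W[OF f] integrable_W[OF f]]
        indep_var_integrable[OF ind integrable_W[OF f] integrable_W[OF f]] False
      by (simp add: integral_W mean)
  qed
  have eq: "(\<Sum>i\<in>T. f (W i \<omega>))\<^sup>2 = (\<Sum>i\<in>T. \<Sum>j\<in>T. f (W i \<omega>) * f (W j \<omega>))" for \<omega>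
    by (simp add: power2_eq_square sum_product)
  show "integrable M (\<lambda>\<omega>. (\<Sum>i\<in>T. f (W i \<omega>))\<^sup>2)"
    unfolding eq using cross by (intro Bochner_Integration.integrable_sum) auto
  have "(\<integral>\<omega>. (\<Sum>i\<in>T. f (W i \<omega>))\<^sup>2 \<partial>M) = (\<Sum>i\<in>T. \<Sum>j\<in>T. if i = j then \<integral>w. (f w)\<^sup>2 \<partial>F else 0)"
    unfolding eq using cross by (simp add: Bochner_Integration.integral_sum)
  also have "\<dots> = card T * (\<integral>w. (f w)\<^sup>2 \<partial>F)"
    using T by simp
  finally show "(\<integral>\<omega>. (\<Sum>i\<in>T. f (W i \<omega>))\<^sup>2 \<partial>M) = card T * (\<integral>w. (f w)\<^sup>2 \<partial>F)" .
qed

lemma Chebyshev_sum: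
  fixes f :: "'w \<Rightarrow> real" and t :: real
  assumes meas [measurable]: "f \<in> borel_measurable F" and sq: "integrable F (\<lambda>w. (f w)\<^sup>2)"
    and mean: "(\<integral>w. f w \<partial>F) = 0" and T: "finite T" and "t > 0"
  shows "prob {\<omega>\<in>space M. \<bar>\<Sum>i\<in>T. f (W i \<omega>)\<bar> > t} \<le> card T * (\<integral>w. (f w)\<^sup>2 \<partial>F) / t\<^sup>2"
proof -
  have "prob {\<omega>\<in>space M. \<bar>\<Sum>i\<in>T. f (W i \<omega>)\<bar> > t} \<le> prob {\<omega>\<in>space M. (\<Sum>i\<in>T. f (W i \<omega>))\<^sup>2 \<ge> t\<^sup>2}"
  proof (intro finite_measure_mono)
    show "{\<omega> \<in> space M. t < \<bar>\<Sum>i\<in>T. f (W i \<omega>)\<bar>} \<subseteq> {\<omega> \<in> space M. t\<^sup>2 \<le> (\<Sum>i\<in>T. f (W i \<omega>))\<^sup>2}"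
      using \<open>t > 0\<close> by (auto simp: abs_le_square_iff[symmetric])
  qed measurable
  also have "\<dots> \<le> card T * (\<integral>w. (f w)\<^sup>2 \<partial>F) / t\<^sup>2"
    using integral_Markov_inequality_measure[OF second_moment_sum(1)[OF meas sq mean T] sets.empty_sets, of "t\<^sup>2"]
      second_moment_sum(2)[OF meas sq mean T] \<open>t > 0\<close> by simp
  finally show ?thesis .
qed

text \<open>The counterpart of the previous bound for nonnegative terms of which only the mean is
  controlled: truncation excesses, squared approximation errors, products of errors.\<close>

lemma Markov_sum:
  fixes f :: "'w \<Rightarrow> real" and t :: real
  assumes f: "integrable F f" and nonneg: "\<And>w. f w \<ge> 0" and T: "finite T" and "t > 0"
  shows "prob {\<omega>\<in>space M. (\<Sum>i\<in>T. f (W i \<omega>)) > t} \<le> card T * (\<integral>w. f w \<partial>F) / t"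
proof -
  have [measurable]: "f \<in> borel_measurable F"
    using f by simp
  have int: "integrable M (\<lambda>\<omega>. \<Sum>i\<in>T. f (W i \<omega>))"
    using integrable_W[OF f] by simp
  have "(\<integral>\<omega>. (\<Sum>i\<in>T. f (W i \<omega>)) \<partial>M) = card T * (\<integral>w. f w \<partial>F)"
    using integrable_W[OF f] by (simp add: Bochner_Integration.integral_sum integral_W)
  then have "prob {\<omega>\<in>space M. (\<Sum>i\<in>T. f (W i \<omega>)) \<ge> t} \<le> card T * (\<integral>w. f w \<partial>F) / t"
    using integral_Markov_inequality_measure[OF int sets.empty_sets _ \<open>t > 0\<close>] by (simp add: nonneg sum_nonneg)
  moreover have "prob {\<omega>\<in>space M. (\<Sum>i\<in>T. f (W i \<omega>)) > t} \<le> prob {\<omega>\<in>space M. (\<Sum>i\<in>T. f (W i \<omega>)) \<ge> t}"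
    by (intro finite_measure_mono) auto
  ultimately show ?thesis by simp
qed

text \<open>Hoeffding's inequality on the interval [-C, C]: the squared lengths add up to 4 C^2 per
  observation, which gives the denominator \<open>2 * C\<^sup>2\<close>.\<close>

lemma Hoeffding_mean:
  fixes f :: "'w \<Rightarrow> real" and t C :: real
  assumes meas [measurable]: "f \<in> borel_measurable F" and bound: "AE w in F. \<bar>f w\<bar> \<le> C" and "C > 0"
    and T: "finite T" "T \<noteq> {}" and "t \<ge> 0"
  shows "prob {\<omega>\<in>space M. \<bar>(\<Sum>i\<in>T. f (W i \<omega>)) / card T - (\<integral>w. f w \<partial>F)\<bar> \<ge> t}
    \<le> 2 * exp (- (card T * t\<^sup>2 / (2 * C\<^sup>2)))"
proof -
  interpret H: Hoeffding_ineq M T "\<lambda>i \<omega>. f (W i \<omega>)" "\<lambda>_. - C" "\<lambda>_. C" "\<Sum>i\<in>T. expectation (\<lambda>\<omega>. f (W i \<omega>))"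
  proof unfold_locales
    fix i
    have "AE \<omega> in M. \<bar>f (W i \<omega>)\<bar> \<le> C"
      using bound by (rule AE_W)
    then show "AE \<omega> in M. f (W i \<omega>) \<in> {- C..C}"
      by eventually_elim auto
  qed (auto simp: T indep_vars_comp)
  have card: "real (card T) > 0"
    using T by (simp add: card_gt_0_iff)
  have sum_sq: "(\<Sum>i\<in>T. (C - - C)\<^sup>2) = card T * (4 * C\<^sup>2)"
    by (simp add: power2_eq_square)
  have "prob {\<omega>\<in>space M. \<bar>(\<Sum>i\<in>T. f (W i \<omega>)) / card T - (\<integral>w. f w \<partial>F)\<bar> \<ge> t}
      = prob {\<omega>\<in>space M. \<bar>(\<Sum>i\<in>T. f (W i \<omega>)) - card T * (\<integral>w. f w \<partial>F)\<bar> \<ge> card T * t}"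
  proof (intro arg_cong[where f = prob] Collect_cong conj_cong refl)
    fix \<omega>
    have "(\<Sum>i\<in>T. f (W i \<omega>)) / card T - (\<integral>w. f w \<partial>F)
        = ((\<Sum>i\<in>T. f (W i \<omega>)) - card T * (\<integral>w. f w \<partial>F)) / card T"
      using card by (simp add: field_simps)
    then show "t \<le> \<bar>(\<Sum>i\<in>T. f (W i \<omega>)) / card T - (\<integral>w. f w \<partial>F)\<bar> \<longleftrightarrow>
        card T * t \<le> \<bar>(\<Sum>i\<in>T. f (W i \<omega>)) - card T * (\<integral>w. f w \<partial>F)\<bar>"
      using card by (simp add: pos_le_divide_eq mult.commute)
  qed
  also have "\<dots> \<le> 2 * exp (- 2 * (card T * t)\<^sup>2 / (\<Sum>i\<in>T. (C - - C)\<^sup>2))"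
    using H.Hoeffding_ineq_abs_ge[of "card T * t"] sum_sq card \<open>C > 0\<close> \<open>t \<ge> 0\<close> by (simp add: integral_W)
  also have "- 2 * (card T * t)\<^sup>2 / (\<Sum>i\<in>T. (C - - C)\<^sup>2) = - (card T * t\<^sup>2 / (2 * C\<^sup>2))"
    unfolding sum_sq using card \<open>C > 0\<close> by (simp add: field_simps power2_eq_square)
  finally show ?thesis .
qed

text \<open>Hoeffding's inequality and a union bound. At most p^2 functions are involved, so that
  pairs of dictionary functions are covered. As eps = o(r), the exponent eventually exceeds
  \<open>(2 + k) * ln (p n)\<close> for every \<open>k\<close>, which leaves a bound of 2 / p^k.
  Since \<open>p\<close> may stay bounded, this tends to 0 by letting \<open>k\<close> grow, with p
  at least 2.\<close>

lemma whp_uniform_mean: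
  fixes f :: "nat \<Rightarrow> 'j \<Rightarrow> 'w \<Rightarrow> real" and c C \<delta> :: real
  assumes meas: "\<And>n j. j \<in> J n \<Longrightarrow> f n j \<in> borel_measurable F"
    and bound: "\<And>n j. n > 0 \<Longrightarrow> j \<in> J n \<Longrightarrow> AE w in F. \<bar>f n j w\<bar> \<le> C" and "C > 0"
    and J: "\<And>n. finite (J n)" "\<And>n. card (J n) \<le> (p n)\<^sup>2" and p: "\<And>n. n > 0 \<Longrightarrow> p n \<ge> 2"
    and T: "\<And>n. finite (T n)" "\<forall>\<^sub>F n in sequentially. c * real n \<le> card (T n)" "c > 0"
    and r: "eps p \<in> o(r)" "\<And>n. n > 0 \<Longrightarrow> r n > 0" and "\<delta> > 0"
  shows "whp M (\<lambda>n \<omega>. \<forall>j\<in>J n. \<bar>(\<Sum>i\<in>T n. f n j (W i \<omega>)) / card (T n) - (\<integral>w. f n j w \<partial>F)\<bar> \<le> \<delta> * r n)"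
    (is "whp M ?P")
proof (rule whpI_bound)
  let ?bad = "\<lambda>n. {\<omega>\<in>space M. \<not> ?P n \<omega>}"
  let ?B = "\<lambda>n j. {\<omega>\<in>space M. \<bar>(\<Sum>i\<in>T n. f n j (W i \<omega>)) / card (T n) - (\<integral>w. f n j w \<partial>F)\<bar> \<ge> \<delta> * r n}"
  have bad_ev: "?bad n \<in> events" for n
  proof -
    have "{\<omega>\<in>space M. \<not> \<bar>(\<Sum>i\<in>T n. f n j (W i \<omega>)) / card (T n) - (\<integral>w. f n j w \<partial>F)\<bar> \<le> \<delta> * r n} \<in> events"
      if "j \<in> J n" for j
      using meas[OF that] by measurable
    then have "(\<Union>j\<in>J n. {\<omega>\<in>space M. \<not> \<bar>(\<Sum>i\<in>T n. f n j (W i \<omega>)) / card (T n) - (\<integral>w. f n j w \<partial>F)\<bar> \<le> \<delta> * r n}) \<in> events"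
      using J(1) by blast
    also have "(\<Union>j\<in>J n. {\<omega>\<in>space M. \<not> \<bar>(\<Sum>i\<in>T n. f n j (W i \<omega>)) / card (T n) - (\<integral>w. f n j w \<partial>F)\<bar> \<le> \<delta> * r n}) = ?bad n"
      by auto
    finally show ?thesis .
  qed
  then show "\<forall>\<^sub>F n in sequentially. ?bad n \<in> events \<and> prob (?bad n) \<le> prob (?bad n)"
    by simp
  have tail: "\<forall>\<^sub>F n in sequentially. prob (?bad n) \<le> 2 / 2 ^ k" for k :: nat
  proof -
    \<comment> \<open>Chosen such that \<open>eps p n \<le> \<kappa> * r n\<close> is exactly what
      turns the Hoeffding exponent into \<open>(2 + k) * ln (p n)\<close>.\<close>
    define \<kappa> where "\<kappa> = sqrt (c * \<delta>\<^sup>2 / (2 * C\<^sup>2 * (2 + k)))"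
    have \<kappa>: "\<kappa> > 0" "\<kappa>\<^sup>2 = c * \<delta>\<^sup>2 / (2 * C\<^sup>2 * (2 + k))"
      using \<open>C > 0\<close> \<open>\<delta> > 0\<close> T(3) by (auto simp: \<kappa>_def)
    have "\<forall>\<^sub>F n in sequentially. norm (eps p n) \<le> \<kappa> * norm (r n)"
      using r(1) \<kappa>(1) by (rule landau_o.smallD)
    then show ?thesis
      using T(2) eventually_gt_at_top[of 0]
    proof eventually_elim
      case (elim n)
      have p2: "real (p n) \<ge> 2" and rn: "r n > 0"
        using p[OF elim(3)] r(2)[OF elim(3)] by auto
      have "c * real n > 0"
        using elim(3) T(3) by simp
      then have "card (T n) > 0"
        using elim(2) by (metis less_le_trans of_nat_0_less_iff)
      then have Tn: "T n \<noteq> {}" by auto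
      have lnp: "ln (p n) \<ge> 0" using p2 by simp
      have "(eps p n)\<^sup>2 \<le> (\<kappa> * r n)\<^sup>2"
        using elim(1) rn \<kappa>(1) by (intro abs_le_square_iff[THEN iffD1]) (auto simp: abs_mult)
      then have *: "ln (p n) / n \<le> \<kappa>\<^sup>2 * (r n)\<^sup>2"
        using lnp by (simp add: eps_def power_mult_distrib)
      have "(2 + k) * ln (p n) = (2 + k) * n * (ln (p n) / n)"
        using elim(3) by (simp add: field_simps)
      also have "\<dots> \<le> (2 + k) * n * (\<kappa>\<^sup>2 * (r n)\<^sup>2)"
        using * by (intro mult_left_mono) auto
      also have "\<dots> = c * n * (\<delta> * r n)\<^sup>2 / (2 * C\<^sup>2)"
      proof -
        have "\<kappa>\<^sup>2 * (2 + k) = c * \<delta>\<^sup>2 / (2 * C\<^sup>2)"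
          unfolding \<kappa> by simp
        moreover have "(2 + k) * n * (\<kappa>\<^sup>2 * (r n)\<^sup>2) = \<kappa>\<^sup>2 * (2 + k) * n * (r n)\<^sup>2"
          by (simp only: of_nat_mult mult_ac)
        ultimately show ?thesis
          by (simp add: power_mult_distrib)
      qed
      also have "\<dots> \<le> card (T n) * (\<delta> * r n)\<^sup>2 / (2 * C\<^sup>2)"
        using elim(2) by (intro divide_right_mono mult_right_mono) auto
      finally have expo: "- (card (T n) * (\<delta> * r n)\<^sup>2 / (2 * C\<^sup>2)) \<le> - ((2 + k) * ln (p n))"
        by simp
      have "exp (- ((2 + k) * ln (p n))) = inverse (exp (ln (p n)) ^ (2 + k))"
        by (simp only: exp_of_nat_mult[symmetric] exp_minus)
      then have exp_eq: "exp (- ((2 + k) * ln (p n))) = 1 / p n ^ (2 + k)"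
        using p2 by (simp add: inverse_eq_divide)
      have "prob (?bad n) \<le> prob (\<Union>j\<in>J n. ?B n j)"
      proof (rule finite_measure_mono)
        show "(\<Union>j\<in>J n. ?B n j) \<in> events"
        proof (intro sets.finite_UN J)
          fix j assume "j \<in> J n"
          note [measurable] = meas[OF this]
          show "?B n j \<in> events" by measurable
        qed
      qed force
      also have "\<dots> \<le> (\<Sum>j\<in>J n. prob (?B n j))"
      proof (intro finite_measure_subadditive_finite J image_subsetI)
        fix j assume "j \<in> J n"
        note [measurable] = meas[OF this]
        show "?B n j \<in> events" by measurable
      qed
      also have "\<dots> \<le> (\<Sum>j\<in>J n. 2 * exp (- (card (T n) * (\<delta> * r n)\<^sup>2 / (2 * C\<^sup>2))))"
      proof (rule sum_mono)
        fix j assume j: "j \<in> J n"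
        show "prob (?B n j) \<le> 2 * exp (- (card (T n) * (\<delta> * r n)\<^sup>2 / (2 * C\<^sup>2)))"
          using Hoeffding_mean[OF meas[OF j] bound[OF elim(3) j] \<open>C > 0\<close> T(1) Tn, of "\<delta> * r n"] rn \<open>\<delta> > 0\<close>
          by simp
      qed
      also have "\<dots> \<le> (\<Sum>j\<in>J n. 2 * (1 / p n ^ (2 + k)))"
        unfolding exp_eq[symmetric] using expo by (intro sum_mono) simp
      also have "\<dots> = card (J n) * (2 / p n ^ (2 + k))"
        by simp
      also have "\<dots> \<le> (p n)\<^sup>2 * (2 / p n ^ (2 + k))"
        using J(2)[of n] by (intro mult_right_mono) (auto simp flip: of_nat_power)
      also have "\<dots> = 2 / p n ^ k"
        using p2 by (simp add: power_add power2_eq_square)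
      also have "\<dots> \<le> 2 / 2 ^ k"
        using p2 power_mono[OF p2, of k] by (intro divide_left_mono) auto
      finally show ?case .
    qed
  qed
  show "(\<lambda>n. prob (?bad n)) \<longlonglongrightarrow> 0"
  proof (rule tendstoI)
    fix e :: real assume "e > 0"
    then obtain k where "(1 / 2) ^ k < e / 2"
      using real_arch_pow_inv[of "e / 2" "1 / 2"] by auto
    then have "2 / 2 ^ k < e"
      by (simp add: power_divide)
    then show "\<forall>\<^sub>F n in sequentially. dist (prob (?bad n)) 0 < e"
      using tail[of k] by (auto elim!: eventually_mono)
  qed
qed

section \<open>Freezing the training sample\<close>

lemma distr_restrict_pair:
  assumes "T \<inter> T' = {}" "finite T" "finite T'"
  shows "distr M (PiM T (\<lambda>_. F) \<Otimes>\<^sub>M PiM T' (\<lambda>_. F)) (\<lambda>\<omega>. (\<lambda>i\<in>T. W i \<omega>, \<lambda>i\<in>T'. W i \<omega>))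
    = distr M (PiM T (\<lambda>_. F)) (\<lambda>\<omega>. \<lambda>i\<in>T. W i \<omega>) \<Otimes>\<^sub>M distr M (PiM T' (\<lambda>_. F)) (\<lambda>\<omega>. \<lambda>i\<in>T'. W i \<omega>)"
proof -
  have "indep_var (PiM T (\<lambda>_. F)) (\<lambda>\<omega>. \<lambda>i\<in>T. W i \<omega>) (PiM T' (\<lambda>_. F)) (\<lambda>\<omega>. \<lambda>i\<in>T'. W i \<omega>)"
    using assms by (intro indep_var_restrict[OF indep]) auto
  then show ?thesis
    by (simp add: indep_var_distribution_eq)
qed

text \<open>Fubini in place of conditional probability: the two blocks have a product law, so the
  probability is the average over training samples \<open>d\<close> of the probability with
  \<open>d\<close> held fixed.\<close>

lemma prob_split_sample:
  fixes q :: real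
  assumes TT: "T \<inter> T' = {}" "finite T" "finite T'"
    and S: "S \<in> sets (PiM T (\<lambda>_. F))"
    and B: "B \<in> sets (PiM T (\<lambda>_. F) \<Otimes>\<^sub>M PiM T' (\<lambda>_. F))"
    and q: "\<And>d. d \<in> S \<Longrightarrow> prob {\<omega>\<in>space M. (d, \<lambda>i\<in>T'. W i \<omega>) \<in> B} \<le> q" and "q \<ge> 0"
  shows "prob {\<omega>\<in>space M. (\<lambda>i\<in>T. W i \<omega>) \<in> S \<and> (\<lambda>i\<in>T. W i \<omega>, \<lambda>i\<in>T'. W i \<omega>) \<in> B} \<le> q"
proof -
  let ?D = "\<lambda>\<omega>. \<lambda>i\<in>T. W i \<omega>" and ?E = "\<lambda>\<omega>. \<lambda>i\<in>T'. W i \<omega>"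
  let ?PD = "PiM T (\<lambda>_. F)" and ?PE = "PiM T' (\<lambda>_. F)"
  have D [measurable]: "?D \<in> measurable M ?PD" and E [measurable]: "?E \<in> measurable M ?PE"
    by (auto intro!: measurable_restrict)
  interpret PD: prob_space "distr M ?PD ?D"
    by (rule prob_space_distr) simp
  interpret PE: prob_space "distr M ?PE ?E"
    by (rule prob_space_distr) simp
  define A where "A = B \<inter> (S \<times> space ?PE)"
  have A: "A \<in> sets (?PD \<Otimes>\<^sub>M ?PE)"
    unfolding A_def using S B by (intro sets.Int pair_measureI) auto
  have E_space: "?E \<omega> \<in> space ?PE" if "\<omega> \<in> space M" for \<omega>
    using measurable_space[OF E that] .
  have "emeasure M {\<omega>\<in>space M. ?D \<omega> \<in> S \<and> (?D \<omega>, ?E \<omega>) \<in> B}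
      = emeasure (distr M (?PD \<Otimes>\<^sub>M ?PE) (\<lambda>\<omega>. (?D \<omega>, ?E \<omega>))) A"
    using A by (subst emeasure_distr) (auto simp: A_def E_space intro!: arg_cong[where f = "emeasure M"])
  also have "\<dots> = emeasure (distr M ?PD ?D \<Otimes>\<^sub>M distr M ?PE ?E) A"
    by (simp add: distr_restrict_pair[OF TT])
  also have "\<dots> = (\<integral>\<^sup>+d. emeasure (distr M ?PE ?E) (Pair d -` A) \<partial>distr M ?PD ?D)"
    using A by (intro PE.emeasure_pair_measure_alt) simp
  also have "\<dots> \<le> (\<integral>\<^sup>+d. ennreal q \<partial>distr M ?PD ?D)"
  proof (rule nn_integral_mono)
    fix d
    show "emeasure (distr M ?PE ?E) (Pair d -` A) \<le> ennreal q"
    proof (cases "d \<in> S")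
      case True
      have meas: "Pair d -` B \<in> sets ?PE"
        using B by (rule sets_Pair1)
      have "emeasure (distr M ?PE ?E) (Pair d -` A) \<le> emeasure (distr M ?PE ?E) (Pair d -` B)"
        using meas by (intro emeasure_mono) (auto simp: A_def)
      also have "\<dots> = emeasure M {\<omega>\<in>space M. (d, ?E \<omega>) \<in> B}"
        using meas by (subst emeasure_distr) (auto intro!: arg_cong[where f = "emeasure M"])
      also have "\<dots> \<le> ennreal q"
        using q[OF True] \<open>q \<ge> 0\<close> by (simp add: emeasure_eq_measure)
      finally show ?thesis .
    qed (simp add: A_def)
  qed
  also have "\<dots> = ennreal q"
    using PD.emeasure_space_1 by simp
  finally show ?thesis
    using \<open>q \<ge> 0\<close> by (simp add: emeasure_eq_measure)
qed

lemma whp_split_sample: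
  fixes S :: "real \<Rightarrow> nat \<Rightarrow> (nat \<Rightarrow> 'w) set"
  assumes TT: "\<And>n. T n \<inter> T' n = {}" "\<And>n. finite (T n)" "\<And>n. finite (T' n)"
    and S: "\<And>\<delta> n. n > 0 \<Longrightarrow> S \<delta> n \<in> sets (PiM (T n) (\<lambda>_. F))"
    and whp_S: "\<And>\<delta>. \<delta> > 0 \<Longrightarrow> whp M (\<lambda>n \<omega>. (\<lambda>i\<in>T n. W i \<omega>) \<in> S \<delta> n)"
    and B: "\<And>n. n > 0 \<Longrightarrow> B n \<in> sets (PiM (T n) (\<lambda>_. F) \<Otimes>\<^sub>M PiM (T' n) (\<lambda>_. F))"
    and q: "\<And>\<delta> n d. \<delta> > 0 \<Longrightarrow> n > 0 \<Longrightarrow> d \<in> S \<delta> n \<Longrightarrow> prob {\<omega>\<in>space M. (d, \<lambda>i\<in>T' n. W i \<omega>) \<in> B n} \<le> \<delta>"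
  shows "whp M (\<lambda>n \<omega>. (\<lambda>i\<in>T n. W i \<omega>, \<lambda>i\<in>T' n. W i \<omega>) \<notin> B n)"
proof -
  let ?D = "\<lambda>n \<omega>. \<lambda>i\<in>T n. W i \<omega>" and ?E = "\<lambda>n \<omega>. \<lambda>i\<in>T' n. W i \<omega>"
  let ?bad = "\<lambda>n. {\<omega> \<in> space M. (?D n \<omega>, ?E n \<omega>) \<in> B n}"
  have D [measurable]: "?D n \<in> measurable M (PiM (T n) (\<lambda>_. F))"
    and E [measurable]: "?E n \<in> measurable M (PiM (T' n) (\<lambda>_. F))" for n
    by (auto intro!: measurable_restrict)
  have bad_event: "?bad n \<in> events" if "n > 0" for n
    using B[OF that] by measurable
  show ?thesis
  proof (rule whpI_bound[where q = "\<lambda>n. prob (?bad n)"])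
    show "\<forall>\<^sub>F n in sequentially. {\<omega> \<in> space M. \<not> (?D n \<omega>, ?E n \<omega>) \<notin> B n} \<in> events \<and>
       prob {\<omega> \<in> space M. \<not> (?D n \<omega>, ?E n \<omega>) \<notin> B n} \<le> prob (?bad n)"
      using eventually_gt_at_top[of 0] by eventually_elim (simp add: bad_event)
    show "(\<lambda>n. prob (?bad n)) \<longlonglongrightarrow> 0"
    proof (rule tendstoI)
      fix e :: real assume "e > 0"
      then have e2: "e / 2 > 0" by simp
      show "\<forall>\<^sub>F n in sequentially. dist (prob (?bad n)) 0 < e"
        using tendstoD[OF prob_bad_tendsto_0[OF whp_S[OF e2]] e2] eventually_gt_at_top[of 0]
      proof eventually_elim
        case (elim n)
        note [measurable] = S[OF elim(2), of "e / 2"] B[OF elim(2)]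
        let ?A = "{\<omega> \<in> space M. ?D n \<omega> \<in> S (e / 2) n \<and> (?D n \<omega>, ?E n \<omega>) \<in> B n}"
        let ?C = "{\<omega> \<in> space M. ?D n \<omega> \<notin> S (e / 2) n}"
        have "prob (?bad n) \<le> prob (?A \<union> ?C)"
          by (intro finite_measure_mono) (auto, measurable)
        also have "\<dots> \<le> prob ?A + prob ?C"
          by (intro measure_Un_le) measurable
        also have "prob ?A \<le> e / 2"
          using prob_split_sample[OF TT S[OF elim(2)] B[OF elim(2)] q[OF e2 elim(2)]] e2 by simp
        also have "prob ?C < e / 2"
          using elim(1) by simp
        finally show ?case by simp
      qed
    qed
  qed
qed

end

section \<open>Limit theorems\<close>

context iid_sample
begin

text \<open>The law is applied to the square of the influence function, for which only a first
  moment is available. Hence truncation at a level \<open>k\<close>: Chebyshev's inequality controls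
  the bounded part, Markov's inequality the excess \<open>h k\<close>.\<close>

lemma whp_weak_law:
  fixes f :: "'w \<Rightarrow> real"
  assumes f: "integrable F f" and nonneg: "\<And>w. f w \<ge> 0" and "e > 0"
  shows "whp M (\<lambda>n \<omega>. \<bar>(\<Sum>i<n. f (W i \<omega>)) / n - (\<integral>w. f w \<partial>F)\<bar> \<le> e)"
proof -
  interpret F: prob_space F by (rule prob_space_F)
  have [measurable]: "f \<in> borel_measurable F"
    using f by simp
  let ?bad = "\<lambda>n. {\<omega>\<in>space M. \<not> \<bar>(\<Sum>i<n. f (W i \<omega>)) / real n - (\<integral>w. f w \<partial>F)\<bar> \<le> e}"
  define h where "h k w = f w - min (f w) (real k)" for k :: nat and w
  have h_nonneg: "h k w \<ge> 0" and h_le: "h k w \<le> f w" for k w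
    using nonneg[of w] by (auto simp: h_def)
  have [measurable]: "h k \<in> borel_measurable F" for k
    unfolding h_def by measurable
  have h_int: "integrable F (h k)" for k
    using f by (rule Bochner_Integration.integrable_bound) (auto simp: h_nonneg h_le nonneg)
  have "(\<lambda>k. \<integral>w. h k w \<partial>F) \<longlonglongrightarrow> (\<integral>w. 0 \<partial>F)"
  proof (rule integral_dominated_convergence[OF _ _ f])
    have "(\<lambda>k. h k w) \<longlonglongrightarrow> 0" for w
    proof (rule tendsto_eventually)
      have "\<forall>\<^sub>F k in sequentially. f w \<le> real k"
        using filterlim_real_sequentially by (simp add: filterlim_at_top)
      then show "\<forall>\<^sub>F k in sequentially. h k w = 0"
        by eventually_elim (simp add: h_def)
    qed
    then show "AE w in F. (\<lambda>k. h k w) \<longlonglongrightarrow> 0"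
      by simp
  qed (auto simp: h_nonneg h_le)
  then have h_lim: "(\<lambda>k. \<integral>w. h k w \<partial>F) \<longlonglongrightarrow> 0"
    by simp
  show ?thesis
  proof (rule whpI_bound)
    show "\<forall>\<^sub>F n in sequentially. ?bad n \<in> events \<and> prob (?bad n) \<le> prob (?bad n)"
      by (auto intro!: always_eventually)
    show "(\<lambda>n. prob (?bad n)) \<longlonglongrightarrow> 0"
    proof (rule tendstoI)
      fix \<delta> :: real assume "\<delta> > 0"
      \<comment> \<open>One third of \<open>e\<close> each for the bounded part, the sample mean of
        the excess and the population mean of the excess; the factor \<delta>/2 makes the Markov
        bound of the second at most \<delta>/2.\<close>
      have "min (e / 3) (e / 3 * (\<delta> / 2)) > 0"
        using \<open>e > 0\<close> \<open>\<delta> > 0\<close> by simp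
      with order_tendstoD(2)[OF h_lim this] obtain k
        where k: "(\<integral>w. h k w \<partial>F) < e / 3" "(\<integral>w. h k w \<partial>F) < e / 3 * (\<delta> / 2)"
        by (auto dest: eventually_happens'[OF sequentially_bot])
      define g where "g w = min (f w) (real k) - (\<integral>w. min (f w) (real k) \<partial>F)" for w
      have g_int0: "integrable F (\<lambda>w. min (f w) (real k))"
        using nonneg by (intro F.integrable_const_bound[of _ k]) (auto intro!: AE_I2)
      have "(\<integral>w. min (f w) (real k) \<partial>F) \<le> (\<integral>w. real k \<partial>F)"
        using g_int0 by (intro integral_mono) auto
      moreover have "0 \<le> (\<integral>w. min (f w) (real k) \<partial>F)"
        using nonneg by (intro integral_nonneg_AE) auto
      ultimately have g_bound: "\<bar>g w\<bar> \<le> k" for w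
        using nonneg[of w] by (auto simp: g_def F.prob_space min_def)
      have [measurable]: "g \<in> borel_measurable F"
        unfolding g_def by measurable
      have g_sq: "integrable F (\<lambda>w. (g w)\<^sup>2)"
        using power_mono[OF g_bound abs_ge_zero, where n = 2]
        by (intro F.integrable_const_bound[of _ "(real k)\<^sup>2"]) (auto intro!: AE_I2)
      have g_mean: "(\<integral>w. g w \<partial>F) = 0"
        unfolding g_def using g_int0 by (simp add: F.prob_space)
      have f_eq: "f w = g w + (\<integral>w. min (f w) (real k) \<partial>F) + h k w" for w
        by (simp add: g_def h_def)
      have int_f: "(\<integral>w. f w \<partial>F) = (\<integral>w. min (f w) (real k) \<partial>F) + (\<integral>w. h k w \<partial>F)"
        using g_int0 f by (simp add: h_def)
      let ?v = "\<integral>w. (g w)\<^sup>2 \<partial>F"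
      have "(\<lambda>n. ?v / (e / 3)\<^sup>2 / real n) \<longlonglongrightarrow> 0"
        by (rule lim_const_over_n)
      then have "\<forall>\<^sub>F n in sequentially. ?v / (e / 3)\<^sup>2 / real n < \<delta> / 2"
        using \<open>\<delta> > 0\<close> by (intro order_tendstoD(2)) auto
      then show "\<forall>\<^sub>F n in sequentially. dist (prob (?bad n)) 0 < \<delta>"
        using eventually_gt_at_top[of 0]
      proof eventually_elim
        case (elim n)
        then have t: "real n * (e / 3) > 0"
          using \<open>e > 0\<close> by simp
        let ?A = "{\<omega>\<in>space M. \<bar>\<Sum>i<n. g (W i \<omega>)\<bar> > real n * (e / 3)}"
        let ?B = "{\<omega>\<in>space M. (\<Sum>i<n. h k (W i \<omega>)) > real n * (e / 3)}"
        have "?bad n \<subseteq> ?A \<union> ?B"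
        proof (rule subsetI, rule ccontr)
          fix \<omega> assume \<omega>: "\<omega> \<in> ?bad n" "\<omega> \<notin> ?A \<union> ?B"
          let ?g = "\<Sum>i<n. g (W i \<omega>)" and ?h = "\<Sum>i<n. h k (W i \<omega>)"
          have "(\<Sum>i<n. f (W i \<omega>)) = ?g + n * (\<integral>w. min (f w) (real k) \<partial>F) + ?h"
            by (subst f_eq) (simp add: sum.distrib)
          then have "(\<Sum>i<n. f (W i \<omega>)) / n - (\<integral>w. f w \<partial>F) = ?g / n + ?h / n - (\<integral>w. h k w \<partial>F)"
            unfolding int_f using elim by (simp add: field_simps)
          moreover have "\<bar>?g / n\<bar> \<le> e / 3" "?h / n \<le> e / 3"
            using \<omega> elim by (auto simp: not_less field_simps)
          moreover have "0 \<le> ?h / n" "0 \<le> (\<integral>w. h k w \<partial>F)"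
            by (auto intro!: divide_nonneg_nonneg sum_nonneg h_nonneg Bochner_Integration.integral_nonneg)
          ultimately have "\<bar>(\<Sum>i<n. f (W i \<omega>)) / n - (\<integral>w. f w \<partial>F)\<bar> \<le> e"
            using k(1) by linarith
          with \<omega>(1) show False by simp
        qed
        then have "prob (?bad n) \<le> prob (?A \<union> ?B)"
          by (intro finite_measure_mono) auto
        also have "\<dots> \<le> prob ?A + prob ?B"
          by (intro measure_Un_le) auto
        also have "prob ?A \<le> card {..<n} * ?v / (real n * (e / 3))\<^sup>2"
          using t by (intro Chebyshev_sum g_sq g_mean) auto
        also have "\<dots> = ?v / (e / 3)\<^sup>2 / real n"
          using elim by (simp add: power2_eq_square field_simps)
        also have "prob ?B \<le> card {..<n} * (\<integral>w. h k w \<partial>F) / (real n * (e / 3))"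
          using t by (intro Markov_sum h_int h_nonneg) auto
        also have "\<dots> = (\<integral>w. h k w \<partial>F) / (e / 3)"
          using elim by simp
        also have "\<dots> < \<delta> / 2"
          using k(2) \<open>e > 0\<close> by (subst pos_divide_less_eq) (auto simp: mult.commute)
        finally have "prob (?bad n) < \<delta>"
          using elim(1) by linarith
        then show ?case
          by simp
      qed
    qed
  qed
qed

end

section \<open>Central limit theorem and Slutsky's lemma, degenerate variance included\<close>

lemma real_distribution_normal_law:
  assumes "v \<ge> 0"
  shows "real_distribution (normal_law \<mu> v)"
proof (cases "v = 0")
  case True
  then show ?thesis
    by (auto simp: normal_law_def real_distribution_def real_distribution_axioms_def intro!: prob_space_return)
next
  case False
  then show ?thesis
    using assms by (auto simp: normal_law_def real_distribution_def real_distribution_axioms_def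
      intro!: prob_space_normal_density)
qed

text \<open>Weak convergence is tested at continuity points of the limit, and the asymptotic
  variance may vanish; the point mass has a single jump, at its location.\<close>

lemma isCont_cdf_normal_law_iff:
  assumes "v \<ge> 0"
  shows "isCont (cdf (normal_law \<mu> v)) x \<longleftrightarrow> v \<noteq> 0 \<or> x \<noteq> \<mu>"
proof -
  interpret real_distribution "normal_law \<mu> v"
    using assms by (rule real_distribution_normal_law)
  show ?thesis
  proof (cases "v = 0")
    case True
    then show ?thesis
      unfolding isCont_cdf by (auto simp: normal_law_def measure_return indicator_def)
  next
    case False
    have "emeasure (density lborel (normal_density \<mu> (sqrt v))) {x} = 0"
      by (subst emeasure_density) (auto simp: nn_integral_0_iff_AE intro!: nn_integral_null_set)
    then show ?thesis
      unfolding isCont_cdf using False by (simp add: normal_law_def measure_def)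
  qed
qed

text \<open>Undoes the standardization under which the classical central limit theorem is
  stated.\<close>

lemma cdf_std_normal_scale:
  assumes "\<sigma> > 0"
  shows "cdf (normal_law 0 (\<sigma>\<^sup>2)) x = cdf std_normal_distribution (x / \<sigma>)"
proof -
  interpret N: prob_space "std_normal_distribution"
    by (rule prob_space_normal_density) simp
  have "distributed std_normal_distribution lborel (\<lambda>x. x) std_normal_density"
    by (auto simp: distributed_def distr_id2)
  then have "distributed std_normal_distribution lborel (\<lambda>x. 0 + \<sigma> * x) (normal_density (0 + \<sigma> * 0) (\<bar>\<sigma>\<bar> * 1))"
    using assms by (intro N.normal_density_affine) auto
  then have "distr std_normal_distribution lborel (\<lambda>x. \<sigma> * x) = density lborel (normal_density 0 \<sigma>)"
    using assms by (simp add: distributed_def)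
  then have "cdf (normal_law 0 (\<sigma>\<^sup>2)) x = measure (distr std_normal_distribution lborel (\<lambda>x. \<sigma> * x)) {..x}"
    using assms by (simp add: cdf_def2 normal_law_def)
  also have "\<dots> = measure std_normal_distribution {..x / \<sigma>}"
    using assms by (subst measure_distr)
      (auto intro!: arg_cong[where f = "measure std_normal_distribution"] simp: field_simps)
  finally show ?thesis
    by (simp add: cdf_def2)
qed

context iid_sample
begin

text \<open>With zero variance the summands vanish almost surely and every normalized sum already
  has the limit law; otherwise the standardized theorem is rescaled.\<close>

lemma clt_normal_law:
  fixes f :: "'w \<Rightarrow> real"
  assumes meas [measurable]: "f \<in> borel_measurable F" and sq: "integrable F (\<lambda>w. (f w)\<^sup>2)"
    and mean: "(\<integral>w. f w \<partial>F) = 0"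
  shows "weak_conv_m (\<lambda>n. distr M borel (\<lambda>\<omega>. (\<Sum>i<n. f (W i \<omega>)) / sqrt n)) (normal_law 0 (\<integral>w. (f w)\<^sup>2 \<partial>F))"
proof (cases "(\<integral>w. (f w)\<^sup>2 \<partial>F) = 0")
  case True
  then have "AE w in F. (f w)\<^sup>2 = 0"
    using integral_nonneg_eq_0_iff_AE[OF sq] by simp
  then have "AE w in F. f w = 0"
    by simp
  then have "AE \<omega> in M. f (W i \<omega>) = 0" for i
    by (rule AE_W)
  then have zero: "AE \<omega> in M. \<forall>i. f (W i \<omega>) = 0"
    by (simp add: AE_all_countable)
  have "distr M borel (\<lambda>\<omega>. (\<Sum>i<n. f (W i \<omega>)) / sqrt n) = return borel 0" for n :: nat
  proof -
    have "distr M borel (\<lambda>\<omega>. (\<Sum>i<n. f (W i \<omega>)) / sqrt n) = distr M borel (\<lambda>_. 0)"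
      using zero by (intro distr_cong_AE) (auto elim!: eventually_mono)
    also have "\<dots> = return borel 0"
      by (rule distr_const) simp
    finally show ?thesis .
  qed
  then show ?thesis
    using True by (simp add: normal_law_def weak_conv_m_def weak_conv_def)
next
  case False
  define \<sigma> where "\<sigma> = sqrt (\<integral>w. (f w)\<^sup>2 \<partial>F)"
  have nonneg: "0 \<le> (\<integral>w. (f w)\<^sup>2 \<partial>F)"
    by simp
  then have "0 < (\<integral>w. (f w)\<^sup>2 \<partial>F)"
    using False by linarith
  then have \<sigma>: "\<sigma> > 0" "\<sigma>\<^sup>2 = (\<integral>w. (f w)\<^sup>2 \<partial>F)"
    by (auto simp: \<sigma>_def)
  have expect: "expectation (\<lambda>\<omega>. f (W i \<omega>)) = 0" for i
    by (simp add: integral_W mean)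
  have distr: "distr M borel (\<lambda>\<omega>. f (W i \<omega>)) = distr F borel f" for i
    using distr_distr[OF meas measurable_W[of i]] by (simp add: ident comp_def)
  have "weak_conv_m (\<lambda>n. distr M borel (\<lambda>\<omega>. (\<Sum>i<n. f (W i \<omega>)) / sqrt (real n * \<sigma>\<^sup>2))) std_normal_distribution"
  proof (rule central_limit_theorem_zero_mean[OF _ _ \<sigma>(1)])
    show "integrable M (\<lambda>\<omega>. (f (W n \<omega>))\<^sup>2)" for n
      using sq by (rule integrable_W)
    have sq_meas: "(\<lambda>w. (f w)\<^sup>2) \<in> borel_measurable F"
      by measurable
    show "variance (\<lambda>\<omega>. f (W n \<omega>)) = \<sigma>\<^sup>2" for n
      using integral_W[OF sq_meas, of n] by (simp add: expect \<sigma>(2))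
  qed (auto intro: indep_vars_comp meas expect distr)
  then have std: "(\<lambda>n. cdf (distr M borel (\<lambda>\<omega>. (\<Sum>i<n. f (W i \<omega>)) / sqrt (real n * \<sigma>\<^sup>2))) y)
      \<longlonglongrightarrow> cdf std_normal_distribution y" for y
  proof -
    have "isCont (cdf std_normal_distribution) y"
      using isCont_cdf_normal_law_iff[where v = 1 and \<mu> = 0 and x = y] by (simp add: normal_law_def)
    then show ?thesis
      using \<open>weak_conv_m _ std_normal_distribution\<close> by (simp add: weak_conv_m_def weak_conv_def)
  qed
  have cdf_eq: "cdf (distr M borel (\<lambda>\<omega>. (\<Sum>i<n. f (W i \<omega>)) / sqrt n)) x
      = cdf (distr M borel (\<lambda>\<omega>. (\<Sum>i<n. f (W i \<omega>)) / sqrt (real n * \<sigma>\<^sup>2))) (x / \<sigma>)" for n x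
  proof -
    have "(\<Sum>i<n. f (W i \<omega>)) / sqrt n \<le> x \<longleftrightarrow> (\<Sum>i<n. f (W i \<omega>)) / sqrt (real n * \<sigma>\<^sup>2) \<le> x / \<sigma>" for \<omega>
    proof -
      have "(\<Sum>i<n. f (W i \<omega>)) / sqrt (real n * \<sigma>\<^sup>2) = (\<Sum>i<n. f (W i \<omega>)) / sqrt n / \<sigma>"
        using \<sigma>(1) by (simp add: real_sqrt_mult)
      then show ?thesis
        using \<sigma>(1) by (simp only: divide_le_cancel) auto
    qed
    then show ?thesis
      by (simp add: cdf_def2 measure_distr vimage_def)
  qed
  show ?thesis
    unfolding weak_conv_m_def weak_conv_def
    using std[of "_ / \<sigma>"] cdf_std_normal_scale[OF \<sigma>(1)] by (simp add: cdf_eq flip: \<sigma>(2))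
qed

end

text \<open>The hypothesis \<open>cont\<close>, that continuity points form an open set, holds for
  all normal laws, degenerate or not. It allows the distribution functions to be compared at x - h
  and x + h for a freely chosen small \<open>h\<close>.\<close>

lemma (in prob_space) Slutsky:
  assumes conv: "weak_conv_m (\<lambda>n. distr M borel (A n)) \<mu>"
    and A: "\<And>n. A n \<in> borel_measurable M" and Z: "\<And>n. n > 0 \<Longrightarrow> Z n \<in> borel_measurable M"
    and near: "\<And>e. e > 0 \<Longrightarrow> whp M (\<lambda>n \<omega>. \<bar>Z n \<omega> - A n \<omega>\<bar> \<le> e)"
    and cont: "\<And>x. isCont (cdf \<mu>) x \<Longrightarrow> \<exists>d>0. \<forall>y. \<bar>y - x\<bar> < d \<longrightarrow> isCont (cdf \<mu>) y"
  shows "weak_conv_m (\<lambda>n. distr M borel (Z n)) \<mu>"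
  unfolding weak_conv_m_def weak_conv_def
proof (intro allI impI tendstoI)
  fix x e :: real
  assume x: "isCont (cdf \<mu>) x" and "e > 0"
  obtain d where d: "d > 0" "\<And>y. \<bar>y - x\<bar> < d \<Longrightarrow> isCont (cdf \<mu>) y"
    using cont[OF x] by blast
  obtain d' where d': "d' > 0" "\<And>y. \<bar>y - x\<bar> < d' \<Longrightarrow> \<bar>cdf \<mu> y - cdf \<mu> x\<bar> < e / 4"
    using x \<open>e > 0\<close> unfolding continuous_at_eps_delta dist_real_def
    by (metis divide_pos_pos zero_less_numeral)
  \<comment> \<open>Below \<open>d\<close>, so that x - h and x + h are continuity points, and below
    \<open>d'\<close>, so that the limit varies by less than e/4 between them and x.\<close>
  define h where "h = min d d' / 2"
  have h: "h > 0" "h < d" "h < d'"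
    using d d' by (auto simp: h_def min_def)
  have cdf_A: "(\<lambda>n. prob {\<omega>\<in>space M. A n \<omega> \<le> y}) \<longlonglongrightarrow> cdf \<mu> y" if "isCont (cdf \<mu>) y" for y
  proof -
    have "cdf (distr M borel (A n)) y = prob {\<omega>\<in>space M. A n \<omega> \<le> y}" for n
      using A[of n] by (simp add: cdf_def2 measure_distr vimage_def Collect_conj_eq Int_commute)
    moreover have "(\<lambda>n. cdf (distr M borel (A n)) y) \<longlonglongrightarrow> cdf \<mu> y"
      using conv that by (simp add: weak_conv_m_def weak_conv_def)
    ultimately show ?thesis
      by (simp only:)
  qed
  have near0: "(\<lambda>n. prob {\<omega>\<in>space M. \<not> \<bar>Z n \<omega> - A n \<omega>\<bar> \<le> h}) \<longlonglongrightarrow> 0"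
    by (rule prob_bad_tendsto_0[OF near[OF h(1)]])
  have up: "isCont (cdf \<mu>) (x + h)" "\<bar>cdf \<mu> (x + h) - cdf \<mu> x\<bar> < e / 4"
    and low: "isCont (cdf \<mu>) (x - h)" "\<bar>cdf \<mu> (x - h) - cdf \<mu> x\<bar> < e / 4"
    using h d(2)[of "x + h"] d'(2)[of "x + h"] d(2)[of "x - h"] d'(2)[of "x - h"] by auto
  have e4: "e / 4 > 0" using \<open>e > 0\<close> by simp
  show "\<forall>\<^sub>F n in sequentially. dist (cdf (distr M borel (Z n)) x) (cdf \<mu> x) < e"
    using tendstoD[OF cdf_A[OF up(1)] e4] tendstoD[OF cdf_A[OF low(1)] e4] tendstoD[OF near0 e4]
      eventually_gt_at_top[of 0]
  proof eventually_elim
    case (elim n)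
    note [measurable] = A[of n] Z[OF elim(4)]
    let ?N = "{\<omega>\<in>space M. \<not> \<bar>Z n \<omega> - A n \<omega>\<bar> \<le> h}"
    have "cdf (distr M borel (Z n)) x = prob {\<omega>\<in>space M. Z n \<omega> \<le> x}"
      by (simp add: cdf_def2 measure_distr vimage_def Collect_conj_eq Int_commute)
    moreover have "prob {\<omega>\<in>space M. Z n \<omega> \<le> x} \<le> prob {\<omega>\<in>space M. A n \<omega> \<le> x + h} + prob ?N"
    proof -
      have "prob {\<omega>\<in>space M. Z n \<omega> \<le> x} \<le> prob ({\<omega>\<in>space M. A n \<omega> \<le> x + h} \<union> ?N)"
        by (intro finite_measure_mono) auto
      also have "\<dots> \<le> prob {\<omega>\<in>space M. A n \<omega> \<le> x + h} + prob ?N"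
        by (intro measure_Un_le) auto
      finally show ?thesis .
    qed
    moreover have "prob {\<omega>\<in>space M. A n \<omega> \<le> x - h} \<le> prob {\<omega>\<in>space M. Z n \<omega> \<le> x} + prob ?N"
    proof -
      have "prob {\<omega>\<in>space M. A n \<omega> \<le> x - h} \<le> prob ({\<omega>\<in>space M. Z n \<omega> \<le> x} \<union> ?N)"
        by (intro finite_measure_mono) auto
      also have "\<dots> \<le> prob {\<omega>\<in>space M. Z n \<omega> \<le> x} + prob ?N"
        by (intro measure_Un_le) auto
      finally show ?thesis .
    qed
    ultimately show ?case
      using elim up(2) low(2) unfolding dist_real_def by linarith
  qed
qed

section \<open>Quadratic forms and deterministic lasso bounds\<close>

text \<open>Coefficients are functions on all of \<open>nat\<close>, read below \<open>p\<close>
  only, so that differences, truncations and dictionaries of various sizes need no carrier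
  conditions. The evaluation point is a covariate value or, for in-sample quantities, an observation
  index.\<close>

definition dict_comb :: "(nat \<Rightarrow> 'x \<Rightarrow> real) \<Rightarrow> nat \<Rightarrow> (nat \<Rightarrow> real) \<Rightarrow> 'x \<Rightarrow> real" where
  "dict_comb b p v x = (\<Sum>j<p. v j * b j x)"

definition emp_mean :: "'i set \<Rightarrow> ('i \<Rightarrow> real) \<Rightarrow> real" where
  "emp_mean T f = (\<Sum>i\<in>T. f i) / real (card T)"

definition matvec :: "nat \<Rightarrow> (nat \<Rightarrow> nat \<Rightarrow> real) \<Rightarrow> (nat \<Rightarrow> real) \<Rightarrow> nat \<Rightarrow> real" where
  "matvec p A v j = (\<Sum>k<p. A j k * v k)"

definition bform :: "nat \<Rightarrow> (nat \<Rightarrow> nat \<Rightarrow> real) \<Rightarrow> (nat \<Rightarrow> real) \<Rightarrow> (nat \<Rightarrow> real) \<Rightarrow> real" where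
  "bform p A u v = (\<Sum>j<p. u j * matvec p A v j)"

lemma bform_commute:
  assumes "\<And>j k. A j k = A k j"
  shows "bform p A u v = bform p A v u"
proof -
  have "bform p A u v = (\<Sum>k<p. \<Sum>j<p. u j * (A j k * v k))"
    unfolding bform_def matvec_def sum_distrib_left by (rule sum.swap)
  also have "\<dots> = bform p A v u"
    unfolding bform_def matvec_def sum_distrib_left
    by (intro sum.cong refl) (simp add: assms[of _ k for k] mult_ac)
  finally show ?thesis .
qed

lemma bform_add_left: "bform p A (\<lambda>j. u j + t * w j) v = bform p A u v + t * bform p A w v"
  unfolding bform_def by (simp add: sum_distrib_left sum.distrib algebra_simps)

lemma bform_add_right: "bform p A u (\<lambda>j. v j + t * w j) = bform p A u v + t * bform p A u w"
  unfolding bform_def matvec_def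
  by (simp add: sum_distrib_left sum.distrib distrib_left mult_ac)

lemma bform_add_square:
  assumes "\<And>j k. A j k = A k j"
  shows "bform p A (\<lambda>j. u j + t * w j) (\<lambda>j. u j + t * w j)
    = bform p A u u + 2 * t * bform p A u w + t\<^sup>2 * bform p A w w"
  unfolding bform_add_left bform_add_right bform_commute[of A p w u, OF assms]
  by (simp add: algebra_simps power2_eq_square)

lemma bform_scale: "bform p A (\<lambda>j. t * v j) (\<lambda>j. t * v j) = t\<^sup>2 * bform p A v v"
  unfolding bform_def matvec_def
  by (simp add: sum_distrib_left power2_eq_square mult_ac)

lemma bform_upd_right:
  assumes "j < p"
  shows "bform p A u (\<lambda>i. if i = j then a else 0) = a * (\<Sum>i<p. u i * A i j)"
proof -
  have "matvec p A (\<lambda>i. if i = j then a else 0) i = A i j * a" for i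
    unfolding matvec_def using assms by (simp add: if_distrib cong: if_cong)
  then show ?thesis
    unfolding bform_def by (simp add: sum_distrib_left mult_ac)
qed

lemma bform_bound:
  assumes v: "\<And>j. j < p \<Longrightarrow> \<bar>v j\<bar> \<le> 1"
  shows "bform p A v v \<le> (\<Sum>j<p. \<Sum>k<p. \<bar>A j k\<bar>)"
  unfolding bform_def matvec_def sum_distrib_left
proof (intro sum_mono)
  fix j k assume "j \<in> {..<p}" "k \<in> {..<p}"
  then have "\<bar>v j\<bar> * \<bar>v k\<bar> \<le> 1 * 1"
    by (intro mult_mono v) auto
  then have "\<bar>A j k\<bar> * (\<bar>v j\<bar> * \<bar>v k\<bar>) \<le> \<bar>A j k\<bar> * 1"
    by (intro mult_left_mono) auto
  moreover have "v j * (A j k * v k) \<le> \<bar>v j * (A j k * v k)\<bar>"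
    by simp
  ultimately show "v j * (A j k * v k) \<le> \<bar>A j k\<bar>"
    by (simp add: abs_mult mult_ac)
qed

text \<open>Rayleigh: if the supremum \<open>\<mu>\<close> of the quotient were not an eigenvalue, then \<open>\<mu> - A\<close> would be
  invertible and positive semidefinite, hence bounded below, contradicting the choice of \<open>\<mu>\<close>.\<close>

lemma quadratic_form_le_max_eigenvalue:
  assumes sym: "\<And>j k. A j k = A k j"
    and ev: "\<And>k. eigenvalue (Matrix.mat p p (\<lambda>(i, j). A i j)) k \<Longrightarrow> k \<le> C"
  shows "bform p A v v \<le> C * (\<Sum>j<p. (v j)\<^sup>2)"
proof (rule ccontr)
  assume contr: "\<not> bform p A v v \<le> C * (\<Sum>j<p. (v j)\<^sup>2)"
  define S where "S = {bform p A u u | u. (\<Sum>j<p. (u j)\<^sup>2) = 1}"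
  have unit_le: "\<bar>u j\<bar> \<le> 1" if "(\<Sum>j<p. (u j)\<^sup>2) = 1" "j < p" for u :: "nat \<Rightarrow> real" and j
  proof -
    have "(u j)\<^sup>2 \<le> (\<Sum>j<p. (u j)\<^sup>2)"
      using that(2) by (intro member_le_sum) auto
    then show ?thesis
      using that(1) by (simp add: abs_square_le_1)
  qed
  have bdd: "bdd_above S"
    unfolding bdd_above_def S_def using bform_bound unit_le by blast
  define \<mu> where "\<mu> = Sup S"
  have le_\<mu>: "bform p A u u \<le> \<mu>" if "(\<Sum>j<p. (u j)\<^sup>2) = 1" for u
    unfolding \<mu>_def using that bdd by (intro cSup_upper) (auto simp: S_def)
  have normalize: "(\<Sum>j<p. (1 / sqrt (\<Sum>j<p. (u j)\<^sup>2) * u j)\<^sup>2) = 1"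
    if "(\<Sum>j<p. (u j)\<^sup>2) > 0" for u :: "nat \<Rightarrow> real"
    using that by (simp add: power_mult_distrib power_divide flip: sum_distrib_left sum_divide_distrib)
  have le_\<mu>': "bform p A u u \<le> \<mu> * (\<Sum>j<p. (u j)\<^sup>2)" for u
  proof (cases "(\<Sum>j<p. (u j)\<^sup>2) > 0")
    case True
    then show ?thesis
      using le_\<mu>[OF normalize[OF True]] unfolding bform_scale
      by (simp add: power_divide field_simps)
  next
    case False
    then have "(\<Sum>j<p. (u j)\<^sup>2) = 0"
      by (metis less_eq_real_def sum_nonneg zero_le_power2)
    then have "u j = 0" if "j < p" for j
      using that by (subst (asm) sum_nonneg_eq_0_iff) auto
    then show ?thesis
      by (simp add: bform_def)
  qed
  have pos: "(\<Sum>j<p. (v j)\<^sup>2) > 0"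
  proof (rule ccontr)
    assume "\<not> ?thesis"
    then have "(\<Sum>j<p. (v j)\<^sup>2) = 0"
      by (metis less_eq_real_def sum_nonneg zero_le_power2)
    moreover from this have "v j = 0" if "j < p" for j
      using that by (subst (asm) sum_nonneg_eq_0_iff) auto
    ultimately show False
      using contr by (simp add: bform_def)
  qed
  have "C * (\<Sum>j<p. (v j)\<^sup>2) < \<mu> * (\<Sum>j<p. (v j)\<^sup>2)"
    using contr le_\<mu>'[of v] by linarith
  then have "C < \<mu>"
    using pos by simp
  \<comment> \<open>The form of \<open>H\<close> = \<mu> - \<open>A\<close> is positive semidefinite
    because \<mu> is the supremum of the Rayleigh quotient.\<close>
  define H where "H j k = (if j = k then \<mu> else 0) - A j k" for j k
  have H_sym: "H j k = H k j" for j k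
    using sym by (simp add: H_def)
  have matvec_H: "matvec p H u j = \<mu> * u j - matvec p A u j" if "j < p" for u j
    unfolding matvec_def H_def using that
    by (simp add: left_diff_distrib sum_subtractf if_distrib[of "\<lambda>c. c * _"] cong: if_cong)
  have bform_H: "bform p H u u = \<mu> * (\<Sum>j<p. (u j)\<^sup>2) - bform p A u u" for u
  proof -
    have "bform p H u u = (\<Sum>j<p. u j * (\<mu> * u j - matvec p A u j))"
      unfolding bform_def by (intro sum.cong refl) (simp add: matvec_H)
    then show ?thesis
      by (simp add: bform_def right_diff_distrib sum_subtractf sum_distrib_left power2_eq_square mult_ac)
  qed
  let ?H = "Matrix.mat p p (\<lambda>(i, j). H i j)" and ?A = "Matrix.mat p p (\<lambda>(i, j). A i j)"
  have mult_index: "(Matrix.mat p p (\<lambda>(i, j). B i j) *\<^sub>v u) $ j = matvec p B (($) u) j"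
    if "u \<in> carrier_vec p" "j < p" for B :: "nat \<Rightarrow> nat \<Rightarrow> real" and u j
    using that by (simp add: scalar_prod_def matvec_def lessThan_atLeast0)
  \<comment> \<open>A kernel vector of \<open>H\<close> would be an eigenvector of \<open>A\<close>
    for \<mu>, but \<mu> exceeds the bound \<open>C\<close> on all eigenvalues.\<close>
  have "det ?H \<noteq> 0"
  proof
    assume "det ?H = 0"
    then obtain u where u: "u \<in> carrier_vec p" "u \<noteq> 0\<^sub>v p" "?H *\<^sub>v u = 0\<^sub>v p"
      using det_0_iff_vec_prod_zero_field[of ?H p] by auto
    have "?A *\<^sub>v u = \<mu> \<cdot>\<^sub>v u"
    proof (rule eq_vecI)
      fix j assume "j < dim_vec (\<mu> \<cdot>\<^sub>v u)"
      then have j: "j < p" using u(1) by simp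
      have "(?H *\<^sub>v u) $ j = 0" using u(3) j by simp
      then show "(?A *\<^sub>v u) $ j = (\<mu> \<cdot>\<^sub>v u) $ j"
        using j u(1) by (simp only: mult_index matvec_H) simp
    qed (use u(1) in simp)
    then have "eigenvalue ?A \<mu>"
      using u by (auto simp: eigenvalue_def eigenvector_def)
    then show False
      using ev \<open>C < \<mu>\<close> by fastforce
  qed
  then have "?H \<in> Units (ring_mat TYPE(real) p ())"
    by (intro det_non_zero_imp_unit) auto
  then obtain R where R: "R \<in> carrier_mat p p" "?H * R = 1\<^sub>m p"
    by (auto simp: Units_def ring_mat_def)
  \<comment> \<open>Bounds the form of the inverse \<open>R\<close> on unit vectors; the summand 1
    makes it positive.\<close>
  define K where "K = 1 + (\<Sum>j<p. \<Sum>k<p. \<bar>R $$ (j, k)\<bar>)"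
  have K: "K > 0"
    unfolding K_def by (intro add_pos_nonneg sum_nonneg) auto
  have le: "bform p A u u \<le> \<mu> - 1 / K" if unit: "(\<Sum>j<p. (u j)\<^sup>2) = 1" for u
  proof -
    define w where "w j = matvec p (\<lambda>j k. R $$ (j, k)) u j" for j
    have Hw: "matvec p H w j = u j" if "j < p" for j
    proof -
      have "?H *\<^sub>v (R *\<^sub>v Matrix.vec p u) = Matrix.vec p u"
        using R by (simp flip: assoc_mult_mat_vec[of _ p p _ p])
      then have "matvec p H (($) (R *\<^sub>v Matrix.vec p u)) j = u j"
        using that R(1) by (metis mult_index mult_mat_vec_carrier vec_carrier index_vec)
      moreover have "(R *\<^sub>v Matrix.vec p u) $ k = w k" if "k < p" for k
        using that R(1) by (simp add: w_def matvec_def scalar_prod_def lessThan_atLeast0)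
      ultimately show ?thesis
        by (simp add: matvec_def)
    qed
    have uw: "bform p H u w = 1"
      using unit by (simp add: bform_def Hw power2_eq_square)
    have "bform p H w w = bform p (\<lambda>j k. R $$ (j, k)) u u"
    proof -
      have "bform p H w w = (\<Sum>j<p. w j * u j)"
        unfolding bform_def by (intro sum.cong refl) (simp add: Hw)
      then show ?thesis
        by (simp add: bform_def w_def mult.commute)
    qed
    also have "\<dots> \<le> K"
      using bform_bound[of p u "\<lambda>j k. R $$ (j, k)"] unit_le[OF unit] by (simp add: K_def)
    finally have ww: "bform p H w w \<le> K" .
    \<comment> \<open>With \<open>w\<close> = \<open>H\<close> inverse applied to \<open>u\<close>,
      the mixed term is 1. Evaluating the nonnegative form at u - w/K gives 0 \<le> H(u,u) - 2/K +
      1/K, a gap of 1/K below \<mu> uniformly on the sphere.\<close>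
    have "0 \<le> bform p H (\<lambda>j. u j + (- 1 / K) * w j) (\<lambda>j. u j + (- 1 / K) * w j)"
      using le_\<mu>' by (simp only: bform_H) simp
    also have "\<dots> = bform p H u u - 2 / K + (1 / K)\<^sup>2 * bform p H w w"
      unfolding bform_add_square[of H p, OF H_sym] uw by simp
    also have "(1 / K)\<^sup>2 * bform p H w w \<le> (1 / K)\<^sup>2 * K"
      using ww by (intro mult_left_mono) auto
    also have "(1 / K)\<^sup>2 * K = 1 / K"
      using K by (simp add: power2_eq_square)
    finally show ?thesis
      by (simp add: bform_H unit)
  qed
  have "S \<noteq> {}"
    using normalize[OF pos] by (auto simp: S_def)
  then have "Sup S \<le> \<mu> - 1 / K"
    by (rule cSup_least) (auto simp: S_def intro: le)
  then show False
    using K by (simp add: \<mu>_def)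
qed

text \<open>Maurey's empirical method, derandomized: the left-hand side is the mean of
  \<open>bform A (y + Z\<^sub>1 + \<dots> + Z\<^sub>k)\<close> for independent \<open>Z\<^sub>i\<close> equal to \<open>\<plusminus>\<xi> e\<^sub>j\<close> with probability \<open>\<bar>x\<^sub>j\<bar>/\<xi>\<close>.\<close>

lemma Maurey_induction:
  assumes sym: "\<And>j k. A j k = A k j"
    and sparse: "\<And>v. card {j. j < p \<and> v j \<noteq> 0} \<le> N \<Longrightarrow> 0 \<le> bform p A v v"
    and \<xi>: "\<xi> = (\<Sum>j<p. \<bar>x j\<bar>)"
    and "k \<le> N" "card {j. j < p \<and> y j \<noteq> 0} \<le> N - k"
  shows "0 \<le> bform p A y y + 2 * real k * bform p A y x + k * (real k - 1) * bform p A x x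
    + k * \<xi> * (\<Sum>j<p. \<bar>x j\<bar> * A j j)"
  using assms(4,5)
proof (induction k arbitrary: y)
  case 0
  then show ?case using sparse[of y] by simp
next
  case (Suc k)
  let ?S = "\<Sum>j<p. \<bar>x j\<bar> * A j j"
  let ?B = "bform p A"
  show ?case
  proof (cases "\<xi> = 0")
    case True
    then have x0: "x j = 0" if "j < p" for j
      using that unfolding \<xi> by (subst (asm) sum_nonneg_eq_0_iff) auto
    then have "?B x x = 0" "?B y x = 0"
      using bform_commute[of A p y x, OF sym] by (auto simp: bform_def)
    moreover have "0 \<le> ?B y y"
      using Suc.prems by (intro sparse) auto
    ultimately show ?thesis
      using True by simp
  next
    case False
    have \<xi>_pos: "\<xi> > 0"
      using False unfolding \<xi> by (metis abs_ge_zero less_eq_real_def sum_nonneg)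
    \<comment> \<open>The value taken by the next random summand with probability
      \<bar>x_j\<bar>/\<xi>; \<open>z j\<close> is \<open>y\<close> after adding it.\<close>
    define e where "e j = (\<lambda>i. if i = j then sgn (x j) * \<xi> else 0)" for j
    define z where "z j = (\<lambda>i. y i + 1 * e j i)" for j
    have By: "?B y (e j) = sgn (x j) * \<xi> * (\<Sum>i<p. y i * A i j)"
      and Bx: "?B x (e j) = sgn (x j) * \<xi> * (\<Sum>i<p. x i * A i j)"
      and Be: "?B (e j) (e j) = (sgn (x j))\<^sup>2 * \<xi>\<^sup>2 * A j j" if "j < p" for j
      unfolding e_def bform_upd_right[OF that] using that
      by (auto simp: if_distrib[of "\<lambda>c. c * _"] power2_eq_square cong: if_cong)
    have IH: "0 \<le> \<bar>x j\<bar> * (?B y y + 2 * ?B y (e j) + ?B (e j) (e j) + 2 * real k * (?B y x + ?B x (e j))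
        + k * (real k - 1) * ?B x x + k * \<xi> * ?S)" if "j < p" for j
    proof -
      \<comment> \<open>Each summand uses up one coordinate of the sparsity budget \<open>N\<close>,
        which is why the bound on the support of \<open>y\<close> shrinks with
        \<open>k\<close>.\<close>
      have "{i. i < p \<and> z j i \<noteq> 0} \<subseteq> insert j {i. i < p \<and> y i \<noteq> 0}"
        by (auto simp: z_def e_def)
      then have "card {i. i < p \<and> z j i \<noteq> 0} \<le> card (insert j {i. i < p \<and> y i \<noteq> 0})"
        by (intro card_mono) auto
      also have "\<dots> \<le> Suc (card {i. i < p \<and> y i \<noteq> 0})"
        by (simp add: card_insert_if)
      also have "\<dots> \<le> N - k"
        using Suc.prems by linarith
      finally have "0 \<le> ?B (z j) (z j) + 2 * real k * ?B (z j) x + k * (real k - 1) * ?B x x + k * \<xi> * ?S"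
        using Suc.prems by (intro Suc.IH) auto
      moreover have "?B (z j) (z j) = ?B y y + 2 * ?B y (e j) + ?B (e j) (e j)"
        unfolding z_def bform_add_square[of A p, OF sym] by simp
      moreover have "?B (z j) x = ?B y x + ?B x (e j)"
        unfolding z_def bform_add_left bform_commute[of A p "e j" x, OF sym] by simp
      ultimately show ?thesis
        by simp
    qed
    have abs_sgn: "\<bar>x j\<bar> * sgn (x j) = x j" for j
      by (auto simp: sgn_if)
    \<comment> \<open>The random summand has mean \<open>x\<close>; the weights are not divided by
      \<xi>, hence the extra factor \<xi>.\<close>
    have avg: "(\<Sum>j<p. \<bar>x j\<bar> * ?B u (e j)) = \<xi> * ?B u x"
      if "\<And>j. j < p \<Longrightarrow> ?B u (e j) = sgn (x j) * \<xi> * (\<Sum>i<p. u i * A i j)" for u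
    proof -
      have "(\<Sum>j<p. \<bar>x j\<bar> * ?B u (e j)) = (\<Sum>j<p. \<xi> * (x j * (\<Sum>i<p. u i * A i j)))"
      proof (intro sum.cong refl)
        fix j assume "j \<in> {..<p}"
        then have "\<bar>x j\<bar> * ?B u (e j) = (\<bar>x j\<bar> * sgn (x j)) * \<xi> * (\<Sum>i<p. u i * A i j)"
          by (simp add: that)
        then show "\<bar>x j\<bar> * ?B u (e j) = \<xi> * (x j * (\<Sum>i<p. u i * A i j))"
          unfolding abs_sgn by simp
      qed
      also have "\<dots> = \<xi> * (\<Sum>j<p. x j * matvec p A u j)"
        by (simp add: sum_distrib_left matvec_def sym[of _ j for j] mult_ac)
      finally show ?thesis
        by (simp add: bform_commute[of A p u x, OF sym] bform_def[of p A x u])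
    qed
    have avg_y: "(\<Sum>j<p. \<bar>x j\<bar> * ?B y (e j)) = \<xi> * ?B y x"
      by (rule avg) (rule By)
    have avg_x: "(\<Sum>j<p. \<bar>x j\<bar> * ?B x (e j)) = \<xi> * ?B x x"
      by (rule avg) (rule Bx)
    \<comment> \<open>The second moment of the random summand. It involves the diagonal of
      \<open>A\<close> alone, which makes the sampling error small.\<close>
    have diag: "(\<Sum>j<p. \<bar>x j\<bar> * ?B (e j) (e j)) = \<xi>\<^sup>2 * ?S"
      unfolding sum_distrib_left
    proof (intro sum.cong refl)
      fix j assume "j \<in> {..<p}"
      then show "\<bar>x j\<bar> * ?B (e j) (e j) = \<xi>\<^sup>2 * (\<bar>x j\<bar> * A j j)"
        by (cases "x j = 0") (auto simp: Be sgn_if)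
    qed
    have "0 \<le> (\<Sum>j<p. \<bar>x j\<bar> * (?B y y + 2 * ?B y (e j) + ?B (e j) (e j) + 2 * real k * (?B y x + ?B x (e j))
        + k * (real k - 1) * ?B x x + k * \<xi> * ?S))"
      by (intro sum_nonneg IH) auto
    also have "\<dots> = (\<Sum>j<p. \<bar>x j\<bar> * (?B y y + 2 * real k * ?B y x + k * (real k - 1) * ?B x x + k * \<xi> * ?S)
        + 2 * (\<bar>x j\<bar> * ?B y (e j)) + \<bar>x j\<bar> * ?B (e j) (e j) + 2 * real k * (\<bar>x j\<bar> * ?B x (e j)))"
      by (intro sum.cong refl) (simp add: algebra_simps)
    also have "\<dots> = \<xi> * (?B y y + 2 * real k * ?B y x + k * (real k - 1) * ?B x x + k * \<xi> * ?S)
        + 2 * (\<xi> * ?B y x) + \<xi>\<^sup>2 * ?S + 2 * real k * (\<xi> * ?B x x)"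
      unfolding sum.distrib sum_distrib_left[symmetric] sum_distrib_right[symmetric] \<xi>[symmetric]
        avg_y avg_x diag ..
    also have "\<dots> = \<xi> * (?B y y + 2 * real (Suc k) * ?B y x + Suc k * (real (Suc k) - 1) * ?B x x + Suc k * \<xi> * ?S)"
      by (simp add: algebra_simps power2_eq_square)
    finally show ?thesis
      using \<xi>_pos by (simp add: zero_le_mult_iff)
  qed
qed

section \<open>Empirical means and deterministic inequalities for the lasso\<close>

lemma emp_mean_add: "emp_mean T (\<lambda>i. f i + g i) = emp_mean T f + emp_mean T g"
  by (simp add: emp_mean_def sum.distrib add_divide_distrib)

lemma emp_mean_diff: "emp_mean T (\<lambda>i. f i - g i) = emp_mean T f - emp_mean T g"
  by (simp add: emp_mean_def sum_subtractf diff_divide_distrib)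

lemma emp_mean_cmult: "emp_mean T (\<lambda>i. c * f i) = c * emp_mean T f"
  by (simp add: emp_mean_def sum_distrib_left)

lemma emp_mean_sum: "emp_mean T (\<lambda>i. \<Sum>j\<in>J. f j i) = (\<Sum>j\<in>J. emp_mean T (f j))"
  unfolding emp_mean_def sum_divide_distrib[symmetric] by (subst sum.swap) simp

lemma emp_mean_mono: "(\<And>i. i \<in> T \<Longrightarrow> f i \<le> g i) \<Longrightarrow> emp_mean T f \<le> emp_mean T g"
  unfolding emp_mean_def by (intro divide_right_mono sum_mono) auto

lemma emp_mean_nonneg: "(\<And>i. i \<in> T \<Longrightarrow> 0 \<le> f i) \<Longrightarrow> 0 \<le> emp_mean T f"
  unfolding emp_mean_def by (intro divide_nonneg_nonneg sum_nonneg) auto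

lemma bform_emp_gram:
  "bform p (\<lambda>j k. emp_mean T (\<lambda>i. B j i * B k i)) u v
    = emp_mean T (\<lambda>i. dict_comb B p u i * dict_comb B p v i)"
proof -
  have "emp_mean T (\<lambda>i. dict_comb B p u i * dict_comb B p v i)
      = (\<Sum>j<p. \<Sum>k<p. emp_mean T (\<lambda>i. (u j * B j i) * (v k * B k i)))"
    unfolding dict_comb_def sum_product emp_mean_sum ..
  also have "\<dots> = (\<Sum>j<p. \<Sum>k<p. u j * (emp_mean T (\<lambda>i. B j i * B k i) * v k))"
    by (intro sum.cong refl) (simp add: mult_ac flip: emp_mean_cmult)
  finally show ?thesis
    by (simp add: bform_def matvec_def sum_distrib_left)
qed

lemma dict_comb_diff: "dict_comb B p (\<lambda>j. u j - v j) x = dict_comb B p u x - dict_comb B p v x"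
  by (simp add: dict_comb_def left_diff_distrib sum_subtractf)

text \<open>The transfer principle. It is needed because the lasso error may lie outside the cone of the
  restricted eigenvalue condition when the approximation error dominates.\<close>

lemma emp_gram_lower_bound:
  assumes sparse: "\<And>v. card {j. j < p \<and> v j \<noteq> 0} \<le> N \<Longrightarrow>
      c * (\<Sum>j<p. (v j)\<^sup>2) \<le> emp_mean T (\<lambda>i. (dict_comb B p v i)\<^sup>2)"
    and diag: "\<And>j. j < p \<Longrightarrow> emp_mean T (\<lambda>i. (B j i)\<^sup>2) \<le> D"
    and "c \<ge> 0" "N \<ge> 2"
  shows "c * (\<Sum>j<p. (x j)\<^sup>2) \<le> emp_mean T (\<lambda>i. (dict_comb B p x i)\<^sup>2) + D / (real N - 1) * (\<Sum>j<p. \<bar>x j\<bar>)\<^sup>2"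
proof -
  define G where "G j k = emp_mean T (\<lambda>i. B j i * B k i)" for j k
  \<comment> \<open>The Gram matrix minus \<open>c\<close> times the identity has a nonnegative form
    on \<open>N\<close>-sparse vectors, by \<open>sparse\<close>.\<close>
  define A where "A j k = G j k - (if j = k then c else 0)" for j k
  let ?\<xi> = "\<Sum>j<p. \<bar>x j\<bar>"
  have A_sym: "A j k = A k j" for j k
    by (simp add: A_def G_def mult.commute)
  have form: "bform p A v v = emp_mean T (\<lambda>i. (dict_comb B p v i)\<^sup>2) - c * (\<Sum>j<p. (v j)\<^sup>2)" for v
  proof -
    have "matvec p A v j = matvec p G v j - c * v j" if "j < p" for j
      unfolding matvec_def A_def using that
      by (simp add: left_diff_distrib sum_subtractf if_distrib[of "\<lambda>c. c * _"] cong: if_cong)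
    then have "bform p A v v = (\<Sum>j<p. v j * (matvec p G v j - c * v j))"
      unfolding bform_def by (intro sum.cong refl) simp
    also have "\<dots> = bform p G v v - c * (\<Sum>j<p. (v j)\<^sup>2)"
      by (simp add: bform_def right_diff_distrib sum_subtractf sum_distrib_left power2_eq_square mult_ac)
    also have "bform p G v v = emp_mean T (\<lambda>i. (dict_comb B p v i)\<^sup>2)"
      unfolding G_def bform_emp_gram power2_eq_square ..
    finally show ?thesis .
  qed
  have zero: "bform p A (\<lambda>_. 0) u = 0" for u
    by (simp add: bform_def)
  \<comment> \<open>Starting at 0 with all \<open>N\<close> summands, every realization of the sum
    is \<open>N\<close>-sparse. Division by \<open>N\<close> leaves N - 1 in front of the form at
    \<open>x\<close>, the origin of the denominator in the claim.\<close>
  have "0 \<le> bform p A (\<lambda>_. 0) (\<lambda>_. 0) + 2 * real N * bform p A (\<lambda>_. 0) x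
      + N * (real N - 1) * bform p A x x + N * ?\<xi> * (\<Sum>j<p. \<bar>x j\<bar> * A j j)"
    using A_sym sparse by (intro Maurey_induction[of A p N]) (auto simp: form)
  then have "0 \<le> N * ((real N - 1) * bform p A x x + ?\<xi> * (\<Sum>j<p. \<bar>x j\<bar> * A j j))"
    by (simp add: zero algebra_simps)
  then have "0 \<le> (real N - 1) * bform p A x x + ?\<xi> * (\<Sum>j<p. \<bar>x j\<bar> * A j j)"
    using \<open>N \<ge> 2\<close> by (simp add: zero_le_mult_iff)
  also have "?\<xi> * (\<Sum>j<p. \<bar>x j\<bar> * A j j) \<le> ?\<xi> * (\<Sum>j<p. \<bar>x j\<bar> * D)"
  proof (intro mult_left_mono sum_mono)
    fix j assume "j \<in> {..<p}"
    then show "A j j \<le> D"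
      using diag[of j] \<open>c \<ge> 0\<close> by (simp add: A_def G_def power2_eq_square)
  qed (auto intro: sum_nonneg)
  also have "\<dots> = D * ?\<xi>\<^sup>2"
    by (simp add: power2_eq_square flip: sum_distrib_right)
  also have "(real N - 1) * bform p A x x + D * ?\<xi>\<^sup>2 = (real N - 1) * (bform p A x x + D / (real N - 1) * ?\<xi>\<^sup>2)"
    using \<open>N \<ge> 2\<close> by (simp add: distrib_left)
  finally have "0 \<le> (real N - 1) * (bform p A x x + D / (real N - 1) * ?\<xi>\<^sup>2)"
    by simp
  then have "0 \<le> bform p A x x + D / (real N - 1) * ?\<xi>\<^sup>2"
    using \<open>N \<ge> 2\<close> by (simp add: zero_le_mult_iff)
  then show ?thesis
    by (simp add: form)
qed

text \<open>The bias enters through the in-sample error of \<open>v\<close>, so no bound on the norm of \<open>v\<close> is needed.\<close>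

lemma lasso_basic_inequality:
  assumes opt: "- 2 * (\<Sum>j<p. \<mu> j * u j) + emp_mean T (\<lambda>i. (dict_comb B p u i)\<^sup>2) + 2 * r * (\<Sum>j<p. \<bar>u j\<bar>)
      \<le> - 2 * (\<Sum>j<p. \<mu> j * v j) + emp_mean T (\<lambda>i. (dict_comb B p v i)\<^sup>2) + 2 * r * (\<Sum>j<p. \<bar>v j\<bar>)"
    and score: "\<And>j. j < p \<Longrightarrow> \<bar>\<mu> j - emp_mean T (\<lambda>i. a i * B j i)\<bar> \<le> \<eta>"
  shows "emp_mean T (\<lambda>i. (dict_comb B p (\<lambda>j. u j - v j) i)\<^sup>2) / 2
    \<le> 2 * emp_mean T (\<lambda>i. (a i - dict_comb B p v i)\<^sup>2) + 2 * \<eta> * (\<Sum>j<p. \<bar>u j - v j\<bar>)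
      + 2 * r * ((\<Sum>j<p. \<bar>v j\<bar>) - (\<Sum>j<p. \<bar>u j\<bar>))"
proof -
  let ?d = "\<lambda>j. u j - v j"
  let ?D = "dict_comb B p ?d" and ?V = "dict_comb B p v"
  let ?s = "\<lambda>j. \<mu> j - emp_mean T (\<lambda>i. a i * B j i)"
  have u_eq: "dict_comb B p u i = ?V i + ?D i" for i
    by (simp add: dict_comb_diff)
  have quad: "emp_mean T (\<lambda>i. (dict_comb B p u i)\<^sup>2)
      = emp_mean T (\<lambda>i. (?V i)\<^sup>2) + 2 * emp_mean T (\<lambda>i. ?V i * ?D i) + emp_mean T (\<lambda>i. (?D i)\<^sup>2)"
    unfolding u_eq by (simp add: power2_sum emp_mean_add mult.assoc flip: emp_mean_cmult)
  have aD: "emp_mean T (\<lambda>i. a i * ?D i) = (\<Sum>j<p. emp_mean T (\<lambda>i. a i * B j i) * ?d j)"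
  proof -
    have "emp_mean T (\<lambda>i. a i * ?D i) = emp_mean T (\<lambda>i. \<Sum>j<p. ?d j * (a i * B j i))"
      by (simp add: dict_comb_def sum_distrib_left mult_ac)
    then show ?thesis
      by (simp add: emp_mean_sum emp_mean_cmult mult.commute)
  qed
  have "(\<Sum>j<p. ?s j * ?d j) = (\<Sum>j<p. \<mu> j * u j) - (\<Sum>j<p. \<mu> j * v j) - emp_mean T (\<lambda>i. a i * ?D i)"
    unfolding aD sum_subtractf[symmetric] by (intro sum.cong refl) (simp add: algebra_simps)
  then have "emp_mean T (\<lambda>i. (?D i)\<^sup>2)
      \<le> 2 * (emp_mean T (\<lambda>i. a i * ?D i) - emp_mean T (\<lambda>i. ?V i * ?D i)) + 2 * (\<Sum>j<p. ?s j * ?d j)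
        + 2 * r * ((\<Sum>j<p. \<bar>v j\<bar>) - (\<Sum>j<p. \<bar>u j\<bar>))"
    using opt unfolding quad by (simp add: algebra_simps)
  moreover have "2 * (emp_mean T (\<lambda>i. a i * ?D i) - emp_mean T (\<lambda>i. ?V i * ?D i))
      \<le> 2 * emp_mean T (\<lambda>i. (a i - ?V i)\<^sup>2) + emp_mean T (\<lambda>i. (?D i)\<^sup>2) / 2"
  proof -
    \<comment> \<open>Young's inequality, weighted so that half of the quadratic term remains on the
      left of the final bound.\<close>
    have "2 * ((a i - ?V i) * ?D i) \<le> 2 * (a i - ?V i)\<^sup>2 + 1 / 2 * (?D i)\<^sup>2" for i
      using zero_le_power2[of "2 * (a i - ?V i) - ?D i"] by (simp add: power2_eq_square algebra_simps)
    then have "emp_mean T (\<lambda>i. 2 * ((a i - ?V i) * ?D i)) \<le> emp_mean T (\<lambda>i. 2 * (a i - ?V i)\<^sup>2 + 1 / 2 * (?D i)\<^sup>2)"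
      by (intro emp_mean_mono)
    then show ?thesis
      unfolding emp_mean_add emp_mean_cmult by (simp add: left_diff_distrib emp_mean_diff)
  qed
  moreover have "(\<Sum>j<p. ?s j * ?d j) \<le> \<eta> * (\<Sum>j<p. \<bar>?d j\<bar>)"
    unfolding sum_distrib_left
  proof (intro sum_mono)
    fix j assume "j \<in> {..<p}"
    then have "\<bar>?s j\<bar> * \<bar>?d j\<bar> \<le> \<eta> * \<bar>?d j\<bar>"
      using score by (intro mult_right_mono) auto
    then have "\<bar>?s j * ?d j\<bar> \<le> \<eta> * \<bar>?d j\<bar>"
      by (simp only: abs_mult)
    then show "?s j * ?d j \<le> \<eta> * \<bar>?d j\<bar>"
      by (rule order_trans[OF abs_ge_self])
  qed
  ultimately show ?thesis
    by (simp add: algebra_simps)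
qed

lemma lasso_slow_rate:
  fixes r A D e :: real
  assumes basic: "D / 2 \<le> 2 * e + 2 * (r / 4) * (\<Sum>j<p. \<bar>u j - v j\<bar>) + 2 * r * ((\<Sum>j<p. \<bar>v j\<bar>) - (\<Sum>j<p. \<bar>u j\<bar>))"
    and "0 \<le> D" "e \<le> r" "(\<Sum>j<p. \<bar>v j\<bar>) \<le> A" "r > 0"
  shows "(\<Sum>j<p. \<bar>u j\<bar>) \<le> 2 + 2 * A" and "D \<le> (4 + 5 * A) * r"
proof -
  let ?u = "\<Sum>j<p. \<bar>u j\<bar>" and ?v = "\<Sum>j<p. \<bar>v j\<bar>"
  have A: "0 \<le> A"
    using assms(4) by (meson abs_ge_zero order_trans sum_nonneg)
  have "(\<Sum>j<p. \<bar>u j - v j\<bar>) \<le> ?u + ?v"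
    unfolding sum.distrib[symmetric] by (intro sum_mono) auto
  then have "r * (\<Sum>j<p. \<bar>u j - v j\<bar>) \<le> r * (?u + ?v)"
    using \<open>r > 0\<close> by (intro mult_left_mono) auto
  moreover have "r * ?v \<le> r * A"
    using assms(4,5) by (intro mult_left_mono) auto
  ultimately have main: "D / 2 \<le> 2 * r + 5 / 2 * (r * A) - 3 / 2 * (r * ?u)"
    using basic \<open>e \<le> r\<close> by (simp add: algebra_simps)
  then have "r * ?u * 3 \<le> r * (4 + 5 * A)"
    using \<open>0 \<le> D\<close> by (simp add: algebra_simps)
  then have "?u * 3 \<le> 4 + 5 * A"
    using \<open>r > 0\<close> by (simp add: mult.assoc)
  then show "?u \<le> 2 + 2 * A"
    using A by linarith
  have "0 \<le> r * ?u"
    using \<open>r > 0\<close> by (intro mult_nonneg_nonneg sum_nonneg) auto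
  then show "D \<le> (4 + 5 * A) * r"
    using main by (simp add: algebra_simps)
qed

text \<open>A quadratic inequality in the Euclidean error \<open>y\<close>. The error need not lie
  in a cone, since \<open>e\<close> may dominate; instead its l1 norm is at most a multiple of sqrt
  s times (R + y), and the l1 remainder in \<open>lower\<close> is absorbed because \<open>N\<close>
  is much larger than \<open>s\<close>. Here \<open>R\<close> = r sqrt s is the target rate.\<close>

lemma lasso_fast_rate:
  fixes r c D e K :: real and s N p :: nat
  defines "K \<equiv> 4 * (4 + c + 25 / c) / c"
  assumes basic: "D / 2 \<le> 2 * e + 2 * (r / 4) * (\<Sum>j<p. \<bar>u j - v j\<bar>) + 2 * r * ((\<Sum>j<p. \<bar>v j\<bar>) - (\<Sum>j<p. \<bar>u j\<bar>))"
    and sparse: "card {j. j < p \<and> v j \<noteq> 0} = s" "s > 0"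
    and lower: "c * (\<Sum>j<p. (u j - v j)\<^sup>2) \<le> D + E / (real N - 1) * (\<Sum>j<p. \<bar>u j - v j\<bar>)\<^sup>2"
    and "c > 0" "r > 0" "0 \<le> D" "0 \<le> e" "e \<le> r\<^sup>2 * s" "0 \<le> E" "36 * E * s \<le> c * (real N - 1)" "N \<ge> 2"
  shows "(\<Sum>j<p. (u j - v j)\<^sup>2) \<le> K * (r\<^sup>2 * s)"
proof -
  define S where "S = {j. j < p \<and> v j \<noteq> 0}"
  define dS where "dS = (\<Sum>j\<in>S. \<bar>u j - v j\<bar>)"
  define dC where "dC = (\<Sum>j\<in>{..<p} - S. \<bar>u j - v j\<bar>)"
  define y where "y = sqrt (\<Sum>j<p. (u j - v j)\<^sup>2)"
  define R where "R = r * sqrt s"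
  have S: "S \<subseteq> {..<p}" "finite S"
    by (auto simp: S_def)
  have d: "(\<Sum>j<p. \<bar>u j - v j\<bar>) = dS + dC"
    unfolding dS_def dC_def using sum.subset_diff[OF S(1)] by (simp add: add.commute)
  have y2: "y\<^sup>2 = (\<Sum>j<p. (u j - v j)\<^sup>2)"
    unfolding y_def by (simp add: sum_nonneg)
  have y0: "0 \<le> y"
    unfolding y_def by (simp add: sum_nonneg)
  have R2: "R\<^sup>2 = r\<^sup>2 * s" and R0: "0 < R"
    using \<open>r > 0\<close> \<open>s > 0\<close> by (auto simp: R_def power_mult_distrib)
  \<comment> \<open>On the support of \<open>v\<close> the triangle inequality, off the support
    \<bar>v j\<bar> - \<bar>u j\<bar> = - \<bar>u j - v j\<bar>.\<close>
  have "(\<Sum>j<p. \<bar>v j\<bar>) - (\<Sum>j<p. \<bar>u j\<bar>)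
      = (\<Sum>j\<in>S. \<bar>v j\<bar> - \<bar>u j\<bar>) + (\<Sum>j\<in>{..<p} - S. \<bar>v j\<bar> - \<bar>u j\<bar>)"
    unfolding sum_subtractf[symmetric] using sum.subset_diff[OF S(1)] by (simp add: add.commute)
  also have "\<dots> \<le> dS - dC"
    unfolding dS_def dC_def diff_conv_add_uminus sum_negf[symmetric]
    by (intro add_mono sum_mono) (auto simp: S_def)
  finally have "r * ((\<Sum>j<p. \<bar>v j\<bar>) - (\<Sum>j<p. \<bar>u j\<bar>)) \<le> r * (dS - dC)"
    using \<open>r > 0\<close> by (intro mult_left_mono) auto
  then have "r * (\<Sum>j<p. \<bar>v j\<bar>) - r * (\<Sum>j<p. \<bar>u j\<bar>) \<le> r * dS - r * dC"
    by (simp add: right_diff_distrib)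
  moreover have "D / 2 \<le> 2 * e + (r * dS + r * dC) / 2 + 2 * (r * (\<Sum>j<p. \<bar>v j\<bar>)) - 2 * (r * (\<Sum>j<p. \<bar>u j\<bar>))"
    using basic unfolding d by (simp add: algebra_simps)
  moreover have "D / 2 \<le> 2 * e + 5 / 2 * y - 3 / 2 * z"
    if "a - b \<le> y - z" "D / 2 \<le> 2 * e + (y + z) / 2 + 2 * a - 2 * b" for a b y z :: real
    using that by (simp add: field_simps)
  ultimately have main: "D / 2 \<le> 2 * e + 5 / 2 * (r * dS) - 3 / 2 * (r * dC)"
    by blast
  have dS_nonneg: "0 \<le> dS" and dC_nonneg: "0 \<le> dC"
    by (auto simp: dS_def dC_def sum_nonneg)
  have "dS\<^sup>2 \<le> real (card S) * (\<Sum>j\<in>S. \<bar>u j - v j\<bar>\<^sup>2)"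
    unfolding dS_def using sum_squared_le_sum_of_squares[of "\<lambda>j. \<bar>u j - v j\<bar>" S] by (simp add: mult.commute)
  also have "\<dots> \<le> s * y\<^sup>2"
    unfolding y2 using S sparse(1) by (auto simp: S_def intro!: mult_left_mono sum_mono2)
  also have "\<dots> = (sqrt s * y)\<^sup>2"
    by (simp add: power_mult_distrib)
  finally have dS: "dS \<le> sqrt s * y"
    using y0 by (rule_tac power2_le_imp_le) auto
  have rdS: "r * dS \<le> R * y"
    using mult_left_mono[OF dS, of r] \<open>r > 0\<close> by (simp add: R_def mult.assoc)
  have D_le: "D \<le> 4 * R\<^sup>2 + 5 * (R * y)"
  proof -
    have "0 \<le> r * dC" using \<open>r > 0\<close> dC_nonneg by simp
    then show ?thesis
      using main rdS \<open>e \<le> r\<^sup>2 * s\<close> unfolding R2 by linarith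
  qed
  \<comment> \<open>As \<open>D\<close> is nonnegative, \<open>main\<close> bounds
    \<open>r * dC\<close> by 4/3 R^2 + 5/3 R y. Adding \<open>r * dS\<close> gives the coefficient
    8/3 of R y, rounded up to 3.\<close>
  have "r * (dS + dC) \<le> r * (4 / 3 * (sqrt s * R) + 3 * (sqrt s * y))"
  proof -
    have "r * (sqrt s * R) = R\<^sup>2" "r * (sqrt s * y) = R * y"
      by (simp_all add: R_def power2_eq_square)
    moreover have "0 \<le> R * y"
      using R0 y0 by simp
    moreover have "r * dS + r * dC \<le> 4 / 3 * R\<^sup>2 + 3 * (R * y)"
      using main rdS \<open>e \<le> r\<^sup>2 * s\<close> \<open>0 \<le> D\<close> \<open>0 \<le> R * y\<close> unfolding R2[symmetric] by argo
    moreover have "r * (4 / 3 * (sqrt s * R) + 3 * (sqrt s * y)) = 4 / 3 * (r * (sqrt s * R)) + 3 * (r * (sqrt s * y))"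
      by (simp add: algebra_simps)
    ultimately show ?thesis
      by (simp only: distrib_left[of r dS])
  qed
  then have "dS + dC \<le> 4 / 3 * (sqrt s * R) + 3 * (sqrt s * y)"
    using \<open>r > 0\<close> by (rule mult_left_le_imp_le)
  then have "dS + dC \<le> sqrt s * (4 / 3 * R + 3 * y)"
    by (simp add: algebra_simps)
  then have "(dS + dC)\<^sup>2 \<le> (sqrt s * (4 / 3 * R + 3 * y))\<^sup>2"
    using dS_nonneg dC_nonneg by (intro power_mono) auto
  also have "\<dots> = s * (4 / 3 * R + 3 * y)\<^sup>2"
    by (simp add: power_mult_distrib)
  also have "\<dots> \<le> s * (4 * R\<^sup>2 + 18 * y\<^sup>2)"
  proof (rule mult_left_mono)
    have "(4 / 3 * R + 3 * y)\<^sup>2 + (4 / 3 * R - 3 * y)\<^sup>2 = 32 / 9 * R\<^sup>2 + 18 * y\<^sup>2"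
      by (simp add: power2_eq_square algebra_simps)
    moreover have "0 \<le> (4 / 3 * R - 3 * y)\<^sup>2" "0 \<le> R\<^sup>2"
      by simp_all
    ultimately show "(4 / 3 * R + 3 * y)\<^sup>2 \<le> 4 * R\<^sup>2 + 18 * y\<^sup>2"
      by linarith
  qed simp
  finally have d2: "(dS + dC)\<^sup>2 \<le> s * (4 * R\<^sup>2 + 18 * y\<^sup>2)" .
  \<comment> \<open>The constant 36 is twice the coefficient 18 of y^2: the remainder then takes
    away at most half of the curvature \<open>c\<close>.\<close>
  have "E / (real N - 1) * (dS + dC)\<^sup>2 \<le> E / (real N - 1) * (s * (4 * R\<^sup>2 + 18 * y\<^sup>2))"
    using d2 \<open>0 \<le> E\<close> \<open>N \<ge> 2\<close> by (intro mult_left_mono) auto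
  also have "\<dots> = E * s / (real N - 1) * (4 * R\<^sup>2 + 18 * y\<^sup>2)"
    by simp
  also have "\<dots> \<le> c / 36 * (4 * R\<^sup>2 + 18 * y\<^sup>2)"
    using \<open>36 * E * s \<le> c * (real N - 1)\<close> \<open>N \<ge> 2\<close>
    by (intro mult_right_mono) (auto simp: field_simps)
  finally have E_le: "E / (real N - 1) * (dS + dC)\<^sup>2 \<le> c / 9 * R\<^sup>2 + c / 2 * y\<^sup>2"
    by (simp add: algebra_simps)
  \<comment> \<open>Young's inequality, weighted to take another quarter of the curvature; c/4
    remains for the conclusion.\<close>
  have "5 * (R * y) \<le> 25 / c * R\<^sup>2 + c / 4 * y\<^sup>2"
  proof -
    have "0 \<le> (5 * R / sqrt c - sqrt c / 2 * y)\<^sup>2"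
      by simp
    also have "\<dots> = 25 / c * R\<^sup>2 + c / 4 * y\<^sup>2 - 5 * (R * y)"
      using \<open>c > 0\<close> by (simp add: power2_diff power_divide power_mult_distrib)
    finally show ?thesis by simp
  qed
  then have "c * y\<^sup>2 \<le> 4 * R\<^sup>2 + (25 / c * R\<^sup>2 + c / 4 * y\<^sup>2) + (c / 9 * R\<^sup>2 + c / 2 * y\<^sup>2)"
    using lower D_le E_le unfolding d y2[symmetric] by linarith
  moreover have "c / 9 * R\<^sup>2 \<le> c * R\<^sup>2"
    using \<open>c > 0\<close> by (intro mult_right_mono) auto
  ultimately have "c / 4 * y\<^sup>2 \<le> (4 + c + 25 / c) * R\<^sup>2"
    by (simp add: algebra_simps)
  then show ?thesis
    using \<open>c > 0\<close> unfolding K_def y2[symmetric] R2[symmetric] by (simp add: field_simps)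
qed

section \<open>The lasso for the Riesz representer\<close>

lemma quadratic_form_mat:
  assumes "\<rho> \<in> carrier_vec p"
  shows "\<rho> \<bullet> (Matrix.mat p p (\<lambda>(j, k). A j k) *\<^sub>v \<rho>) = bform p A (($) \<rho>) (($) \<rho>)"
  using assms by (simp add: scalar_prod_def bform_def matvec_def lessThan_atLeast0)

lemma quadratic_form_emp_gram:
  assumes "\<rho> \<in> carrier_vec p"
  shows "\<rho> \<bullet> (emp_gram X b p T d *\<^sub>v \<rho>) = emp_mean T (\<lambda>i. (dict_comb b p (($) \<rho>) (X (d i)))\<^sup>2)"
proof -
  have "emp_gram X b p T d = Matrix.mat p p (\<lambda>(j, k). emp_mean T (\<lambda>i. b j (X (d i)) * b k (X (d i))))"
    by (simp add: emp_gram_def emp_mean_def)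
  then show ?thesis
    using quadratic_form_mat[OF assms] bform_emp_gram[of p T "\<lambda>j i. b j (X (d i))"]
    by (simp add: power2_eq_square dict_comb_def)
qed

lemma lasso_objective_emp:
  assumes "\<rho> \<in> carrier_vec p"
  shows "lasso_objective (emp_moment m b p T d) (emp_gram X b p T d) r \<rho>
    = - 2 * (\<Sum>j<p. emp_mean T (\<lambda>i. m (d i) (b j)) * \<rho> $ j)
      + emp_mean T (\<lambda>i. (dict_comb b p (($) \<rho>) (X (d i)))\<^sup>2) + 2 * r * (\<Sum>j<p. \<bar>\<rho> $ j\<bar>)"
proof -
  have "emp_moment m b p T d \<bullet> \<rho> = (\<Sum>j<p. emp_mean T (\<lambda>i. m (d i) (b j)) * \<rho> $ j)"
    using assms by (simp add: emp_moment_def emp_mean_def scalar_prod_def lessThan_atLeast0)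
  then show ?thesis
    using assms by (simp add: lasso_objective_def quadratic_form_emp_gram l1_norm_def)
qed

text \<open>With \<open>J\<close> the support of \<open>v\<close> the cone constraint holds
  trivially, as nothing lies outside \<open>J\<close>. This lower bound on sparse vectors is the
  input of the transfer principle.\<close>

lemma restricted_eig_ge_sparse:
  assumes RE: "restricted_eig_ge (emp_gram X b p T d) p N c"
    and card: "card {j. j < p \<and> v j \<noteq> 0} \<le> N"
  shows "c * (\<Sum>j<p. (v j)\<^sup>2) \<le> emp_mean T (\<lambda>i. (dict_comb b p v (X (d i)))\<^sup>2)"
proof (cases "{j. j < p \<and> v j \<noteq> 0} = {}")
  case True
  then have "(\<Sum>j<p. (v j)\<^sup>2) = 0"
    by (intro sum.neutral) auto
  then show ?thesis
    by (simp add: emp_mean_nonneg)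
next
  case False
  define J where "J = {j. j < p \<and> v j \<noteq> 0}"
  let ?\<rho> = "Matrix.vec p v"
  have J: "J \<subseteq> {..<p}" "J \<noteq> {}" "finite J"
    using False by (auto simp: J_def)
  have "(\<Sum>j\<in>{..<p} - J. \<bar>?\<rho> $ j\<bar>) = 0"
    by (intro sum.neutral) (auto simp: J_def)
  moreover have "0 \<le> (\<Sum>j\<in>J. \<bar>?\<rho> $ j\<bar>)"
    by (intro sum_nonneg) auto
  moreover have "\<exists>j\<in>J. ?\<rho> $ j \<noteq> 0"
    using J by (auto simp: J_def)
  ultimately have "c \<le> (?\<rho> \<bullet> (emp_gram X b p T d *\<^sub>v ?\<rho>)) / (\<Sum>j\<in>J. (?\<rho> $ j)\<^sup>2)"
    using RE J card unfolding restricted_eig_ge_def J_def[symmetric] by (auto dest!: spec[of _ J])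
  also have "(\<Sum>j\<in>J. (?\<rho> $ j)\<^sup>2) = (\<Sum>j\<in>J. (v j)\<^sup>2)"
    using J by (intro sum.cong) auto
  also have "\<dots> = (\<Sum>j<p. (v j)\<^sup>2)"
    using J by (intro sum.mono_neutral_left) (auto simp: J_def)
  also have "?\<rho> \<bullet> (emp_gram X b p T d *\<^sub>v ?\<rho>) = emp_mean T (\<lambda>i. (dict_comb b p (($) ?\<rho>) (X (d i)))\<^sup>2)"
    by (rule quadratic_form_emp_gram) simp
  also have "\<dots> = emp_mean T (\<lambda>i. (dict_comb b p v (X (d i)))\<^sup>2)"
    by (simp add: dict_comb_def)
  finally have "c \<le> emp_mean T (\<lambda>i. (dict_comb b p v (X (d i)))\<^sup>2) / (\<Sum>j<p. (v j)\<^sup>2)" .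
  moreover obtain j where "j < p" "v j \<noteq> 0"
    using J(2) by (auto simp: J_def)
  then have "0 < (\<Sum>j<p. (v j)\<^sup>2)"
    by (intro sum_pos2[of _ j]) auto
  ultimately show ?thesis
    by (simp add: pos_le_divide_eq)
qed

lemma dict_vec_scalar_prod:
  "\<rho> \<in> carrier_vec p \<Longrightarrow> dict_vec b p x \<bullet> \<rho> = dict_comb b p (($) \<rho>) x"
  by (simp add: dict_vec_def dict_comb_def scalar_prod_def lessThan_atLeast0 mult.commute)

text \<open>An entrywise error of the matrix is paired with the squared l1 norm, which does not grow
  with the dimension when that norm is bounded.\<close>

lemma bform_perturb:
  assumes "\<And>j k. j < p \<Longrightarrow> k < p \<Longrightarrow> \<bar>A j k - B j k\<bar> \<le> \<delta>"
  shows "bform p B v v \<le> bform p A v v + \<delta> * (\<Sum>j<p. \<bar>v j\<bar>)\<^sup>2"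
proof -
  have "bform p B v v - bform p A v v = (\<Sum>j<p. \<Sum>k<p. v j * (B j k - A j k) * v k)"
    unfolding bform_def matvec_def sum_distrib_left sum_subtractf[symmetric]
    by (intro sum.cong refl) (simp add: algebra_simps)
  also have "\<dots> \<le> (\<Sum>j<p. \<Sum>k<p. \<delta> * (\<bar>v j\<bar> * \<bar>v k\<bar>))"
  proof (intro sum_mono)
    fix j k assume "j \<in> {..<p}" "k \<in> {..<p}"
    then have "\<bar>A j k - B j k\<bar> * (\<bar>v j\<bar> * \<bar>v k\<bar>) \<le> \<delta> * (\<bar>v j\<bar> * \<bar>v k\<bar>)"
      using assms by (intro mult_right_mono) auto
    then have "\<bar>v j * (B j k - A j k) * v k\<bar> \<le> \<delta> * (\<bar>v j\<bar> * \<bar>v k\<bar>)"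
      by (simp add: abs_mult abs_minus_commute mult_ac)
    then show "v j * (B j k - A j k) * v k \<le> \<delta> * (\<bar>v j\<bar> * \<bar>v k\<bar>)"
      by (rule order_trans[OF abs_ge_self])
  qed
  also have "\<dots> = \<delta> * (\<Sum>j<p. \<bar>v j\<bar>)\<^sup>2"
    unfolding power2_eq_square sum_product by (simp only: sum_distrib_left)
  finally show ?thesis by simp
qed

lemma AE_dict_comb_bound:
  fixes X :: "'w \<Rightarrow> 'x"
  assumes "AE w in F. \<forall>j. \<bar>b j (X w)\<bar> \<le> C"
  shows "AE w in F. \<bar>dict_comb b q v (X w)\<bar> \<le> (\<Sum>j<q. \<bar>v j\<bar>) * C"
  using assms
proof eventually_elim
  case (elim w)
  have "\<bar>dict_comb b q v (X w)\<bar> \<le> (\<Sum>j<q. \<bar>v j * b j (X w)\<bar>)"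
    unfolding dict_comb_def by (rule sum_abs)
  also have "\<dots> \<le> (\<Sum>j<q. \<bar>v j\<bar> * C)"
    using elim by (intro sum_mono) (simp add: abs_mult mult_left_mono)
  finally show ?case
    by (simp add: sum_distrib_right)
qed

text \<open>The lasso of one fold: \<open>T n\<close> are the indices outside the fold, \<alpha> is
  the projected representer \<open>\<alpha>bar\<close>. The projection still satisfies
  \<open>m_riesz\<close> because the dictionary lies in \<Gamma>. The minimization property is
  assumed with probability approaching one, in the form of \<open>whp\<close>.\<close>

locale riesz_lasso = iid_sample M F W
  for M :: "'a measure" and F :: "'w measure" and W :: "nat \<Rightarrow> 'a \<Rightarrow> 'w" +
  fixes X :: "'w \<Rightarrow> 'x::euclidean_space" and m :: "'w \<Rightarrow> ('x \<Rightarrow> real) \<Rightarrow> real" and \<alpha> :: "'x \<Rightarrow> real"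
    and b :: "nat \<Rightarrow> 'x \<Rightarrow> real" and p :: "nat \<Rightarrow> nat" and r :: "nat \<Rightarrow> real" and T :: "nat \<Rightarrow> nat set"
    and \<rho>h :: "nat \<Rightarrow> 'a \<Rightarrow> real Matrix.vec" and Cb Cm C\<alpha> \<Lambda> cT :: real
  assumes meas_X [measurable]: "X \<in> measurable F borel"
    and meas_b [measurable]: "\<And>j. b j \<in> borel_measurable borel"
    and meas_\<alpha> [measurable]: "\<alpha> \<in> borel_measurable borel"
    and b_bound: "AE w in F. \<forall>j. \<bar>b j (X w)\<bar> \<le> Cb" "Cb > 0"
    and \<alpha>_bound: "AE w in F. \<bar>\<alpha> (X w)\<bar> \<le> C\<alpha>" "C\<alpha> > 0"
    and m_meas: "\<And>j. (\<lambda>w. m w (b j)) \<in> borel_measurable F"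
    and m_bound: "\<And>n. n > 0 \<Longrightarrow> AE w in F. \<forall>j<p n. \<bar>m w (b j)\<bar> \<le> Cm" "Cm > 0"
    and m_riesz: "\<And>j. (\<integral>w. m w (b j) \<partial>F) = (\<integral>w. \<alpha> (X w) * b j (X w) \<partial>F)"
    and p_ge: "\<And>n. n > 0 \<Longrightarrow> p n \<ge> 2"
    and r_pos: "\<And>n. n > 0 \<Longrightarrow> r n > 0"
    and eps_o: "eps p \<in> o(r)"
    and eig: "\<And>n k. n > 0 \<Longrightarrow> eigenvalue (pop_gram F X b (p n)) k \<Longrightarrow> k \<le> \<Lambda>" "\<Lambda> \<ge> 0"
    and T: "\<And>n. finite (T n)" "\<forall>\<^sub>F n in sequentially. cT * real n \<le> card (T n)" "cT > 0"
    and opt: "whp M (\<lambda>n \<omega>. is_arg_min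
        (lasso_objective (emp_moment m b (p n) (T n) (\<lambda>i. W i \<omega>)) (emp_gram X b (p n) (T n) (\<lambda>i. W i \<omega>)) (r n))
         (\<lambda>\<rho>. \<rho> \<in> carrier_vec (p n)) (\<rho>h n \<omega>))"
begin

sublocale F: prob_space F
  by (rule prob_space_F)

abbreviation fit :: "nat \<Rightarrow> (nat \<Rightarrow> real) \<Rightarrow> 'w \<Rightarrow> real" where
  "fit n v w \<equiv> dict_comb b (p n) v (X w)"

abbreviation fit_err :: "nat \<Rightarrow> (nat \<Rightarrow> real) \<Rightarrow> real" where
  "fit_err n v \<equiv> \<integral>w. (\<alpha> (X w) - fit n v w)\<^sup>2 \<partial>F"

lemma meas_dict [measurable]: "(\<lambda>w. dict_comb b q v (X w)) \<in> borel_measurable F"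
  unfolding dict_comb_def by measurable

lemma dict_bound: "AE w in F. \<bar>dict_comb b q v (X w)\<bar> \<le> (\<Sum>j<q. \<bar>v j\<bar>) * Cb"
  by (rule AE_dict_comb_bound) (rule b_bound(1))

lemma integrable_bounded:
  fixes f :: "'w \<Rightarrow> real"
  assumes "f \<in> borel_measurable F" "AE w in F. \<bar>f w\<bar> \<le> C"
  shows "integrable F f"
  using assms by (intro F.integrable_const_bound[of _ C]) auto

lemma integrable_bounded_square:
  fixes f :: "'w \<Rightarrow> real"
  assumes [measurable]: "f \<in> borel_measurable F" and "AE w in F. \<bar>f w\<bar> \<le> C"
  shows "integrable F (\<lambda>w. (f w)\<^sup>2)"
proof (rule integrable_bounded)
  show "AE w in F. \<bar>(f w)\<^sup>2\<bar> \<le> C\<^sup>2"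
    using assms(2) by eventually_elim (metis abs_ge_zero power2_abs power_abs power_mono)
qed measurable

lemma dict_sq_integrable: "integrable F (\<lambda>w. (dict_comb b q v (X w))\<^sup>2)"
  by (rule integrable_bounded_square[OF _ dict_bound]) measurable

lemma err_bound: "AE w in F. \<bar>\<alpha> (X w) - dict_comb b q v (X w)\<bar> \<le> C\<alpha> + (\<Sum>j<q. \<bar>v j\<bar>) * Cb"
  using \<alpha>_bound(1) dict_bound[of q v] by eventually_elim linarith

lemma err_sq_integrable: "integrable F (\<lambda>w. (\<alpha> (X w) - dict_comb b q v (X w))\<^sup>2)"
  by (rule integrable_bounded_square[OF _ err_bound]) measurable

lemma bb_bound: "AE w in F. \<bar>b j (X w) * b k (X w)\<bar> \<le> Cb * Cb"
  using b_bound(1)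
proof eventually_elim
  case (elim w)
  then show ?case
    unfolding abs_mult using b_bound(2) by (intro mult_mono) auto
qed

lemma \<alpha>b_bound: "AE w in F. \<bar>\<alpha> (X w) * b k (X w)\<bar> \<le> C\<alpha> * Cb"
  using b_bound(1) \<alpha>_bound(1)
proof eventually_elim
  case (elim w)
  then show ?case
    unfolding abs_mult using \<alpha>_bound(2) by (intro mult_mono) auto
qed

lemma bform_pop_gram:
  "bform q (\<lambda>j k. \<integral>w. b j (X w) * b k (X w) \<partial>F) v v = (\<integral>w. (dict_comb b q v (X w))\<^sup>2 \<partial>F)"
proof -
  have int: "integrable F (\<lambda>w. v j * b j (X w) * (v k * b k (X w)))" for j k
  proof -
    have "integrable F (\<lambda>w. (v j * v k) * (b j (X w) * b k (X w)))"
      by (intro integrable_mult_right integrable_bounded[OF _ bb_bound]) measurable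
    then show ?thesis
      by (simp add: mult_ac)
  qed
  have "(\<integral>w. (dict_comb b q v (X w))\<^sup>2 \<partial>F) = (\<Sum>j<q. \<Sum>k<q. \<integral>w. v j * b j (X w) * (v k * b k (X w)) \<partial>F)"
    unfolding dict_comb_def power2_eq_square sum_product
    using int by (simp add: Bochner_Integration.integral_sum)
  also have "\<dots> = (\<Sum>j<q. \<Sum>k<q. v j * ((\<integral>w. b j (X w) * b k (X w) \<partial>F) * v k))"
  proof (intro sum.cong refl)
    fix j k
    have "(\<integral>w. v j * b j (X w) * (v k * b k (X w)) \<partial>F) = (\<integral>w. (v j * v k) * (b j (X w) * b k (X w)) \<partial>F)"
      by (simp add: mult_ac)
    then show "(\<integral>w. v j * b j (X w) * (v k * b k (X w)) \<partial>F) = v j * ((\<integral>w. b j (X w) * b k (X w) \<partial>F) * v k)"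
      by (simp add: mult_ac)
  qed
  finally show ?thesis
    by (simp add: bform_def matvec_def sum_distrib_left)
qed

lemma pop_norm_le: "n > 0 \<Longrightarrow> (\<integral>w. (fit n v w)\<^sup>2 \<partial>F) \<le> \<Lambda> * (\<Sum>j<p n. (v j)\<^sup>2)"
  unfolding bform_pop_gram[symmetric]
  by (rule quadratic_form_le_max_eigenvalue) (auto simp: mult.commute pop_gram_def[symmetric] intro: eig)

lemma fit_err_split: "fit_err n u \<le> 2 * fit_err n v + 2 * (\<integral>w. (fit n (\<lambda>j. u j - v j) w)\<^sup>2 \<partial>F)"
proof -
  have "fit_err n u \<le> (\<integral>w. 2 * (\<alpha> (X w) - fit n v w)\<^sup>2 + 2 * (fit n (\<lambda>j. u j - v j) w)\<^sup>2 \<partial>F)"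
  proof (intro integral_mono Bochner_Integration.integrable_add integrable_mult_right
      err_sq_integrable dict_sq_integrable)
    fix w
    show "(\<alpha> (X w) - fit n u w)\<^sup>2 \<le> 2 * (\<alpha> (X w) - fit n v w)\<^sup>2 + 2 * (fit n (\<lambda>j. u j - v j) w)\<^sup>2"
      unfolding dict_comb_diff
      using zero_le_power2[of "(\<alpha> (X w) - fit n v w) + (fit n u w - fit n v w)"]
      by (simp add: power2_eq_square algebra_simps)
  qed
  also have "\<dots> = 2 * fit_err n v + 2 * (\<integral>w. (fit n (\<lambda>j. u j - v j) w)\<^sup>2 \<partial>F)"
    by (simp add: err_sq_integrable dict_sq_integrable)
  finally show ?thesis .
qed

text \<open>Both empirical means concentrate around the same expectation, by \<open>m_riesz\<close>,
  each within r/8. The total r/4 is small enough for the penalty to dominate the noise.\<close>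

lemma whp_score:
  "whp M (\<lambda>n \<omega>. \<forall>j<p n. \<bar>emp_mean (T n) (\<lambda>i. m (W i \<omega>) (b j))
      - emp_mean (T n) (\<lambda>i. \<alpha> (X (W i \<omega>)) * b j (X (W i \<omega>)))\<bar> \<le> r n / 4)"
proof -
  have card: "card {..<p n} \<le> (p n)\<^sup>2" for n
    by (simp add: power2_eq_square)
  have m_b: "AE w in F. \<bar>m w (b j)\<bar> \<le> Cm" if "n > 0" "j < p n" for n j
    using m_bound(1)[OF that(1)] that(2) by (auto elim!: eventually_mono)
  have "whp M (\<lambda>n \<omega>. \<forall>j\<in>{..<p n}. \<bar>(\<Sum>i\<in>T n. m (W i \<omega>) (b j)) / card (T n) - (\<integral>w. m w (b j) \<partial>F)\<bar> \<le> 1 / 8 * r n)"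
    by (rule whp_uniform_mean[where J = "\<lambda>n. {..<p n}" and f = "\<lambda>_ j w. m w (b j)", OF _ _ m_bound(2) _ card p_ge T eps_o r_pos])
       (use m_b in \<open>auto simp: m_meas\<close>)
  moreover have "whp M (\<lambda>n \<omega>. \<forall>j\<in>{..<p n}. \<bar>(\<Sum>i\<in>T n. \<alpha> (X (W i \<omega>)) * b j (X (W i \<omega>))) / card (T n)
      - (\<integral>w. \<alpha> (X w) * b j (X w) \<partial>F)\<bar> \<le> 1 / 8 * r n)"
    by (rule whp_uniform_mean[where J = "\<lambda>n. {..<p n}" and f = "\<lambda>_ j w. \<alpha> (X w) * b j (X w)" and C = "C\<alpha> * Cb",
          OF _ _ _ _ card p_ge T eps_o r_pos])
       (use \<alpha>b_bound \<alpha>_bound(2) b_bound(2) in auto)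
  ultimately have "whp M (\<lambda>n \<omega>.
      (\<forall>j\<in>{..<p n}. \<bar>(\<Sum>i\<in>T n. m (W i \<omega>) (b j)) / card (T n) - (\<integral>w. m w (b j) \<partial>F)\<bar> \<le> 1 / 8 * r n) \<and>
      (\<forall>j\<in>{..<p n}. \<bar>(\<Sum>i\<in>T n. \<alpha> (X (W i \<omega>)) * b j (X (W i \<omega>))) / card (T n)
      - (\<integral>w. \<alpha> (X w) * b j (X w) \<partial>F)\<bar> \<le> 1 / 8 * r n))"
    by (rule whp_conj)
  then show ?thesis
  proof (rule whp_mono', intro allI impI)
    fix n \<omega> j
    assume *: "(\<forall>j\<in>{..<p n}. \<bar>(\<Sum>i\<in>T n. m (W i \<omega>) (b j)) / card (T n) - (\<integral>w. m w (b j) \<partial>F)\<bar> \<le> 1 / 8 * r n) \<and>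
      (\<forall>j\<in>{..<p n}. \<bar>(\<Sum>i\<in>T n. \<alpha> (X (W i \<omega>)) * b j (X (W i \<omega>))) / card (T n)
      - (\<integral>w. \<alpha> (X w) * b j (X w) \<partial>F)\<bar> \<le> 1 / 8 * r n)" and "j < p n"
    then have "\<bar>(\<Sum>i\<in>T n. m (W i \<omega>) (b j)) / card (T n) - (\<integral>w. m w (b j) \<partial>F)\<bar> \<le> 1 / 8 * r n"
      "\<bar>(\<Sum>i\<in>T n. \<alpha> (X (W i \<omega>)) * b j (X (W i \<omega>))) / card (T n) - (\<integral>w. m w (b j) \<partial>F)\<bar> \<le> 1 / 8 * r n"
      by (auto simp: m_riesz)
    then show "\<bar>emp_mean (T n) (\<lambda>i. m (W i \<omega>) (b j))
      - emp_mean (T n) (\<lambda>i. \<alpha> (X (W i \<omega>)) * b j (X (W i \<omega>)))\<bar> \<le> r n / 4"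
      unfolding emp_mean_def by linarith
  qed
qed

text \<open>Entrywise concentration, uniform over the p^2 pairs of dictionary functions.\<close>

lemma whp_gram:
  "whp M (\<lambda>n \<omega>. \<forall>j<p n. \<forall>k<p n. \<bar>emp_mean (T n) (\<lambda>i. b j (X (W i \<omega>)) * b k (X (W i \<omega>)))
      - (\<integral>w. b j (X w) * b k (X w) \<partial>F)\<bar> \<le> r n)"
proof -
  have "whp M (\<lambda>n \<omega>. \<forall>jk\<in>{..<p n} \<times> {..<p n}. \<bar>(\<Sum>i\<in>T n. b (fst jk) (X (W i \<omega>)) * b (snd jk) (X (W i \<omega>))) / card (T n)
      - (\<integral>w. b (fst jk) (X w) * b (snd jk) (X w) \<partial>F)\<bar> \<le> 1 * r n)"
    by (rule whp_uniform_mean[where J = "\<lambda>n. {..<p n} \<times> {..<p n}"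
          and f = "\<lambda>_ jk w. b (fst jk) (X w) * b (snd jk) (X w)" and C = "Cb * Cb",
          OF _ _ _ _ _ p_ge T eps_o r_pos])
       (use bb_bound b_bound(2) in \<open>auto simp: power2_eq_square\<close>)
  then show ?thesis
    by (rule whp_mono') (auto simp: emp_mean_def)
qed

text \<open>Markov's inequality, because the coefficients \<open>v n\<close> are unbounded. It asks
  for a threshold \<open>t\<close> of larger order than the population error \<beta>.\<close>

lemma whp_in_sample_error:
  fixes v :: "nat \<Rightarrow> nat \<Rightarrow> real"
  assumes "\<forall>\<^sub>F n in sequentially. fit_err n (v n) \<le> \<beta> n" "\<forall>\<^sub>F n in sequentially. t n > 0"
    and "(\<lambda>n. \<beta> n / t n) \<longlonglongrightarrow> 0"
  shows "whp M (\<lambda>n \<omega>. emp_mean (T n) (\<lambda>i. (\<alpha> (X (W i \<omega>)) - fit n (v n) (W i \<omega>))\<^sup>2) \<le> t n)"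
proof (rule whpI_bound[OF _ assms(3)])
  show "\<forall>\<^sub>F n in sequentially.
     {\<omega> \<in> space M. \<not> emp_mean (T n) (\<lambda>i. (\<alpha> (X (W i \<omega>)) - fit n (v n) (W i \<omega>))\<^sup>2) \<le> t n} \<in> events \<and>
     prob {\<omega> \<in> space M. \<not> emp_mean (T n) (\<lambda>i. (\<alpha> (X (W i \<omega>)) - fit n (v n) (W i \<omega>))\<^sup>2) \<le> t n} \<le> \<beta> n / t n"
    using assms(1,2) T(2) eventually_gt_at_top[of 0]
  proof eventually_elim
    case (elim n)
    let ?f = "\<lambda>w. (\<alpha> (X w) - fit n (v n) w)\<^sup>2"
    have "0 < cT * real n"
      using T(3) elim(4) by simp
    then have c: "0 < real (card (T n))"
      using elim(3) by linarith
    have "prob {\<omega> \<in> space M. (\<Sum>i\<in>T n. ?f (W i \<omega>)) > card (T n) * t n} \<le> card (T n) * (\<integral>w. ?f w \<partial>F) / (card (T n) * t n)"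
      using c elim(2) by (intro Markov_sum err_sq_integrable T) auto
    also have "\<dots> \<le> \<beta> n / t n"
      using c elim(1,2) by (simp add: divide_right_mono)
    finally have *: "prob {\<omega> \<in> space M. (\<Sum>i\<in>T n. ?f (W i \<omega>)) > card (T n) * t n} \<le> \<beta> n / t n" .
    have "{\<omega> \<in> space M. \<not> emp_mean (T n) (\<lambda>i. ?f (W i \<omega>)) \<le> t n}
        = {\<omega> \<in> space M. (\<Sum>i\<in>T n. ?f (W i \<omega>)) > card (T n) * t n}"
      using c by (auto simp: emp_mean_def field_simps not_le)
    moreover have "{\<omega> \<in> space M. (\<Sum>i\<in>T n. ?f (W i \<omega>)) > card (T n) * t n} \<in> events"
      by measurable
    ultimately show ?case
      using * by simp
  qed
qed

lemma whp_basic_inequality: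
  fixes v :: "nat \<Rightarrow> nat \<Rightarrow> real"
  shows "whp M (\<lambda>n \<omega>. \<rho>h n \<omega> \<in> carrier_vec (p n) \<and>
    emp_mean (T n) (\<lambda>i. (dict_comb (\<lambda>j i. b j (X (W i \<omega>))) (p n) (\<lambda>j. \<rho>h n \<omega> $ j - v n j) i)\<^sup>2) / 2
    \<le> 2 * emp_mean (T n) (\<lambda>i. (\<alpha> (X (W i \<omega>)) - fit n (v n) (W i \<omega>))\<^sup>2)
      + 2 * (r n / 4) * (\<Sum>j<p n. \<bar>\<rho>h n \<omega> $ j - v n j\<bar>)
      + 2 * r n * ((\<Sum>j<p n. \<bar>v n j\<bar>) - (\<Sum>j<p n. \<bar>\<rho>h n \<omega> $ j\<bar>)))"
  using whp_conj[OF opt whp_score]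
proof (rule whp_mono', intro conjI)
  fix n \<omega>
  let ?obj = "lasso_objective (emp_moment m b (p n) (T n) (\<lambda>i. W i \<omega>)) (emp_gram X b (p n) (T n) (\<lambda>i. W i \<omega>)) (r n)"
  assume *: "is_arg_min ?obj (\<lambda>\<rho>. \<rho> \<in> carrier_vec (p n)) (\<rho>h n \<omega>) \<and>
    (\<forall>j<p n. \<bar>emp_mean (T n) (\<lambda>i. m (W i \<omega>) (b j))
      - emp_mean (T n) (\<lambda>i. \<alpha> (X (W i \<omega>)) * b j (X (W i \<omega>)))\<bar> \<le> r n / 4)"
  then show \<rho>: "\<rho>h n \<omega> \<in> carrier_vec (p n)"
    by (simp add: is_arg_min_def)
  let ?v = "Matrix.vec (p n) (v n)"
  have "?obj (\<rho>h n \<omega>) \<le> ?obj ?v"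
    using * by (auto simp: is_arg_min_linorder)
  then have "- 2 * (\<Sum>j<p n. emp_mean (T n) (\<lambda>i. m (W i \<omega>) (b j)) * \<rho>h n \<omega> $ j)
      + emp_mean (T n) (\<lambda>i. (dict_comb (\<lambda>j i. b j (X (W i \<omega>))) (p n) (($) (\<rho>h n \<omega>)) i)\<^sup>2)
      + 2 * r n * (\<Sum>j<p n. \<bar>\<rho>h n \<omega> $ j\<bar>)
    \<le> - 2 * (\<Sum>j<p n. emp_mean (T n) (\<lambda>i. m (W i \<omega>) (b j)) * v n j)
      + emp_mean (T n) (\<lambda>i. (dict_comb (\<lambda>j i. b j (X (W i \<omega>))) (p n) (v n) i)\<^sup>2)
      + 2 * r n * (\<Sum>j<p n. \<bar>v n j\<bar>)"
    by (simp add: lasso_objective_emp[OF \<rho>] lasso_objective_emp[of ?v] dict_comb_def)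
  from lasso_basic_inequality[OF this, of "\<lambda>i. \<alpha> (X (W i \<omega>))" "r n / 4"] *
  show "emp_mean (T n) (\<lambda>i. (dict_comb (\<lambda>j i. b j (X (W i \<omega>))) (p n) (\<lambda>j. \<rho>h n \<omega> $ j - v n j) i)\<^sup>2) / 2
    \<le> 2 * emp_mean (T n) (\<lambda>i. (\<alpha> (X (W i \<omega>)) - fit n (v n) (W i \<omega>))\<^sup>2)
      + 2 * (r n / 4) * (\<Sum>j<p n. \<bar>\<rho>h n \<omega> $ j - v n j\<bar>)
      + 2 * r n * ((\<Sum>j<p n. \<bar>v n j\<bar>) - (\<Sum>j<p n. \<bar>\<rho>h n \<omega> $ j\<bar>))"
    by (simp add: dict_comb_def)
qed

end

section \<open>The two convergence rates\<close>

context riesz_lasso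
begin

lemma eps_over_r: "(\<lambda>n. eps p n / r n) \<longlonglongrightarrow> 0"
  by (rule smalloD_tendsto[OF eps_o])

lemma eps_pos: "n > 0 \<Longrightarrow> eps p n > 0"
  using p_ge[of n] by (simp add: eps_def)

text \<open>This is where the largest eigenvalue of \<open>G\<close> is needed for dictionaries of every size: the
  truncated tail involves arbitrarily many functions.\<close>

lemma tail_error:
  assumes sums: "AE w in F. (\<lambda>j. \<rho>0 j * b j (X w)) sums \<alpha> (X w)"
    and summable: "summable (\<lambda>j. \<bar>\<rho>0 j\<bar>)"
    and J: "J \<subseteq> {..<p n}" "card J > 0" "\<And>j k. j \<in> J \<Longrightarrow> k \<notin> J \<Longrightarrow> \<bar>\<rho>0 k\<bar> \<le> \<bar>\<rho>0 j\<bar>"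
    and p_large: "\<And>k. \<exists>n'>0. k \<le> p n'"
  shows "fit_err n (\<lambda>j. if j \<in> J then \<rho>0 j else 0) \<le> \<Lambda> * (\<Sum>j. \<bar>\<rho>0 j\<bar>)\<^sup>2 / card J"
proof -
  define A where "A = (\<Sum>j. \<bar>\<rho>0 j\<bar>)"
  define \<tau> where "\<tau> j = (if j \<in> J then 0 else \<rho>0 j)" for j
  have fin: "finite J"
    using J(2) card_gt_0_iff by blast
  have sum_le: "(\<Sum>j\<in>K. \<bar>\<rho>0 j\<bar>) \<le> A" if "finite K" for K
    unfolding A_def using that summable by (intro sum_le_suminf) auto
  have A: "A \<ge> 0"
    using sum_le[of "{}"] by simp
  \<comment> \<open>An omitted coefficient is at most each of the \<open>card J\<close> kept ones,
    whose sum is at most \<open>A\<close>.\<close>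
  have \<tau>_small: "\<bar>\<tau> j\<bar> \<le> A / card J" for j
  proof (cases "j \<in> J")
    case False
    then have "(\<Sum>i\<in>J. \<bar>\<rho>0 j\<bar>) \<le> (\<Sum>i\<in>J. \<bar>\<rho>0 i\<bar>)"
      using J(3) by (intro sum_mono) auto
    also have "\<dots> \<le> A"
      by (rule sum_le[OF fin])
    finally show ?thesis
      using J(2) False by (simp add: \<tau>_def field_simps)
  qed (use A in \<open>simp add: \<tau>_def\<close>)
  have \<tau>_sq: "(\<Sum>j<k. (\<tau> j)\<^sup>2) \<le> A\<^sup>2 / card J" for k
  proof -
    have "(\<Sum>j<k. (\<tau> j)\<^sup>2) \<le> (\<Sum>j<k. A / card J * \<bar>\<rho>0 j\<bar>)"
    proof (intro sum_mono)
      fix j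
      have "\<bar>\<tau> j\<bar> * \<bar>\<tau> j\<bar> \<le> A / card J * \<bar>\<rho>0 j\<bar>"
        using \<tau>_small[of j] A by (intro mult_mono) (auto simp: \<tau>_def)
      then show "(\<tau> j)\<^sup>2 \<le> A / card J * \<bar>\<rho>0 j\<bar>"
        by (simp add: power2_eq_square)
    qed
    also have "\<dots> \<le> A / card J * A"
      unfolding sum_distrib_left[symmetric] using A by (intro mult_left_mono sum_le) auto
    finally show ?thesis
      by (simp add: power2_eq_square)
  qed
  \<comment> \<open>The first \<open>k\<close> tail terms are padded by zeros to a dictionary of
    size \<open>p n'\<close>, for which the eigenvalue bound is available.\<close>
  have norm_le: "(\<integral>w. (dict_comb b k \<tau> (X w))\<^sup>2 \<partial>F) \<le> \<Lambda> * (A\<^sup>2 / card J)" for k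
  proof -
    obtain n' where n': "n' > 0" "k \<le> p n'"
      using p_large by blast
    define \<sigma> where "\<sigma> j = (if j < k then \<tau> j else 0)" for j
    have "dict_comb b (p n') \<sigma> x = dict_comb b k \<tau> x" for x
      unfolding dict_comb_def using n'(2)
      by (intro sum.mono_neutral_cong_right) (auto simp: \<sigma>_def)
    then have "(\<integral>w. (dict_comb b k \<tau> (X w))\<^sup>2 \<partial>F) = (\<integral>w. (fit n' \<sigma> w)\<^sup>2 \<partial>F)"
      by simp
    also have "\<dots> \<le> \<Lambda> * (\<Sum>j<p n'. (\<sigma> j)\<^sup>2)"
      by (rule pop_norm_le[OF n'(1)])
    also have "(\<Sum>j<p n'. (\<sigma> j)\<^sup>2) = (\<Sum>j<k. (\<tau> j)\<^sup>2)"
      using n'(2) by (intro sum.mono_neutral_cong_right) (auto simp: \<sigma>_def)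
    also have "\<Lambda> * (\<Sum>j<k. (\<tau> j)\<^sup>2) \<le> \<Lambda> * (A\<^sup>2 / card J)"
      using \<tau>_sq eig(2) by (intro mult_left_mono)
    finally show ?thesis .
  qed
  \<comment> \<open>The partial sums of the tail converge to the approximation error and are
    dominated by \<open>A * Cb\<close>, so the bound on finite tails survives the limit.\<close>
  have "(\<lambda>k. \<integral>w. (dict_comb b k \<tau> (X w))\<^sup>2 \<partial>F) \<longlonglongrightarrow> fit_err n (\<lambda>j. if j \<in> J then \<rho>0 j else 0)"
  proof (rule integral_dominated_convergence[where w = "\<lambda>_. (A * Cb)\<^sup>2"])
    show "AE w in F. (\<lambda>k. (dict_comb b k \<tau> (X w))\<^sup>2)
        \<longlonglongrightarrow> (\<alpha> (X w) - fit n (\<lambda>j. if j \<in> J then \<rho>0 j else 0) w)\<^sup>2"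
      using sums
    proof eventually_elim
      case (elim w)
      have "\<forall>\<^sub>F k in sequentially. (\<Sum>j<k. \<rho>0 j * b j (X w)) - fit n (\<lambda>j. if j \<in> J then \<rho>0 j else 0) w
          = dict_comb b k \<tau> (X w)"
        using eventually_ge_at_top[of "p n"]
      proof eventually_elim
        case (elim k)
        have "fit n (\<lambda>j. if j \<in> J then \<rho>0 j else 0) w = dict_comb b k (\<lambda>j. if j \<in> J then \<rho>0 j else 0) (X w)"
          unfolding dict_comb_def using elim J(1) by (intro sum.mono_neutral_cong_left) auto
        then show ?case
          unfolding dict_comb_def by (auto simp: \<tau>_def sum_subtractf[symmetric] intro!: sum.cong)
      qed
      then have "(\<lambda>k. dict_comb b k \<tau> (X w)) \<longlonglongrightarrow> \<alpha> (X w) - fit n (\<lambda>j. if j \<in> J then \<rho>0 j else 0) w"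
        using tendsto_diff[OF elim[unfolded sums_def] tendsto_const] by (rule Lim_transform_eventually[rotated])
      then show ?case
        by (intro tendsto_power)
    qed
    show "AE w in F. norm ((dict_comb b k \<tau> (X w))\<^sup>2) \<le> (A * Cb)\<^sup>2" for k
      using dict_bound[of k \<tau>]
    proof eventually_elim
      case (elim w)
      have "(\<Sum>j<k. \<bar>\<tau> j\<bar>) \<le> (\<Sum>j<k. \<bar>\<rho>0 j\<bar>)"
        by (intro sum_mono) (auto simp: \<tau>_def)
      also have "\<dots> \<le> A"
        by (rule sum_le) simp
      finally have "(\<Sum>j<k. \<bar>\<tau> j\<bar>) * Cb \<le> A * Cb"
        using b_bound(2) by (intro mult_right_mono) auto
      with elim have "\<bar>dict_comb b k \<tau> (X w)\<bar> \<le> A * Cb"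
        by linarith
      from power_mono[OF this abs_ge_zero, of 2] show ?case
        by simp
    qed
  qed auto
  then show ?thesis
    unfolding A_def[symmetric] using norm_le by (intro LIMSEQ_le_const2) auto
qed

text \<open>Keeping the largest coefficients, about C sqrt n of them, leaves a squared error of
  order 1/sqrt n, hence o(r). The basic inequality then bounds both the l1 norm of the estimate and
  its in-sample distance to the approximant; the entrywise Gram bound turns the latter into a
  population distance at cost r times a bounded squared l1 norm.\<close>

theorem whp_slow_rate:
  assumes S: "abs_summable_representation F X b p \<alpha>"
  shows "\<exists>K>0. whp M (\<lambda>n \<omega>. (\<Sum>j<p n. \<bar>\<rho>h n \<omega> $ j\<bar>) \<le> K \<and> fit_err n (($) (\<rho>h n \<omega>)) \<le> K * r n)"
proof -
  obtain \<rho>0 C where sums: "AE w in F. (\<lambda>j. \<rho>0 j * b j (X w)) sums \<alpha> (X w)"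
    and summable: "summable (\<lambda>j. \<bar>\<rho>0 j\<bar>)" and C: "C > 0"
    and top: "\<forall>n>0. \<exists>J \<subseteq> {..<p n}. card J = nat \<lfloor>C * sqrt (real n)\<rfloor> \<and>
           (\<forall>j\<in>J. \<forall>k. k \<notin> J \<longrightarrow> \<bar>\<rho>0 k\<bar> \<le> \<bar>\<rho>0 j\<bar>)"
    using S unfolding abs_summable_representation_def by blast
  from top have "\<forall>n. \<exists>J. n > 0 \<longrightarrow> J \<subseteq> {..<p n} \<and> card J = nat \<lfloor>C * sqrt (real n)\<rfloor> \<and>
           (\<forall>j\<in>J. \<forall>k. k \<notin> J \<longrightarrow> \<bar>\<rho>0 k\<bar> \<le> \<bar>\<rho>0 j\<bar>)"
    by meson
  from choice[OF this] obtain J where "\<forall>n. n > 0 \<longrightarrow> J n \<subseteq> {..<p n} \<and> card (J n) = nat \<lfloor>C * sqrt (real n)\<rfloor> \<and>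
           (\<forall>j\<in>J n. \<forall>k. k \<notin> J n \<longrightarrow> \<bar>\<rho>0 k\<bar> \<le> \<bar>\<rho>0 j\<bar>)" ..
  then have J: "\<And>n. n > 0 \<Longrightarrow> J n \<subseteq> {..<p n}" "\<And>n. n > 0 \<Longrightarrow> card (J n) = nat \<lfloor>C * sqrt (real n)\<rfloor>"
      "\<And>n j k. n > 0 \<Longrightarrow> j \<in> J n \<Longrightarrow> k \<notin> J n \<Longrightarrow> \<bar>\<rho>0 k\<bar> \<le> \<bar>\<rho>0 j\<bar>"
    by simp_all
  define A where "A = (\<Sum>j. \<bar>\<rho>0 j\<bar>)"
  have sum_le: "(\<Sum>j\<in>K. \<bar>\<rho>0 j\<bar>) \<le> A" if "finite K" for K
    unfolding A_def using that summable by (intro sum_le_suminf) auto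
  have A: "A \<ge> 0"
    using sum_le[of "{}"] by simp
  define v where "v n j = (if j \<in> J n then \<rho>0 j else 0)" for n j
  define \<beta> where "\<beta> n = 2 * \<Lambda> * A\<^sup>2 / C * (1 / sqrt (real n))" for n :: nat
  have sqrt_top: "filterlim (\<lambda>n. C * sqrt (real n)) at_top sequentially"
    using C by (intro filterlim_tendsto_pos_mult_at_top[OF tendsto_const]
        filterlim_compose[OF sqrt_at_top] filterlim_real_sequentially) auto
  have card_large: "C * sqrt (real n) \<ge> 2 \<Longrightarrow> n > 0 \<Longrightarrow> real (card (J n)) \<ge> C * sqrt (real n) / 2" for n
    unfolding J(2) by linarith
  \<comment> \<open>The kept indices lie below \<open>p n\<close> and their number grows without
    bound, so dictionaries of every size occur, as the tail bound requires.\<close>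
  have p_large: "\<exists>n'>0. k \<le> p n'" for k
  proof -
    have "\<forall>\<^sub>F n in sequentially. C * sqrt (real n) \<ge> max 2 (2 * real k)"
      using sqrt_top unfolding filterlim_at_top by blast
    then have "\<forall>\<^sub>F n in sequentially. C * sqrt (real n) \<ge> max 2 (2 * real k) \<and> n > 0"
      using eventually_gt_at_top[of 0] by eventually_elim simp
    then obtain n where n: "C * sqrt (real n) \<ge> max 2 (2 * real k)" "n > 0"
      by (auto dest: eventually_happens'[OF sequentially_bot])
    then have "real k \<le> card (J n)"
      using card_large[of n] by auto
    also have "card (J n) \<le> p n"
      using card_mono[OF _ J(1)[OF n(2)]] by simp
    finally show ?thesis
      using n(2) by auto
  qed
  have err: "\<forall>\<^sub>F n in sequentially. fit_err n (v n) \<le> \<beta> n"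
  proof -
    have "\<forall>\<^sub>F n in sequentially. C * sqrt (real n) \<ge> 2"
      using sqrt_top by (simp add: filterlim_at_top)
    then show ?thesis
      using eventually_gt_at_top[of 0]
    proof eventually_elim
      case (elim n)
      have c: "real (card (J n)) \<ge> C * sqrt (real n) / 2"
        using elim by (rule card_large)
      moreover have half: "C * sqrt (real n) / 2 > 0"
        using C elim by simp
      ultimately have "card (J n) > 0"
        by linarith
      then have "fit_err n (v n) \<le> \<Lambda> * A\<^sup>2 / card (J n)"
        unfolding v_def A_def using elim(2) J p_large
        by (intro tail_error[OF sums summable]) auto
      also have "\<dots> \<le> \<Lambda> * A\<^sup>2 / (C * sqrt (real n) / 2)"
        using c half eig(2) by (intro divide_left_mono mult_pos_pos) auto
      also have "\<dots> = \<beta> n"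
        by (simp add: \<beta>_def)
      finally show ?case .
    qed
  qed
  \<comment> \<open>As p is at least 2, 1/sqrt n is at most eps divided by sqrt(ln 2).\<close>
  have \<beta>r: "(\<lambda>n. \<beta> n / r n) \<longlonglongrightarrow> 0"
  proof (rule tendsto_sandwich[OF _ _ tendsto_const])
    show "(\<lambda>n. 2 * \<Lambda> * A\<^sup>2 / C / sqrt (ln 2) * (eps p n / r n)) \<longlonglongrightarrow> 0"
      by (rule tendsto_mult_right_zero[OF eps_over_r])
    show "\<forall>\<^sub>F n in sequentially. \<beta> n / r n \<le> 2 * \<Lambda> * A\<^sup>2 / C / sqrt (ln 2) * (eps p n / r n)"
      using eventually_gt_at_top[of 0]
    proof eventually_elim
      case (elim n)
      have "sqrt (ln 2) \<le> sqrt (ln (p n))"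
        using p_ge[OF elim] by simp
      then have "sqrt (ln 2) * (1 / sqrt (real n)) \<le> eps p n"
        using elim by (simp add: eps_def real_sqrt_divide divide_right_mono)
      then have "1 / sqrt (real n) \<le> eps p n / sqrt (ln 2)"
        by (simp add: field_simps)
      then have "2 * \<Lambda> * A\<^sup>2 / C * (1 / sqrt (real n)) \<le> 2 * \<Lambda> * A\<^sup>2 / C * (eps p n / sqrt (ln 2))"
        using C eig(2) by (intro mult_left_mono) auto
      then have "\<beta> n / r n \<le> 2 * \<Lambda> * A\<^sup>2 / C * (eps p n / sqrt (ln 2)) / r n"
        unfolding \<beta>_def using r_pos[OF elim] by (intro divide_right_mono) auto
      then show ?case
        by simp
    qed
    show "\<forall>\<^sub>F n in sequentially. 0 \<le> \<beta> n / r n"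
      using eventually_gt_at_top[of 0]
    proof eventually_elim
      case (elim n)
      then show ?case
        using C eig(2) r_pos[OF elim] by (simp add: \<beta>_def)
    qed
  qed
  have r_ev: "\<forall>\<^sub>F n in sequentially. r n > 0"
    using eventually_gt_at_top[of 0] by eventually_elim (rule r_pos)
  have "\<forall>\<^sub>F n in sequentially. \<beta> n / r n < 1"
    using \<beta>r by (rule order_tendstoD(2)) simp
  then have err_r: "\<forall>\<^sub>F n in sequentially. fit_err n (v n) \<le> r n"
    using err r_ev
  proof eventually_elim
    case (elim n)
    then show ?case
      by (simp add: pos_divide_less_eq)
  qed
  \<comment> \<open>The bound 2 + 2A on the l1 norm plus the constant of the rate, in which 2 + 3A
    bounds the l1 distance between estimate and approximant.\<close>
  define K where "K = 2 + 2 * A + (2 + 2 * ((4 + 5 * A) + (2 + 3 * A)\<^sup>2))"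
  have K: "K > 0" "2 + 2 * A \<le> K"
    using A by (auto simp: K_def intro!: add_pos_nonneg add_nonneg_nonneg)
  have "whp M (\<lambda>n \<omega>. (\<Sum>j<p n. \<bar>\<rho>h n \<omega> $ j\<bar>) \<le> K \<and> fit_err n (($) (\<rho>h n \<omega>)) \<le> K * r n)"
    using whp_conj[OF whp_conj[OF whp_basic_inequality[of v] whp_in_sample_error[OF err r_ev \<beta>r]] whp_gram]
  proof (rule whp_mono_ev[OF _ eventually_conj[OF err_r eventually_conj[OF r_ev eventually_gt_at_top[of 0]]]], elim conjE)
    fix n \<omega>
    let ?u = "($) (\<rho>h n \<omega>)" and ?B = "\<lambda>j i. b j (X (W i \<omega>))"
    let ?D = "emp_mean (T n) (\<lambda>i. (dict_comb ?B (p n) (\<lambda>j. ?u j - v n j) i)\<^sup>2)"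
    assume r: "r n > 0" and n: "n > 0" and errn: "fit_err n (v n) \<le> r n"
      and basic: "?D / 2
      \<le> 2 * emp_mean (T n) (\<lambda>i. (\<alpha> (X (W i \<omega>)) - fit n (v n) (W i \<omega>))\<^sup>2)
      + 2 * (r n / 4) * (\<Sum>j<p n. \<bar>\<rho>h n \<omega> $ j - v n j\<bar>)
      + 2 * r n * ((\<Sum>j<p n. \<bar>v n j\<bar>) - (\<Sum>j<p n. \<bar>\<rho>h n \<omega> $ j\<bar>))"
      and e: "emp_mean (T n) (\<lambda>i. (\<alpha> (X (W i \<omega>)) - fit n (v n) (W i \<omega>))\<^sup>2) \<le> r n"
      and gram: "\<forall>j<p n. \<forall>k<p n. \<bar>emp_mean (T n) (\<lambda>i. b j (X (W i \<omega>)) * b k (X (W i \<omega>)))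
        - (\<integral>w. b j (X w) * b k (X w) \<partial>F)\<bar> \<le> r n"
    have v_le: "(\<Sum>j<p n. \<bar>v n j\<bar>) \<le> A"
    proof -
      have "(\<Sum>j<p n. \<bar>v n j\<bar>) \<le> (\<Sum>j<p n. \<bar>\<rho>0 j\<bar>)"
        by (intro sum_mono) (auto simp: v_def)
      also have "\<dots> \<le> A"
        by (rule sum_le) simp
      finally show ?thesis .
    qed
    have D0: "0 \<le> ?D"
      by (rule emp_mean_nonneg) simp
    have u_le: "(\<Sum>j<p n. \<bar>?u j\<bar>) \<le> 2 + 2 * A" and D_le: "?D \<le> (4 + 5 * A) * r n"
      using lasso_slow_rate[OF basic D0 e v_le r] by auto
    have "(\<Sum>j<p n. \<bar>?u j - v n j\<bar>) \<le> (\<Sum>j<p n. \<bar>?u j\<bar>) + (\<Sum>j<p n. \<bar>v n j\<bar>)"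
      unfolding sum.distrib[symmetric] by (intro sum_mono) auto
    then have "(\<Sum>j<p n. \<bar>?u j - v n j\<bar>) \<le> 2 + 3 * A"
      using u_le v_le by linarith
    then have d2: "(\<Sum>j<p n. \<bar>?u j - v n j\<bar>)\<^sup>2 \<le> (2 + 3 * A)\<^sup>2"
      by (intro power_mono sum_nonneg) auto
    have "(\<integral>w. (fit n (\<lambda>j. ?u j - v n j) w)\<^sup>2 \<partial>F)
        = bform (p n) (\<lambda>j k. \<integral>w. b j (X w) * b k (X w) \<partial>F) (\<lambda>j. ?u j - v n j) (\<lambda>j. ?u j - v n j)"
      by (rule bform_pop_gram[symmetric])
    also have "\<dots> \<le> bform (p n) (\<lambda>j k. emp_mean (T n) (\<lambda>i. ?B j i * ?B k i)) (\<lambda>j. ?u j - v n j) (\<lambda>j. ?u j - v n j)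
        + r n * (\<Sum>j<p n. \<bar>?u j - v n j\<bar>)\<^sup>2"
      using gram by (intro bform_perturb) auto
    also have "bform (p n) (\<lambda>j k. emp_mean (T n) (\<lambda>i. ?B j i * ?B k i)) (\<lambda>j. ?u j - v n j) (\<lambda>j. ?u j - v n j) = ?D"
      unfolding bform_emp_gram by (simp add: power2_eq_square)
    also have "?D + r n * (\<Sum>j<p n. \<bar>?u j - v n j\<bar>)\<^sup>2 \<le> (4 + 5 * A) * r n + r n * (2 + 3 * A)\<^sup>2"
      using D_le d2 r by (intro add_mono mult_left_mono) auto
    finally have pop: "(\<integral>w. (fit n (\<lambda>j. ?u j - v n j) w)\<^sup>2 \<partial>F) \<le> (4 + 5 * A) * r n + r n * (2 + 3 * A)\<^sup>2" .
    have "fit_err n ?u \<le> 2 * fit_err n (v n) + 2 * (\<integral>w. (fit n (\<lambda>j. ?u j - v n j) w)\<^sup>2 \<partial>F)"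
      by (rule fit_err_split)
    also have "\<dots> \<le> 2 * r n + 2 * ((4 + 5 * A) * r n + r n * (2 + 3 * A)\<^sup>2)"
      using errn pop by (intro add_mono mult_left_mono) auto
    also have "\<dots> = (2 + 2 * ((4 + 5 * A) + (2 + 3 * A)\<^sup>2)) * r n"
      by (simp add: algebra_simps)
    also have "\<dots> \<le> K * r n"
      using A r by (intro mult_right_mono) (auto simp: K_def)
    finally show "(\<Sum>j<p n. \<bar>?u j\<bar>) \<le> K \<and> fit_err n ?u \<le> K * r n"
      using u_le K(2) by simp
  qed
  then show ?thesis
    using K(1) by blast
qed

text \<open>The sparsity is the largest admissible one, s ~ C eps^(-\<kappa>) with \<kappa> =
  2/(2\<xi>+1). It balances bias and noise: s^(-2\<xi>) is of order eps^2 s, hence o(r^2 s). The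
  eigenvalue condition is used at N ~ C0/eps^2, and \<kappa> < 2 makes s/N tend to 0, as the
  absorption of the Maurey remainder demands.\<close>

theorem whp_fast_rate:
  assumes sparse: "sparse_approximation F X b p \<alpha> \<xi>" and "\<xi> > 0" and eps0: "eps p \<longlonglongrightarrow> 0"
    and "C0 > 0" "c > 0"
    and RE: "\<And>s. (\<lambda>n. real (s n) * (eps p n)\<^sup>2) \<longlonglongrightarrow> C0 \<Longrightarrow>
      whp M (\<lambda>n \<omega>. restricted_eig_ge (emp_gram X b (p n) (T n) (\<lambda>i. W i \<omega>)) (p n) (s n) c)"
  shows "\<exists>K>0. whp M (\<lambda>n \<omega>. fit_err n (($) (\<rho>h n \<omega>)) \<le> K * ((r n)\<^sup>2 * eps p n powr (- 2 / (2 * \<xi> + 1))))"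
proof -
  define \<kappa> where "\<kappa> = 2 / (2 * \<xi> + 1)"
  have \<kappa>: "0 < \<kappa>" "\<kappa> < 2"
    using \<open>\<xi> > 0\<close> by (auto simp: \<kappa>_def field_simps)
  have \<kappa>2: "- \<kappa> * (- (2 * \<xi> + 1)) = 2"
    using \<open>\<xi> > 0\<close> by (simp add: \<kappa>_def field_simps)
  obtain C where C: "C > 1" and approx: "\<And>n s. n > 0 \<Longrightarrow> s > 0 \<Longrightarrow> real s \<le> C * eps p n powr (- \<kappa>) \<Longrightarrow>
        (\<exists>\<rho> \<in> carrier_vec (p n). card {j. j < p n \<and> \<rho> $ j \<noteq> 0} = s \<and>
           L2_norm_of F (\<lambda>w. \<alpha> (X w) - dict_vec b (p n) (X w) \<bullet> \<rho>) \<le> C * real s powr (- \<xi>))"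
    using sparse unfolding sparse_approximation_def \<kappa>_def minus_divide_left by blast
  define s where "s n = nat \<lfloor>C * eps p n powr (- \<kappa>)\<rfloor>" for n
  define N where "N n = nat \<lfloor>C0 / (eps p n)\<^sup>2\<rfloor>" for n
  have eps_lt_1: "\<forall>\<^sub>F n in sequentially. eps p n < 1"
    using eps0 by (rule order_tendstoD(2)) simp
  have eps_ev: "\<forall>\<^sub>F n in sequentially. 0 < eps p n"
    using eventually_gt_at_top[of 0] by eventually_elim (rule eps_pos)
  have r_ev: "\<forall>\<^sub>F n in sequentially. r n > 0"
    using eventually_gt_at_top[of 0] by eventually_elim (rule r_pos)
  have s_le: "real (s n) \<le> C * eps p n powr (- \<kappa>)" for n
    unfolding s_def using C by simp
  \<comment> \<open>Eventually eps < 1, so rounding down loses less than 1 \<le> eps^(-\<kappa>). A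
    positive multiple is left because \<open>C > 1\<close>.\<close>
  have s_ge: "\<forall>\<^sub>F n in sequentially. (C - 1) * eps p n powr (- \<kappa>) \<le> s n \<and> s n > 0"
    using eps_lt_1 eps_ev
  proof eventually_elim
    case (elim n)
    have "1 powr (- \<kappa>) \<le> eps p n powr (- \<kappa>)"
      using elim \<kappa> by (intro powr_mono2') auto
    then have one: "1 \<le> eps p n powr (- \<kappa>)"
      by simp
    have "C * eps p n powr (- \<kappa>) \<ge> C * 1"
      using one C by (intro mult_left_mono) auto
    then have "C * eps p n powr (- \<kappa>) \<ge> 1"
      using C by linarith
    moreover have "(C - 1) * eps p n powr (- \<kappa>) \<le> C * eps p n powr (- \<kappa>) - 1"
      using one by (simp add: left_diff_distrib)
    ultimately show ?case
      unfolding s_def by linarith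
  qed
  have "\<forall>n. \<exists>v. n > 0 \<longrightarrow> s n > 0 \<longrightarrow> card {j. j < p n \<and> v j \<noteq> 0} = s n \<and>
      fit_err n v \<le> (C * real (s n) powr (- \<xi>))\<^sup>2"
  proof (intro allI)
    fix n
    show "\<exists>v. n > 0 \<longrightarrow> s n > 0 \<longrightarrow> card {j. j < p n \<and> v j \<noteq> 0} = s n \<and>
      fit_err n v \<le> (C * real (s n) powr (- \<xi>))\<^sup>2"
    proof (cases "n > 0 \<and> s n > 0")
      case True
      then obtain \<rho> where \<rho>: "\<rho> \<in> carrier_vec (p n)" "card {j. j < p n \<and> \<rho> $ j \<noteq> 0} = s n"
        "L2_norm_of F (\<lambda>w. \<alpha> (X w) - dict_vec b (p n) (X w) \<bullet> \<rho>) \<le> C * real (s n) powr (- \<xi>)"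
        using approx[of n "s n"] s_le by blast
      have "sqrt (fit_err n (($) \<rho>)) \<le> C * real (s n) powr (- \<xi>)"
        using \<rho>(3) by (simp add: L2_norm_of_def dict_vec_scalar_prod[OF \<rho>(1)])
      then have "fit_err n (($) \<rho>) \<le> (C * real (s n) powr (- \<xi>))\<^sup>2"
        by (rule sqrt_le_D)
      then show ?thesis
        using \<rho>(2) by blast
    qed auto
  qed
  from choice[OF this] obtain v where "\<forall>n. n > 0 \<longrightarrow> s n > 0 \<longrightarrow> card {j. j < p n \<and> v n j \<noteq> 0} = s n \<and>
      fit_err n (v n) \<le> (C * real (s n) powr (- \<xi>))\<^sup>2" ..
  then have v: "\<And>n. n > 0 \<Longrightarrow> s n > 0 \<Longrightarrow> card {j. j < p n \<and> v n j \<noteq> 0} = s n"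
      "\<And>n. n > 0 \<Longrightarrow> s n > 0 \<Longrightarrow> fit_err n (v n) \<le> (C * real (s n) powr (- \<xi>))\<^sup>2"
    by simp_all
  define t where "t n = (r n)\<^sup>2 * s n" for n
  define \<beta> where "\<beta> n = (C * real (s n) powr (- \<xi>))\<^sup>2" for n
  have err: "\<forall>\<^sub>F n in sequentially. fit_err n (v n) \<le> \<beta> n"
    using s_ge eventually_gt_at_top[of 0] by eventually_elim (simp add: \<beta>_def v(2))
  have t_ev: "\<forall>\<^sub>F n in sequentially. t n > 0"
    using s_ge r_ev by eventually_elim (simp add: t_def)
  \<comment> \<open>The quotient equals C^2 s^(-(2\<xi>+1)) / r^2, and \<kappa>(2\<xi>+1) = 2
    converts the lower bound on \<open>s\<close> into a multiple of (eps/r)^2.\<close>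
  have \<beta>t: "(\<lambda>n. \<beta> n / t n) \<longlonglongrightarrow> 0"
  proof (rule tendsto_sandwich[OF _ _ tendsto_const])
    let ?c = "C\<^sup>2 * (C - 1) powr (- (2 * \<xi> + 1))"
    show "(\<lambda>n. ?c * (eps p n / r n)\<^sup>2) \<longlonglongrightarrow> 0"
      using tendsto_power[OF eps_over_r, of 2] by (intro tendsto_mult_right_zero) simp
    show "\<forall>\<^sub>F n in sequentially. \<beta> n / t n \<le> ?c * (eps p n / r n)\<^sup>2"
      using s_ge r_ev eps_ev
    proof eventually_elim
      case (elim n)
      have "\<beta> n / t n = C\<^sup>2 * (real (s n) powr (- (2 * \<xi>)) / s n) / (r n)\<^sup>2"
        using elim by (simp add: \<beta>_def t_def power_mult_distrib powr_power mult.commute)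
      also have "real (s n) powr (- (2 * \<xi>)) / s n = real (s n) powr (- (2 * \<xi> + 1))"
        using elim by (simp add: powr_diff powr_minus_divide powr_add)
      also have "\<dots> \<le> ((C - 1) * eps p n powr (- \<kappa>)) powr (- (2 * \<xi> + 1))"
        using elim C \<open>\<xi> > 0\<close> by (intro powr_mono2') auto
      also have "\<dots> = (C - 1) powr (- (2 * \<xi> + 1)) * (eps p n powr (- \<kappa>)) powr (- (2 * \<xi> + 1))"
        using C by (simp add: powr_mult)
      also have "(eps p n powr (- \<kappa>)) powr (- (2 * \<xi> + 1)) = eps p n powr 2"
        unfolding powr_powr \<kappa>2 ..
      also have "eps p n powr 2 = (eps p n)\<^sup>2"
        using elim by simp
      finally show ?case
        by (simp add: power_divide divide_right_mono mult_left_mono)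
    qed
    show "\<forall>\<^sub>F n in sequentially. 0 \<le> \<beta> n / t n"
      by (simp add: \<beta>_def t_def)
  qed
  \<comment> \<open>Rounding down C0/eps^2 changes the product by at most eps^2, so \<open>N\<close>
    is one of the sequences covered by the eigenvalue condition.\<close>
  have N_lim: "(\<lambda>n. real (N n) * (eps p n)\<^sup>2) \<longlonglongrightarrow> C0"
  proof (rule tendsto_sandwich[OF _ _ _ tendsto_const])
    have N_eq: "real (N n) = of_int \<lfloor>C0 / (eps p n)\<^sup>2\<rfloor>" for n
      unfolding N_def using \<open>C0 > 0\<close> by simp
    show "(\<lambda>n. C0 - (eps p n)\<^sup>2) \<longlonglongrightarrow> C0"
      using tendsto_diff[OF tendsto_const tendsto_power[OF eps0, of 2]] by simp
    show "\<forall>\<^sub>F n in sequentially. C0 - (eps p n)\<^sup>2 \<le> real (N n) * (eps p n)\<^sup>2"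
      using eps_ev
    proof eventually_elim
      case (elim n)
      have "(C0 / (eps p n)\<^sup>2 - 1) * (eps p n)\<^sup>2 \<le> real (N n) * (eps p n)\<^sup>2"
        unfolding N_eq by (intro mult_right_mono) (linarith, simp)
      then show ?case
        using elim by (simp add: left_diff_distrib)
    qed
    show "\<forall>\<^sub>F n in sequentially. real (N n) * (eps p n)\<^sup>2 \<le> C0"
      using eps_ev
    proof eventually_elim
      case (elim n)
      have "real (N n) * (eps p n)\<^sup>2 \<le> C0 / (eps p n)\<^sup>2 * (eps p n)\<^sup>2"
        unfolding N_eq by (intro mult_right_mono) auto
      then show ?case
        using elim by simp
    qed
  qed
  let ?E = "Cb\<^sup>2"
  \<comment> \<open>After multiplication by eps^2 the left side is of order eps^(2-\<kappa>) and
    vanishes, while the right side tends to c C0 > 0.\<close>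
  have N_large: "\<forall>\<^sub>F n in sequentially. 36 * ?E * s n \<le> c * (real (N n) - 1) \<and> N n \<ge> 2"
  proof -
    have "(\<lambda>n. 36 * ?E * (C * eps p n powr (2 - \<kappa>)) + c * (eps p n)\<^sup>2) \<longlonglongrightarrow> 36 * ?E * (C * 0) + c * 0\<^sup>2"
      using \<kappa> eps0 eps_ev
      by (intro tendsto_intros tendsto_zero_powrI[where b = "2 - \<kappa>"]) (auto elim!: eventually_mono)
    moreover have "(\<lambda>n. c * (real (N n) * (eps p n)\<^sup>2)) \<longlonglongrightarrow> c * C0"
      by (intro tendsto_intros N_lim)
    ultimately have "(\<lambda>n. c * (real (N n) * (eps p n)\<^sup>2) - (36 * ?E * (C * eps p n powr (2 - \<kappa>)) + c * (eps p n)\<^sup>2)) \<longlonglongrightarrow> c * C0 - 0"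
      by (intro tendsto_diff) simp_all
    then have ev: "\<forall>\<^sub>F n in sequentially. 0 < c * (real (N n) * (eps p n)\<^sup>2) - (36 * ?E * (C * eps p n powr (2 - \<kappa>)) + c * (eps p n)\<^sup>2)"
      using \<open>c > 0\<close> \<open>C0 > 0\<close> by (intro order_tendstoD(1)[where y = "c * C0"]) simp_all
    show ?thesis
      using ev eps_ev s_ge
    proof eventually_elim
      case (elim n)
      have "36 * ?E * s n * (eps p n)\<^sup>2 \<le> 36 * ?E * (C * eps p n powr (- \<kappa>)) * (eps p n)\<^sup>2"
        using s_le by (intro mult_right_mono mult_left_mono) auto
      also have "\<dots> = 36 * ?E * (C * eps p n powr (2 - \<kappa>))"
        using elim by (simp add: powr_diff powr_minus_divide)
      also have "\<dots> < c * (real (N n) * (eps p n)\<^sup>2) - c * (eps p n)\<^sup>2"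
        using elim by linarith
      also have "\<dots> = c * (real (N n) - 1) * (eps p n)\<^sup>2"
        by (simp add: algebra_simps)
      finally have less: "36 * ?E * s n < c * (real (N n) - 1)"
        using elim by simp
      have "0 \<le> 36 * ?E * s n"
        by simp
      then have "0 < c * (real (N n) - 1)"
        using less by linarith
      then have "real (N n) > 1"
        using \<open>c > 0\<close> by (simp add: zero_less_mult_iff)
      then show ?case
        using less by simp
    qed
  qed
  have bounded: "whp M (\<lambda>n \<omega>. \<forall>i j. \<bar>b j (X (W i \<omega>))\<bar> \<le> Cb)"
    using AE_W[OF b_bound(1)] by (intro whp_AE) (simp add: AE_all_countable)
  have "\<forall>\<^sub>F n in sequentially. \<beta> n / t n < 1"
    using \<beta>t by (rule order_tendstoD(2)) simp
  then have err_t: "\<forall>\<^sub>F n in sequentially. fit_err n (v n) \<le> t n"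
    using err t_ev
  proof eventually_elim
    case (elim n)
    then show ?case
      by (simp add: pos_divide_less_eq)
  qed
  define K where "K = 4 * (4 + c + 25 / c) / c"
  have K: "K > 0"
    using \<open>c > 0\<close> by (simp add: K_def add_pos_pos)
  have "whp M (\<lambda>n \<omega>. fit_err n (($) (\<rho>h n \<omega>)) \<le> (2 + 2 * \<Lambda> * K) * t n)"
    using whp_conj[OF whp_conj[OF whp_basic_inequality[of v] whp_in_sample_error[OF err t_ev \<beta>t]]
        whp_conj[OF RE[OF N_lim] bounded]]
  proof (rule whp_mono_ev[OF _ eventually_conj[OF err_t eventually_conj[OF r_ev eventually_conj[OF s_ge eventually_conj[OF N_large eventually_gt_at_top[of 0]]]]]], elim conjE)
    fix n \<omega>
    let ?u = "($) (\<rho>h n \<omega>)" and ?B = "\<lambda>j i. b j (X (W i \<omega>))"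
    let ?D = "emp_mean (T n) (\<lambda>i. (dict_comb ?B (p n) (\<lambda>j. ?u j - v n j) i)\<^sup>2)"
    assume r: "r n > 0" and n: "n > 0" and errn: "fit_err n (v n) \<le> t n" and s: "s n > 0"
      and Nn: "36 * ?E * s n \<le> c * (real (N n) - 1)" "N n \<ge> 2"
      and basic: "?D / 2
      \<le> 2 * emp_mean (T n) (\<lambda>i. (\<alpha> (X (W i \<omega>)) - fit n (v n) (W i \<omega>))\<^sup>2)
      + 2 * (r n / 4) * (\<Sum>j<p n. \<bar>\<rho>h n \<omega> $ j - v n j\<bar>)
      + 2 * r n * ((\<Sum>j<p n. \<bar>v n j\<bar>) - (\<Sum>j<p n. \<bar>\<rho>h n \<omega> $ j\<bar>))"
      and e: "emp_mean (T n) (\<lambda>i. (\<alpha> (X (W i \<omega>)) - fit n (v n) (W i \<omega>))\<^sup>2) \<le> t n"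
      and re: "restricted_eig_ge (emp_gram X b (p n) (T n) (\<lambda>i. W i \<omega>)) (p n) (N n) c"
      and bd: "\<forall>i j. \<bar>b j (X (W i \<omega>))\<bar> \<le> Cb"
    have lower: "c * (\<Sum>j<p n. (?u j - v n j)\<^sup>2) \<le> ?D + ?E / (real (N n) - 1) * (\<Sum>j<p n. \<bar>?u j - v n j\<bar>)\<^sup>2"
    proof (rule emp_gram_lower_bound)
      show "c * (\<Sum>j<p n. (z j)\<^sup>2) \<le> emp_mean (T n) (\<lambda>i. (dict_comb ?B (p n) z i)\<^sup>2)"
        if "card {j. j < p n \<and> z j \<noteq> 0} \<le> N n" for z
        using restricted_eig_ge_sparse[OF re that] by (simp add: dict_comb_def)
      show "emp_mean (T n) (\<lambda>i. (?B j i)\<^sup>2) \<le> ?E" for j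
      proof -
        have "emp_mean (T n) (\<lambda>i. (?B j i)\<^sup>2) \<le> emp_mean (T n) (\<lambda>i. ?E)"
        proof (rule emp_mean_mono)
          fix i
          show "(?B j i)\<^sup>2 \<le> ?E"
            using bd power_mono[of "\<bar>?B j i\<bar>" Cb 2] by auto
        qed
        also have "\<dots> \<le> ?E"
          by (simp add: emp_mean_def)
        finally show ?thesis .
      qed
    qed (use \<open>c > 0\<close> Nn in auto)
    have "(\<Sum>j<p n. (?u j - v n j)\<^sup>2) \<le> K * ((r n)\<^sup>2 * s n)"
      unfolding K_def using v(1)[OF n s] Nn e r \<open>c > 0\<close> s
      by (intro lasso_fast_rate[OF basic _ _ lower]) (auto simp: t_def emp_mean_nonneg)
    then have "\<Lambda> * (\<Sum>j<p n. (?u j - v n j)\<^sup>2) \<le> \<Lambda> * (K * t n)"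
      unfolding t_def using eig(2) by (rule mult_left_mono)
    then have "(\<integral>w. (fit n (\<lambda>j. ?u j - v n j) w)\<^sup>2 \<partial>F) \<le> \<Lambda> * (K * t n)"
      using pop_norm_le[OF n, of "\<lambda>j. ?u j - v n j"] by linarith
    then show "fit_err n ?u \<le> (2 + 2 * \<Lambda> * K) * t n"
      using fit_err_split[of n ?u "v n"] errn by (simp add: algebra_simps)
  qed
  then have "whp M (\<lambda>n \<omega>. fit_err n (($) (\<rho>h n \<omega>)) \<le> (2 + 2 * \<Lambda> * K) * C * ((r n)\<^sup>2 * eps p n powr (- 2 / (2 * \<xi> + 1))))"
  proof (rule whp_mono')
    fix n \<omega>
    assume "fit_err n (($) (\<rho>h n \<omega>)) \<le> (2 + 2 * \<Lambda> * K) * t n"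
    also have "\<dots> \<le> (2 + 2 * \<Lambda> * K) * ((r n)\<^sup>2 * (C * eps p n powr (- \<kappa>)))"
      unfolding t_def using s_le[of n] eig(2) K by (intro mult_left_mono) auto
    finally show "fit_err n (($) (\<rho>h n \<omega>)) \<le> (2 + 2 * \<Lambda> * K) * C * ((r n)\<^sup>2 * eps p n powr (- 2 / (2 * \<xi> + 1)))"
      by (simp add: \<kappa>_def mult_ac)
  qed
  moreover have "(2 + 2 * \<Lambda> * K) * C > 0"
    using C K eig(2) by (intro mult_pos_pos add_pos_nonneg) auto
  ultimately show ?thesis
    by blast
qed

end

section \<open>Rates as powers of \<open>n\<close>, projections, cross-fitting\<close>

context
  fixes p :: "nat \<Rightarrow> nat" and r :: "nat \<Rightarrow> real"
  assumes p_ge: "\<And>n. n > 0 \<Longrightarrow> p n \<ge> 2"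
    and p_poly: "\<exists>C>0. \<forall>n>0. real (p n) \<le> C * real n powr C"
begin

text \<open>Polynomial growth of \<open>p\<close> makes ln p of order ln n, which is below every
  positive power of n.\<close>

lemma eps_le_powr:
  assumes "\<delta> > 0"
  shows "\<forall>\<^sub>F n in sequentially. eps p n \<le> real n powr (\<delta> - 1 / 2)"
proof -
  obtain C where C: "C > 0" "\<And>n. n > 0 \<Longrightarrow> real (p n) \<le> C * real n powr C"
    using p_poly by blast
  have "((\<lambda>x::real. (ln C + C * ln x) / x powr (2 * \<delta>)) \<longlongrightarrow> 0) at_top"
    using assms by real_asymp
  then have "(\<lambda>n. (ln C + C * ln (real n)) / real n powr (2 * \<delta>)) \<longlonglongrightarrow> 0"
    by (rule filterlim_compose[OF _ filterlim_real_sequentially])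
  then have "\<forall>\<^sub>F n in sequentially. (ln C + C * ln (real n)) / real n powr (2 * \<delta>) < 1"
    by (rule order_tendstoD(2)) simp
  then show ?thesis
    using eventually_gt_at_top[of 0]
  proof eventually_elim
    case (elim n)
    have "real (p n) > 0"
      using p_ge[OF elim(2)] by simp
    then have "ln (real (p n)) \<le> ln (C * real n powr C)"
      using C(2)[OF elim(2)] by (intro ln_mono) auto
    also have "\<dots> = ln C + C * ln (real n)"
      using C(1) elim(2) by (simp add: ln_mult ln_powr)
    also have "\<dots> \<le> real n powr (2 * \<delta>)"
      using elim by (simp add: divide_less_eq)
    finally have "ln (real (p n)) / n \<le> real n powr (2 * \<delta>) / n"
      by (intro divide_right_mono) auto
    also have "\<dots> = (real n powr (\<delta> - 1 / 2))\<^sup>2"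
    proof -
      have "(real n powr (\<delta> - 1 / 2))\<^sup>2 = real n powr (2 * \<delta> - 1)"
        using elim(2) by (simp add: powr_power algebra_simps)
      then show ?thesis
        using elim(2) by (simp add: powr_diff)
    qed
    finally show ?case
      unfolding eps_def by (intro real_le_lsqrt) auto
  qed
qed

lemma eps_nonneg: "n > 0 \<Longrightarrow> 0 \<le> eps p n"
  using p_ge[of n] by (simp add: eps_def)

lemma eps_tendsto_0: "eps p \<longlonglongrightarrow> 0"
proof (rule tendsto_sandwich[OF _ _ tendsto_const])
  show "\<forall>\<^sub>F n in sequentially. eps p n \<le> real n powr (1 / 4 - 1 / 2)"
    by (rule eps_le_powr) simp
  show "\<forall>\<^sub>F n in sequentially. 0 \<le> eps p n"
    using eventually_gt_at_top[of 0] by eventually_elim (rule eps_nonneg)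
  show "(\<lambda>n. real n powr (1 / 4 - 1 / 2)) \<longlonglongrightarrow> 0"
    by (intro tendsto_neg_powr filterlim_real_sequentially) simp
qed

context
  assumes r_pos: "\<And>n. n > 0 \<Longrightarrow> r n > 0"
    and r_upper: "\<And>c. c > 0 \<Longrightarrow> r \<in> o(\<lambda>n. real n powr c * eps p n)"
begin

lemma r_le_eps:
  assumes "\<delta> > 0"
  shows "\<forall>\<^sub>F n in sequentially. r n \<le> real n powr \<delta> * eps p n"
proof -
  have "\<forall>\<^sub>F n in sequentially. norm (r n) \<le> 1 * norm (real n powr \<delta> * eps p n)"
    using r_upper[OF assms] by (rule landau_o.smallD) simp
  then show ?thesis
    using eventually_gt_at_top[of 0]
  proof eventually_elim
    case (elim n)
    then show ?case
      using r_pos[OF elim(2)] eps_nonneg[OF elim(2)] by (simp add: abs_mult)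
  qed
qed

lemma const_le_powr:
  assumes "\<delta> > 0"
  shows "\<forall>\<^sub>F n in sequentially. K \<le> real n powr \<delta>"
proof -
  have "filterlim (\<lambda>x::real. x powr \<delta>) at_top at_top"
    using assms by real_asymp
  then have "filterlim (\<lambda>n. real n powr \<delta>) at_top sequentially"
    by (rule filterlim_compose[OF _ filterlim_real_sequentially])
  then show ?thesis
    unfolding filterlim_at_top by blast
qed

lemma slow_rate_exponent:
  assumes "a < 1 / 4"
  shows "\<forall>\<^sub>F n in sequentially. K * r n \<le> (real n powr (- a))\<^sup>2"
proof -
  \<comment> \<open>The gap 1/2 - 2a is shared equally among three losses: the constant
    \<open>K\<close>, the ratio of r to eps, and the logarithm in eps.\<close>
  define \<delta> where "\<delta> = (1 / 2 - 2 * a) / 3"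
  have \<delta>: "\<delta> > 0" "\<delta> + (\<delta> + (\<delta> - 1 / 2)) = - (2 * a)"
    using assms by (simp_all add: \<delta>_def field_simps)
  show ?thesis
    using const_le_powr[OF \<delta>(1), of K] r_le_eps[OF \<delta>(1)] eps_le_powr[OF \<delta>(1)] eventually_gt_at_top[of 0]
  proof eventually_elim
    case (elim n)
    have "K * r n \<le> real n powr \<delta> * r n"
      using elim r_pos[OF elim(4)] by (intro mult_right_mono) auto
    also have "\<dots> \<le> real n powr \<delta> * (real n powr \<delta> * eps p n)"
      using elim by (intro mult_left_mono) auto
    also have "\<dots> \<le> real n powr \<delta> * (real n powr \<delta> * real n powr (\<delta> - 1 / 2))"
      using elim by (intro mult_left_mono) auto
    also have "\<dots> = real n powr (- (2 * a))"
      unfolding powr_add[symmetric] \<delta> ..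
    also have "\<dots> = (real n powr (- a))\<^sup>2"
      using elim by (simp add: powr_power mult.commute)
    finally show ?case .
  qed
qed

lemma fast_rate_exponent:
  assumes "\<xi> > 0" "a < \<xi> / (2 * \<xi> + 1)"
  shows "\<forall>\<^sub>F n in sequentially. K * ((r n)\<^sup>2 * eps p n powr (- 2 / (2 * \<xi> + 1))) \<le> (real n powr (- a))\<^sup>2"
proof -
  define \<kappa> where "\<kappa> = 2 / (2 * \<xi> + 1)"
  have \<kappa>: "0 < \<kappa>" "\<kappa> < 2" "(2 - \<kappa>) / 2 = 2 * (\<xi> / (2 * \<xi> + 1))"
    using assms(1) by (auto simp: \<kappa>_def field_simps)
  \<comment> \<open>The solution of \<delta> + 2\<delta> + (\<delta> - 1/2)(2 - \<kappa>) = -2a. It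
    is positive because (2 - \<kappa>)/2 is twice the critical exponent \<xi>/(2\<xi>+1).\<close>
  define \<delta> where "\<delta> = ((2 - \<kappa>) / 2 - 2 * a) / (5 - \<kappa>)"
  have "\<delta> > 0"
    unfolding \<delta>_def \<kappa>(3) using assms(2) \<kappa> by (intro divide_pos_pos) auto
  have "\<delta> * (5 - \<kappa>) = (2 - \<kappa>) / 2 - 2 * a"
    using \<kappa> by (simp add: \<delta>_def)
  then have expo: "\<delta> + (2 * \<delta> + (\<delta> - 1 / 2) * (2 - \<kappa>)) = - (2 * a)"
    by (simp add: field_simps)
  show ?thesis
    using const_le_powr[OF \<open>\<delta> > 0\<close>, of K] r_le_eps[OF \<open>\<delta> > 0\<close>] eps_le_powr[OF \<open>\<delta> > 0\<close>] eventually_gt_at_top[of 0]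
  proof eventually_elim
    case (elim n)
    have eps: "eps p n > 0"
      using p_ge[OF elim(4)] elim(4) by (simp add: eps_def)
    have "(r n)\<^sup>2 \<le> (real n powr \<delta> * eps p n)\<^sup>2"
      using elim r_pos[OF elim(4)] by (intro power_mono) auto
    also have "\<dots> = real n powr (2 * \<delta>) * eps p n powr 2"
      using elim eps by (simp add: power_mult_distrib powr_power mult.commute)
    finally have "(r n)\<^sup>2 * eps p n powr (- \<kappa>) \<le> real n powr (2 * \<delta>) * eps p n powr 2 * eps p n powr (- \<kappa>)"
      by (intro mult_right_mono) auto
    also have "\<dots> = real n powr (2 * \<delta>) * eps p n powr (2 - \<kappa>)"
      by (simp add: mult.assoc powr_add[symmetric])
    also have "\<dots> \<le> real n powr (2 * \<delta>) * (real n powr (\<delta> - 1 / 2)) powr (2 - \<kappa>)"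
      using elim eps \<kappa> by (intro mult_left_mono powr_mono2) auto
    finally have le: "(r n)\<^sup>2 * eps p n powr (- \<kappa>) \<le> real n powr (2 * \<delta>) * real n powr ((\<delta> - 1 / 2) * (2 - \<kappa>))"
      by (simp add: powr_powr)
    have "K * ((r n)\<^sup>2 * eps p n powr (- \<kappa>)) \<le> real n powr \<delta> * ((r n)\<^sup>2 * eps p n powr (- \<kappa>))"
      using elim by (intro mult_right_mono) auto
    also have "\<dots> \<le> real n powr \<delta> * (real n powr (2 * \<delta>) * real n powr ((\<delta> - 1 / 2) * (2 - \<kappa>)))"
      using le by (intro mult_left_mono) auto
    also have "\<dots> = real n powr (- (2 * a))"
      unfolding powr_add[symmetric] expo ..
    also have "\<dots> = (real n powr (- a))\<^sup>2"
      using elim by (simp add: powr_power mult.commute)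
    finally show ?case
      by (simp add: \<kappa>_def)
  qed
qed

end

end

section \<open>Square integrability, projections, conditional variance\<close>

lemma integrable_mult_squares:
  fixes f g :: "'w \<Rightarrow> real"
  assumes [measurable]: "f \<in> borel_measurable F" "g \<in> borel_measurable F"
    and "integrable F (\<lambda>w. (f w)\<^sup>2)" "integrable F (\<lambda>w. (g w)\<^sup>2)"
  shows "integrable F (\<lambda>w. f w * g w)"
proof (rule Bochner_Integration.integrable_bound)
  show "integrable F (\<lambda>w. (f w)\<^sup>2 + (g w)\<^sup>2)"
    using assms by simp
  have "\<bar>f w * g w\<bar> \<le> (f w)\<^sup>2 + (g w)\<^sup>2" for w
  proof -
    have "2 * (\<bar>f w\<bar> * \<bar>g w\<bar>) \<le> (f w)\<^sup>2 + (g w)\<^sup>2"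
      using zero_le_power2[of "\<bar>f w\<bar> - \<bar>g w\<bar>"] by (simp add: power2_diff mult_ac)
    moreover have "0 \<le> \<bar>f w\<bar> * \<bar>g w\<bar>"
      by simp
    ultimately show ?thesis
      unfolding abs_mult by argo
  qed
  then show "AE w in F. norm (f w * g w) \<le> norm ((f w)\<^sup>2 + (g w)\<^sup>2)"
    by (auto intro: AE_I2)
qed measurable

lemma integrable_add_square:
  fixes f g :: "'w \<Rightarrow> real"
  assumes [measurable]: "f \<in> borel_measurable F" "g \<in> borel_measurable F"
    and "integrable F (\<lambda>w. (f w)\<^sup>2)" "integrable F (\<lambda>w. (g w)\<^sup>2)"
  shows "integrable F (\<lambda>w. (f w + g w)\<^sup>2)"
proof -
  have "integrable F (\<lambda>w. (f w)\<^sup>2 + 2 * (f w * g w) + (g w)\<^sup>2)"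
    using assms integrable_mult_squares[OF assms] by simp
  then show ?thesis
    by (simp add: power2_sum mult.assoc add_ac)
qed

lemma integrable_diff_square:
  fixes f g :: "'w \<Rightarrow> real"
  assumes [measurable]: "f \<in> borel_measurable F" "g \<in> borel_measurable F"
    and "integrable F (\<lambda>w. (f w)\<^sup>2)" "integrable F (\<lambda>w. (g w)\<^sup>2)"
  shows "integrable F (\<lambda>w. (f w - g w)\<^sup>2)"
  using integrable_add_square[of f F "\<lambda>w. - g w"] assms by simp

text \<open>First-order condition along the line g + t h: the excess t^2 D - 2 t B of the squared
  distance is nonnegative for all t, which forces B = 0.\<close>

lemma projection_orthogonal:
  fixes Z :: "'w \<Rightarrow> real" and X :: "'w \<Rightarrow> 'x::euclidean_space"
  assumes meas [measurable]: "X \<in> measurable F borel" "Z \<in> borel_measurable F"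
    and Z: "integrable F (\<lambda>w. (Z w)\<^sup>2)"
    and \<Gamma>: "closed_linear_subspace F X \<Gamma>"
    and g: "is_arg_min (\<lambda>\<gamma>. \<integral>w. (Z w - \<gamma> (X w))\<^sup>2 \<partial>F) (\<lambda>\<gamma>. \<gamma> \<in> \<Gamma>) g"
    and h: "h \<in> \<Gamma>"
  shows "(\<integral>w. (Z w - g (X w)) * h (X w) \<partial>F) = 0"
proof -
  have gh: "g \<in> L2_fun F X" "h \<in> L2_fun F X"
    using g h \<Gamma> by (auto simp: is_arg_min_def closed_linear_subspace_def)
  then have [measurable]: "g \<in> borel_measurable borel" "h \<in> borel_measurable borel"
    by (auto simp: L2_fun_def)
  have sq: "integrable F (\<lambda>w. (g (X w))\<^sup>2)" "integrable F (\<lambda>w. (h (X w))\<^sup>2)"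
    using gh by (auto simp: L2_fun_def)
  have res: "integrable F (\<lambda>w. (Z w - g (X w))\<^sup>2)"
    by (rule integrable_diff_square) (use Z sq in measurable)
  have prod: "integrable F (\<lambda>w. (Z w - g (X w)) * h (X w))"
    by (rule integrable_mult_squares) (use res sq in measurable)
  define B where "B = (\<integral>w. (Z w - g (X w)) * h (X w) \<partial>F)"
  define D where "D = (\<integral>w. (h (X w))\<^sup>2 \<partial>F)"
  have D: "D \<ge> 0"
    by (simp add: D_def)
  have ineq: "0 \<le> t\<^sup>2 * D - 2 * t * B" for t
  proof -
    have "(\<lambda>x. g x + t * h x) \<in> \<Gamma>"
      using g h \<Gamma> by (auto simp: is_arg_min_def closed_linear_subspace_def)
    then have "(\<integral>w. (Z w - g (X w))\<^sup>2 \<partial>F) \<le> (\<integral>w. (Z w - (g (X w) + t * h (X w)))\<^sup>2 \<partial>F)"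
      using g by (auto simp: is_arg_min_linorder)
    also have "\<dots> = (\<integral>w. (Z w - g (X w))\<^sup>2 - 2 * t * ((Z w - g (X w)) * h (X w)) + t\<^sup>2 * (h (X w))\<^sup>2 \<partial>F)"
      by (intro Bochner_Integration.integral_cong refl) (simp add: power2_eq_square algebra_simps)
    also have "\<dots> = (\<integral>w. (Z w - g (X w))\<^sup>2 \<partial>F) - 2 * t * B + t\<^sup>2 * D"
      unfolding B_def D_def using res prod sq by simp
    finally show ?thesis by simp
  qed
  \<comment> \<open>The minimizer would be B/D; the added 1 covers D = 0 and still yields -u^2 (D +
    2) \<ge> 0.\<close>
  define u where "u = B / (D + 1)"
  have B: "B = u * (D + 1)"
    using D by (simp add: u_def)
  have "0 \<le> u\<^sup>2 * D - 2 * u * (u * (D + 1))"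
    using ineq[of u] unfolding B .
  also have "\<dots> = u\<^sup>2 * (D - 2 * (D + 1))"
    by (simp add: algebra_simps power2_eq_square)
  finally have "u\<^sup>2 \<le> 0"
    using D by (simp add: zero_le_mult_iff)
  then have "B = 0"
    by (simp add: B)
  then show ?thesis
    by (simp add: B_def)
qed

text \<open>The factor g(X)^2 is measurable with respect to the \<sigma>-algebra of X and can be
  pulled out of the conditional expectation. Thus an unbounded residual is handled through its
  conditional variance; the bound \<open>K\<close> secures integrability and does not enter the
  estimate.\<close>

lemma integral_le_cond_exp_bound:
  fixes f :: "'w \<Rightarrow> real" and X :: "'w \<Rightarrow> 'x::euclidean_space"
  assumes F: "prob_space F" and meas [measurable]: "X \<in> measurable F borel" "f \<in> borel_measurable F" "g \<in> borel_measurable borel"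
    and f: "integrable F f" "\<And>w. f w \<ge> 0"
    and cond: "AE w in F. real_cond_exp F (vimage_algebra (space F) X borel) f w \<le> C"
    and g: "AE w in F. \<bar>g (X w)\<bar> \<le> K"
  shows "integrable F (\<lambda>w. (g (X w))\<^sup>2 * f w)"
    and "(\<integral>w. (g (X w))\<^sup>2 * f w \<partial>F) \<le> C * (\<integral>w. (g (X w))\<^sup>2 \<partial>F)"
proof -
  interpret F: prob_space F by (rule F)
  let ?S = "vimage_algebra (space F) X borel"
  have sub: "subalgebra F ?S"
    unfolding subalgebra_def using measurable_sets[OF meas(1)]
    by (auto simp: sets_vimage_algebra2)
  interpret finite_measure_subalgebra F ?S
    by standard (rule sub)
  have gX: "(\<lambda>w. (g (X w))\<^sup>2) \<in> borel_measurable ?S"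
  proof -
    have "X \<in> measurable ?S borel"
      by (rule measurable_vimage_algebra1) simp
    then show ?thesis
      by measurable
  qed
  have K: "AE w in F. (g (X w))\<^sup>2 \<le> K\<^sup>2"
    using g by eventually_elim (metis abs_ge_zero power2_abs power_mono)
  show int: "integrable F (\<lambda>w. (g (X w))\<^sup>2 * f w)"
  proof (rule Bochner_Integration.integrable_bound)
    show "integrable F (\<lambda>w. K\<^sup>2 * f w)"
      using f by simp
    show "AE w in F. norm ((g (X w))\<^sup>2 * f w) \<le> norm (K\<^sup>2 * f w)"
      using K by eventually_elim (simp add: f(2) mult_right_mono)
  qed measurable
  have sq_int: "integrable F (\<lambda>w. (g (X w))\<^sup>2)"
    using K by (intro F.integrable_const_bound[of _ "K\<^sup>2"]) auto
  have "(\<integral>w. (g (X w))\<^sup>2 * f w \<partial>F) = (\<integral>w. (g (X w))\<^sup>2 * real_cond_exp F ?S f w \<partial>F)"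
    using real_cond_exp_intg(2)[OF int gX] by simp
  also have "\<dots> \<le> (\<integral>w. C * (g (X w))\<^sup>2 \<partial>F)"
  proof (rule integral_mono_AE)
    show "integrable F (\<lambda>w. (g (X w))\<^sup>2 * real_cond_exp F ?S f w)"
      using real_cond_exp_intg(1)[OF int gX] by simp
    show "AE w in F. (g (X w))\<^sup>2 * real_cond_exp F ?S f w \<le> C * (g (X w))\<^sup>2"
      using cond
    proof eventually_elim
      case (elim w)
      then have "(g (X w))\<^sup>2 * real_cond_exp F ?S f w \<le> (g (X w))\<^sup>2 * C"
        by (intro mult_left_mono) auto
      then show ?case by (simp add: mult.commute)
    qed
  qed (use sq_int in simp)
  finally show "(\<integral>w. (g (X w))\<^sup>2 * f w \<partial>F) \<le> C * (\<integral>w. (g (X w))\<^sup>2 \<partial>F)"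
    by simp
qed

section \<open>Fold sums of functions estimated from the other observations\<close>

context iid_sample
begin

lemma whp_fold_sum:
  fixes h :: "nat \<Rightarrow> (nat \<Rightarrow> 'w) \<Rightarrow> 'w \<Rightarrow> real" and t :: "nat \<Rightarrow> real"
  assumes TT: "\<And>n. T n \<inter> T' n = {}" "\<And>n. finite (T n)" "\<And>n. finite (T' n)"
    and h: "\<And>n. n > 0 \<Longrightarrow> (\<lambda>(d, w). h n d w) \<in> borel_measurable (PiM (T n) (\<lambda>_. F) \<Otimes>\<^sub>M F)"
    and S: "\<And>\<delta> n. n > 0 \<Longrightarrow> S \<delta> n \<in> sets (PiM (T n) (\<lambda>_. F))"
    and whp_S: "\<And>\<delta>. \<delta> > 0 \<Longrightarrow> whp M (\<lambda>n \<omega>. (\<lambda>i\<in>T n. W i \<omega>) \<in> S \<delta> n)"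
    and q: "\<And>\<delta> n d. \<delta> > 0 \<Longrightarrow> n > 0 \<Longrightarrow> d \<in> S \<delta> n \<Longrightarrow>
      prob {\<omega> \<in> space M. t n < \<bar>\<Sum>i\<in>T' n. h n d (W i \<omega>)\<bar>} \<le> \<delta>"
  shows "whp M (\<lambda>n \<omega>. \<bar>\<Sum>i\<in>T' n. h n (\<lambda>i\<in>T n. W i \<omega>) (W i \<omega>)\<bar> \<le> t n)"
proof -
  let ?P = "\<lambda>n. PiM (T n) (\<lambda>_. F)" and ?P' = "\<lambda>n. PiM (T' n) (\<lambda>_. F)"
  define B where "B n = {(d, f) \<in> space (?P n \<Otimes>\<^sub>M ?P' n). t n < \<bar>\<Sum>i\<in>T' n. h n d (f i)\<bar>}" for n
  have B_meas: "B n \<in> sets (?P n \<Otimes>\<^sub>M ?P' n)" if "n > 0" for n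
  proof -
    have "(\<lambda>x. h n (fst x) (snd x i)) \<in> borel_measurable (?P n \<Otimes>\<^sub>M ?P' n)" if "i \<in> T' n" for i
    proof -
      have "(\<lambda>x. (fst x, snd x i)) \<in> measurable (?P n \<Otimes>\<^sub>M ?P' n) (?P n \<Otimes>\<^sub>M F)"
        using that by measurable
      from measurable_compose[OF this h[OF \<open>n > 0\<close>]] show ?thesis
        by simp
    qed
    then have [measurable]: "(\<lambda>x. \<Sum>i\<in>T' n. h n (fst x) (snd x i)) \<in> borel_measurable (?P n \<Otimes>\<^sub>M ?P' n)"
      by (intro borel_measurable_sum)
    have "B n = {x \<in> space (?P n \<Otimes>\<^sub>M ?P' n). t n < \<bar>\<Sum>i\<in>T' n. h n (fst x) (snd x i)\<bar>}"
      by (auto simp: B_def)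
    then show ?thesis
      by simp
  qed
  have train_space: "(\<lambda>i\<in>T n. W i \<omega>) \<in> space (?P n)" "(\<lambda>i\<in>T' n. W i \<omega>) \<in> space (?P' n)"
    if "\<omega> \<in> space M" for n \<omega>
    using measurable_space[OF measurable_W that] by (auto simp: space_PiM)
  have "whp M (\<lambda>n \<omega>. (\<lambda>i\<in>T n. W i \<omega>, \<lambda>i\<in>T' n. W i \<omega>) \<notin> B n)"
  proof (rule whp_split_sample[OF TT S whp_S B_meas])
    fix \<delta> :: real and n :: nat and d
    assume \<delta>: "\<delta> > 0" and n: "n > 0" and d: "d \<in> S \<delta> n"
    have "d \<in> space (?P n)"
      using d sets.sets_into_space[OF S[OF n]] by blast
    from measurable_Pair2[OF h[OF n] this] have [measurable]: "h n d \<in> borel_measurable F"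
      by simp
    have "prob {\<omega> \<in> space M. (d, \<lambda>i\<in>T' n. W i \<omega>) \<in> B n}
        \<le> prob {\<omega> \<in> space M. t n < \<bar>\<Sum>i\<in>T' n. h n d (W i \<omega>)\<bar>}"
      by (intro finite_measure_mono) (auto simp: B_def)
    also have "\<dots> \<le> \<delta>"
      by (rule q[OF \<delta> n d])
    finally show "prob {\<omega> \<in> space M. (d, \<lambda>i\<in>T' n. W i \<omega>) \<in> B n} \<le> \<delta>" .
  qed
  then show ?thesis
    by (rule whp_mono') (use train_space in \<open>auto simp: B_def space_pair_measure not_less\<close>)
qed

lemma train_in_space: "\<omega> \<in> space M \<Longrightarrow> (\<lambda>i\<in>T. W i \<omega>) \<in> space (PiM T (\<lambda>_. F))"
  using measurable_space[OF measurable_W] by (auto simp: space_PiM)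

text \<open>Chebyshev's inequality with the training sample frozen: centered summands with vanishing
  second moment have a fold sum of order o(sqrt n). The second moment is an \<open>ennreal\<close>
  integral so that a possibly infinite one counts as large, not as 0.\<close>

lemma whp_fold_sum_L2:
  fixes h :: "nat \<Rightarrow> (nat \<Rightarrow> 'w) \<Rightarrow> 'w \<Rightarrow> real"
  assumes TT: "\<And>n. T n \<inter> T' n = {}" "\<And>n. finite (T n)" "\<And>n. finite (T' n)" "\<And>n. card (T' n) \<le> n"
    and h: "\<And>n. n > 0 \<Longrightarrow> (\<lambda>(d, w). h n d w) \<in> borel_measurable (PiM (T n) (\<lambda>_. F) \<Otimes>\<^sub>M F)"
    and small: "\<And>v. v > 0 \<Longrightarrow> whp M (\<lambda>n \<omega>. (\<integral>\<^sup>+w. ennreal ((h n (\<lambda>i\<in>T n. W i \<omega>) w)\<^sup>2) \<partial>F) \<le> ennreal v \<and>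
        (\<integral>w. h n (\<lambda>i\<in>T n. W i \<omega>) w \<partial>F) = 0)"
    and "e > 0"
  shows "whp M (\<lambda>n \<omega>. \<bar>\<Sum>i\<in>T' n. h n (\<lambda>i\<in>T n. W i \<omega>) (W i \<omega>)\<bar> \<le> e * sqrt (real n))"
proof -
  interpret F: prob_space F by (rule prob_space_F)
  let ?P = "\<lambda>n. PiM (T n) (\<lambda>_. F)"
  \<comment> \<open>The threshold \<delta> e^2 makes the Chebyshev bound equal to \<delta>.\<close>
  define S where "S \<delta> n = {d \<in> space (?P n). (\<integral>\<^sup>+w. ennreal ((h n d w)\<^sup>2) \<partial>F) \<le> ennreal (\<delta> * e\<^sup>2) \<and>
      (\<integral>w. h n d w \<partial>F) = 0}" for \<delta> n
  show ?thesis
  proof (rule whp_fold_sum[where S = S, OF TT(1,2,3) h])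
    fix \<delta> :: real and n :: nat assume n: "n > 0"
    note [measurable] = h[OF n]
    show "S \<delta> n \<in> sets (?P n)"
      unfolding S_def by measurable
  next
    fix \<delta> :: real assume "\<delta> > 0"
    then have "\<delta> * e\<^sup>2 > 0"
      using \<open>e > 0\<close> by simp
    then show "whp M (\<lambda>n \<omega>. (\<lambda>i\<in>T n. W i \<omega>) \<in> S \<delta> n)"
      by (rule_tac whp_mono'[OF small]) (auto simp: S_def train_in_space)
  next
    fix \<delta> :: real and n :: nat and d
    assume \<delta>: "\<delta> > 0" and n: "n > 0" and d: "d \<in> S \<delta> n"
    have hm [measurable]: "h n d \<in> borel_measurable F"
      using measurable_Pair2[OF h[OF n], of d] d by (simp add: S_def)
    have le: "(\<integral>\<^sup>+w. ennreal ((h n d w)\<^sup>2) \<partial>F) \<le> ennreal (\<delta> * e\<^sup>2)" and mean: "(\<integral>w. h n d w \<partial>F) = 0"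
      using d by (auto simp: S_def)
    have sq: "integrable F (\<lambda>w. (h n d w)\<^sup>2)"
      using le by (intro integrableI_bounded) (auto intro: le_less_trans)
    have sq_le: "(\<integral>w. (h n d w)\<^sup>2 \<partial>F) \<le> \<delta> * e\<^sup>2"
      using le \<delta> by (subst (asm) nn_integral_eq_integral[OF sq]) auto
    have t: "e * sqrt (real n) > 0"
      using n \<open>e > 0\<close> by simp
    have "prob {\<omega> \<in> space M. e * sqrt (real n) < \<bar>\<Sum>i\<in>T' n. h n d (W i \<omega>)\<bar>}
        \<le> card (T' n) * (\<integral>w. (h n d w)\<^sup>2 \<partial>F) / (e * sqrt (real n))\<^sup>2"
      by (rule Chebyshev_sum[OF hm sq mean TT(3) t])
    also have "\<dots> \<le> n * (\<delta> * e\<^sup>2) / (e * sqrt (real n))\<^sup>2"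
      using TT(4)[of n] sq_le by (intro divide_right_mono mult_mono) auto
    also have "\<dots> = \<delta>"
      using n \<open>e > 0\<close> by (simp add: power_mult_distrib)
    finally show "prob {\<omega> \<in> space M. e * sqrt (real n) < \<bar>\<Sum>i\<in>T' n. h n d (W i \<omega>)\<bar>} \<le> \<delta>" .
  qed
qed

text \<open>Markov's inequality with the training sample frozen, for nonnegative terms without
  centering. The scale \<open>s\<close> is 1/sqrt n for the product of the two errors and 1 for the
  squared errors in the variance estimator.\<close>

lemma whp_fold_sum_L1:
  fixes h :: "nat \<Rightarrow> (nat \<Rightarrow> 'w) \<Rightarrow> 'w \<Rightarrow> real" and s :: "nat \<Rightarrow> real" and e :: real
  assumes TT: "\<And>n. T n \<inter> T' n = {}" "\<And>n. finite (T n)" "\<And>n. finite (T' n)" "\<And>n. card (T' n) \<le> n"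
    and h: "\<And>n. n > 0 \<Longrightarrow> (\<lambda>(d, w). h n d w) \<in> borel_measurable (PiM (T n) (\<lambda>_. F) \<Otimes>\<^sub>M F)"
    and nonneg: "\<And>n d w. h n d w \<ge> 0"
    and s: "\<And>n. n > 0 \<Longrightarrow> s n > 0"
    and small: "\<And>v. v > 0 \<Longrightarrow> whp M (\<lambda>n \<omega>. (\<integral>\<^sup>+w. ennreal (h n (\<lambda>i\<in>T n. W i \<omega>) w) \<partial>F) \<le> ennreal (v * s n))"
    and "e > 0"
  shows "whp M (\<lambda>n \<omega>. (\<Sum>i\<in>T' n. h n (\<lambda>i\<in>T n. W i \<omega>) (W i \<omega>)) \<le> e * (n * s n))"
proof -
  interpret F: prob_space F by (rule prob_space_F)
  let ?P = "\<lambda>n. PiM (T n) (\<lambda>_. F)"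
  define S where "S \<delta> n = {d \<in> space (?P n). (\<integral>\<^sup>+w. ennreal (h n d w) \<partial>F) \<le> ennreal (\<delta> * e * s n)}" for \<delta> n
  have abs_sum: "\<bar>\<Sum>i\<in>T' n. h n d (W i \<omega>)\<bar> = (\<Sum>i\<in>T' n. h n d (W i \<omega>))" for n d \<omega>
    using nonneg by (simp add: sum_nonneg)
  have "whp M (\<lambda>n \<omega>. \<bar>\<Sum>i\<in>T' n. h n (\<lambda>i\<in>T n. W i \<omega>) (W i \<omega>)\<bar> \<le> e * (n * s n))"
  proof (rule whp_fold_sum[where S = S, OF TT(1,2,3) h])
    fix \<delta> :: real and n :: nat assume n: "n > 0"
    note [measurable] = h[OF n]
    show "S \<delta> n \<in> sets (?P n)"
      unfolding S_def by measurable
  next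
    fix \<delta> :: real assume "\<delta> > 0"
    then have "\<delta> * e > 0"
      using \<open>e > 0\<close> by simp
    then show "whp M (\<lambda>n \<omega>. (\<lambda>i\<in>T n. W i \<omega>) \<in> S \<delta> n)"
      by (rule_tac whp_mono'[OF small]) (auto simp: S_def train_in_space)
  next
    fix \<delta> :: real and n :: nat and d
    assume \<delta>: "\<delta> > 0" and n: "n > 0" and d: "d \<in> S \<delta> n"
    have hm [measurable]: "h n d \<in> borel_measurable F"
      using measurable_Pair2[OF h[OF n], of d] d by (simp add: S_def)
    have le: "(\<integral>\<^sup>+w. ennreal (h n d w) \<partial>F) \<le> ennreal (\<delta> * e * s n)"
      using d by (auto simp: S_def)
    have int: "integrable F (h n d)"
      using le nonneg by (intro integrableI_bounded) (auto intro: le_less_trans)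
    have int_le: "(\<integral>w. h n d w \<partial>F) \<le> \<delta> * e * s n"
      using le \<delta> \<open>e > 0\<close> s[OF n] nonneg by (subst (asm) nn_integral_eq_integral[OF int]) auto
    have t: "e * (n * s n) > 0"
      using n \<open>e > 0\<close> s[OF n] by simp
    have "prob {\<omega> \<in> space M. e * (n * s n) < \<bar>\<Sum>i\<in>T' n. h n d (W i \<omega>)\<bar>}
        \<le> card (T' n) * (\<integral>w. h n d w \<partial>F) / (e * (n * s n))"
      unfolding abs_sum by (rule Markov_sum[OF int nonneg TT(3) t])
    also have "\<dots> \<le> n * (\<delta> * e * s n) / (e * (n * s n))"
      using TT(4)[of n] int_le t nonneg
      by (intro divide_right_mono mult_mono Bochner_Integration.integral_nonneg) auto
    also have "\<dots> = \<delta>"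
      using n \<open>e > 0\<close> s[OF n] by simp
    finally show "prob {\<omega> \<in> space M. e * (n * s n) < \<bar>\<Sum>i\<in>T' n. h n d (W i \<omega>)\<bar>} \<le> \<delta>" .
  qed
  then show ?thesis
    by (simp only: abs_sum)
qed

end

section \<open>The debiased estimator\<close>

text \<open>Of the two learners only their L2 rates \<open>a\<close> and \<open>c\<close> with a + c
  > 1/2 are retained, so that both regimes for the lasso end in the same argument. As before,
  \<alpha> is the projected representer.\<close>

locale debiased_crossfit = iid_sample M F W
  for M :: "'a measure" and F :: "'w measure" and W :: "nat \<Rightarrow> 'a \<Rightarrow> 'w" +
  fixes X :: "'w \<Rightarrow> 'x::euclidean_space" and Y :: "'w \<Rightarrow> real" and \<Gamma> :: "('x \<Rightarrow> real) set"
    and m :: "'w \<Rightarrow> ('x \<Rightarrow> real) \<Rightarrow> real" and \<alpha> \<gamma> :: "'x \<Rightarrow> real"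
    and b :: "nat \<Rightarrow> 'x \<Rightarrow> real" and p :: "nat \<Rightarrow> nat"
    and L :: nat and I :: "nat \<Rightarrow> nat \<Rightarrow> nat set"
    and learn :: "nat \<Rightarrow> nat \<Rightarrow> (nat \<Rightarrow> 'w) \<Rightarrow> 'x \<Rightarrow> real"
    and lasso :: "nat \<Rightarrow> nat \<Rightarrow> (nat \<Rightarrow> 'w) \<Rightarrow> real Matrix.vec"
    and C\<alpha> Cv Cb a c :: real
  assumes meas_X [measurable]: "X \<in> measurable F borel"
    and meas_Y [measurable]: "Y \<in> borel_measurable F"
    and Y_sq: "integrable F (\<lambda>w. (Y w)\<^sup>2)"
    and \<Gamma>: "closed_linear_subspace F X \<Gamma>"
    and \<alpha>_mem: "\<alpha> \<in> \<Gamma>" and \<gamma>_mem: "\<gamma> \<in> \<Gamma>" and b_mem: "\<And>j. b j \<in> \<Gamma>"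
    and m_int: "\<And>g. g \<in> \<Gamma> \<Longrightarrow> integrable F (\<lambda>w. m w g)"
    and m_riesz: "\<And>g. g \<in> \<Gamma> \<Longrightarrow> (\<integral>w. m w g \<partial>F) = (\<integral>w. \<alpha> (X w) * g (X w) \<partial>F)"
    and m_sq: "integrable F (\<lambda>w. (m w \<gamma>)\<^sup>2)"
    and orth: "\<And>g. g \<in> \<Gamma> \<Longrightarrow> (\<integral>w. (Y w - \<gamma> (X w)) * g (X w) \<partial>F) = 0"
    and \<alpha>_bound: "AE w in F. \<bar>\<alpha> (X w)\<bar> \<le> C\<alpha>"
    and b_bound: "AE w in F. \<forall>j. \<bar>b j (X w)\<bar> \<le> Cb" "Cb > 0"
    and cond_var: "AE w in F. real_cond_exp F (vimage_algebra (space F) X borel) (\<lambda>w. (Y w - \<gamma> (X w))\<^sup>2) w \<le> Cv"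
    and folds: "cross_fit_folds L I"
    and learn: "measurable_regression_learner F m I L learn"
    and lasso_meas: "measurable_coefficients F p I L lasso"
    and m_conv: "\<And>l. l < L \<Longrightarrow> tendsto_in_prob_0 M (\<lambda>n \<omega>.
       \<integral>\<^sup>+w. ennreal ((m w (gamma_hat W I learn n l \<omega>) - m w \<gamma>)\<^sup>2) \<partial>F)"
    and \<gamma>_hat_mem: "\<And>l. l < L \<Longrightarrow> whp M (\<lambda>n \<omega>. gamma_hat W I learn n l \<omega> \<in> \<Gamma>)"
    and \<gamma>_rate: "\<And>l. l < L \<Longrightarrow> whp M (\<lambda>n \<omega>.
       \<bar>L2_norm_of F (\<lambda>w. gamma_hat W I learn n l \<omega> (X w) - \<gamma> (X w))\<bar> \<le> real n powr (- c))"
    and \<alpha>_rate: "\<And>l. l < L \<Longrightarrow> whp M (\<lambda>n \<omega>.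
       (\<integral>w. (\<alpha> (X w) - dict_comb b (p n) (($) (rho_hat W I lasso n l \<omega>)) (X w))\<^sup>2 \<partial>F) \<le> (real n powr (- a))\<^sup>2)"
    and rates: "a > 0" "c > 0" "a + c > 1 / 2"
begin

sublocale F: prob_space F
  by (rule prob_space_F)

lemma \<Gamma>_meas: "g \<in> \<Gamma> \<Longrightarrow> g \<in> borel_measurable borel"
  and \<Gamma>_sq: "g \<in> \<Gamma> \<Longrightarrow> integrable F (\<lambda>w. (g (X w))\<^sup>2)"
  using \<Gamma> by (auto simp: closed_linear_subspace_def L2_fun_def)

lemma \<Gamma>_add: "g \<in> \<Gamma> \<Longrightarrow> h \<in> \<Gamma> \<Longrightarrow> (\<lambda>x. g x + h x) \<in> \<Gamma>"
  and \<Gamma>_scale: "g \<in> \<Gamma> \<Longrightarrow> (\<lambda>x. t * g x) \<in> \<Gamma>"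
  and \<Gamma>_zero: "(\<lambda>x. 0) \<in> \<Gamma>"
  using \<Gamma> by (auto simp: closed_linear_subspace_def)

lemma \<Gamma>_diff: "g \<in> \<Gamma> \<Longrightarrow> h \<in> \<Gamma> \<Longrightarrow> (\<lambda>x. g x - h x) \<in> \<Gamma>"
  using \<Gamma>_add[of g "\<lambda>x. (-1) * h x"] \<Gamma>_scale[of h "-1"] by simp

lemma \<Gamma>_dict: "dict_comb b q v \<in> \<Gamma>"
proof (induction q)
  case 0
  then show ?case using \<Gamma>_zero by (simp add: dict_comb_def)
next
  case (Suc q)
  then show ?case
    using \<Gamma>_add[OF Suc \<Gamma>_scale[OF b_mem[of q], of "v q"]] by (simp add: dict_comb_def)
qed

lemma \<alpha>_meas [measurable]: "\<alpha> \<in> borel_measurable borel"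
  and \<gamma>_meas [measurable]: "\<gamma> \<in> borel_measurable borel"
  and b_meas [measurable]: "b j \<in> borel_measurable borel"
  and dict_meas [measurable]: "dict_comb b q v \<in> borel_measurable borel"
  by (auto intro!: \<Gamma>_meas \<alpha>_mem \<gamma>_mem b_mem \<Gamma>_dict)

lemma m_meas: "g \<in> \<Gamma> \<Longrightarrow> (\<lambda>w. m w g) \<in> borel_measurable F"
  using m_int by blast

lemma res_sq: "integrable F (\<lambda>w. (Y w - \<gamma> (X w))\<^sup>2)"
  by (rule integrable_diff_square) (use Y_sq \<Gamma>_sq[OF \<gamma>_mem] in measurable)

lemma dict_bound: "AE w in F. \<bar>dict_comb b q v (X w)\<bar> \<le> (\<Sum>j<q. \<bar>v j\<bar>) * Cb"
  by (rule AE_dict_comb_bound) (rule b_bound(1))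

text \<open>For fixed \<open>g\<close> and \<open>f\<close> the errors \<open>t1\<close> and \<open>t2\<close> have mean zero, because \<open>\<alpha>\<close> and \<open>\<gamma>\<close> are
  projections on \<open>\<Gamma>\<close>; only the product \<open>t3\<close> is biased.\<close>

definition t1 :: "('x \<Rightarrow> real) \<Rightarrow> 'w \<Rightarrow> real" where
  "t1 g w = (m w g - m w \<gamma>) - \<alpha> (X w) * (g (X w) - \<gamma> (X w))"

definition t2 :: "('x \<Rightarrow> real) \<Rightarrow> 'w \<Rightarrow> real" where
  "t2 f w = (f (X w) - \<alpha> (X w)) * (Y w - \<gamma> (X w))"

definition t3 :: "('x \<Rightarrow> real) \<Rightarrow> ('x \<Rightarrow> real) \<Rightarrow> 'w \<Rightarrow> real" where
  "t3 g f w = (f (X w) - \<alpha> (X w)) * (g (X w) - \<gamma> (X w))"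

lemma debiased_moment_diff:
  "debiased_moment m X Y g f w - debiased_moment m X Y \<gamma> \<alpha> w = t1 g w + t2 f w - t3 g f w"
  by (simp add: debiased_moment_def t1_def t2_def t3_def algebra_simps)

lemma t1_mean: "g \<in> \<Gamma> \<Longrightarrow> (\<integral>w. t1 g w \<partial>F) = 0"
proof -
  assume g: "g \<in> \<Gamma>"
  note [measurable] = \<Gamma>_meas[OF g]
  have "integrable F (\<lambda>w. \<alpha> (X w) * g (X w))" "integrable F (\<lambda>w. \<alpha> (X w) * \<gamma> (X w))"
    by (intro integrable_mult_squares \<Gamma>_sq g \<alpha>_mem \<gamma>_mem; measurable)+
  then show ?thesis
    unfolding t1_def right_diff_distrib using m_int[OF g] m_int[OF \<gamma>_mem] m_riesz[OF g] m_riesz[OF \<gamma>_mem]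
    by simp
qed

text \<open>Stated with \<open>ennreal\<close> integrals, since m(w,g) need not be square integrable
  for a general g in \<Gamma>.\<close>

lemma t1_sq:
  assumes g: "g \<in> \<Gamma>"
  shows "(\<integral>\<^sup>+w. ennreal ((t1 g w)\<^sup>2) \<partial>F) \<le> 2 * (\<integral>\<^sup>+w. ennreal ((m w g - m w \<gamma>)\<^sup>2) \<partial>F)
    + ennreal (2 * C\<alpha>\<^sup>2 * (\<integral>w. (g (X w) - \<gamma> (X w))\<^sup>2 \<partial>F))"
proof -
  note [measurable] = \<Gamma>_meas[OF g] m_meas[OF g] m_meas[OF \<gamma>_mem]
  have int: "integrable F (\<lambda>w. 2 * C\<alpha>\<^sup>2 * (g (X w) - \<gamma> (X w))\<^sup>2)"
    using \<Gamma>_sq[OF \<Gamma>_diff[OF g \<gamma>_mem]] by simp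
  have "(\<integral>\<^sup>+w. ennreal ((t1 g w)\<^sup>2) \<partial>F)
      \<le> (\<integral>\<^sup>+w. 2 * ennreal ((m w g - m w \<gamma>)\<^sup>2) + ennreal (2 * C\<alpha>\<^sup>2 * (g (X w) - \<gamma> (X w))\<^sup>2) \<partial>F)"
  proof (rule nn_integral_mono_AE)
    show "AE w in F. ennreal ((t1 g w)\<^sup>2)
        \<le> 2 * ennreal ((m w g - m w \<gamma>)\<^sup>2) + ennreal (2 * C\<alpha>\<^sup>2 * (g (X w) - \<gamma> (X w))\<^sup>2)"
      using \<alpha>_bound
    proof eventually_elim
      case (elim w)
      have "(\<alpha> (X w))\<^sup>2 \<le> C\<alpha>\<^sup>2"
        using power_mono[OF elim abs_ge_zero, of 2] by simp
      then have "(\<alpha> (X w))\<^sup>2 * (g (X w) - \<gamma> (X w))\<^sup>2 \<le> C\<alpha>\<^sup>2 * (g (X w) - \<gamma> (X w))\<^sup>2"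
        by (intro mult_right_mono) auto
      moreover have "(x - y)\<^sup>2 \<le> 2 * x\<^sup>2 + 2 * y\<^sup>2" for x y :: real
        using zero_le_power2[of "x + y"] by (simp add: power2_eq_square algebra_simps)
      then have "(t1 g w)\<^sup>2 \<le> 2 * (m w g - m w \<gamma>)\<^sup>2 + 2 * (\<alpha> (X w) * (g (X w) - \<gamma> (X w)))\<^sup>2"
        unfolding t1_def .
      ultimately have "(t1 g w)\<^sup>2 \<le> 2 * (m w g - m w \<gamma>)\<^sup>2 + 2 * C\<alpha>\<^sup>2 * (g (X w) - \<gamma> (X w))\<^sup>2"
        unfolding power_mult_distrib by argo
      then have "ennreal ((t1 g w)\<^sup>2)
          \<le> ennreal (2 * (m w g - m w \<gamma>)\<^sup>2 + 2 * C\<alpha>\<^sup>2 * (g (X w) - \<gamma> (X w))\<^sup>2)"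
        by (rule ennreal_leI)
      then show ?case
        by (simp add: ennreal_plus ennreal_mult')
    qed
  qed
  also have "\<dots> = 2 * (\<integral>\<^sup>+w. ennreal ((m w g - m w \<gamma>)\<^sup>2) \<partial>F) + (\<integral>\<^sup>+w. ennreal (2 * C\<alpha>\<^sup>2 * (g (X w) - \<gamma> (X w))\<^sup>2) \<partial>F)"
    by (subst nn_integral_add) (auto simp: nn_integral_cmult)
  also have "(\<integral>\<^sup>+w. ennreal (2 * C\<alpha>\<^sup>2 * (g (X w) - \<gamma> (X w))\<^sup>2) \<partial>F) = ennreal (2 * C\<alpha>\<^sup>2 * (\<integral>w. (g (X w) - \<gamma> (X w))\<^sup>2 \<partial>F))"
    by (subst nn_integral_eq_integral[OF int]) auto
  finally show ?thesis .
qed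

lemma t2_mean: "(\<integral>w. t2 (dict_comb b q v) w \<partial>F) = 0"
  using orth[OF \<Gamma>_diff[OF \<Gamma>_dict \<alpha>_mem], of q v] by (simp add: t2_def mult.commute)

text \<open>Boundedness of the dictionary makes the product integrable for any coefficients, while
  the estimate involves only the conditional variance bound and the L2 error.\<close>

lemma t2_sq: "(\<integral>\<^sup>+w. ennreal ((t2 (dict_comb b q v) w)\<^sup>2) \<partial>F)
    \<le> ennreal (Cv * (\<integral>w. (\<alpha> (X w) - dict_comb b q v (X w))\<^sup>2 \<partial>F))"
proof -
  have bd: "AE w in F. \<bar>dict_comb b q v (X w) - \<alpha> (X w)\<bar> \<le> (\<Sum>j<q. \<bar>v j\<bar>) * Cb + C\<alpha>"
    using dict_bound[of q v] \<alpha>_bound by eventually_elim linarith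
  note * = integral_le_cond_exp_bound[OF prob_space_F meas_X _ _ res_sq _ cond_var bd]
  have int: "integrable F (\<lambda>w. (dict_comb b q v (X w) - \<alpha> (X w))\<^sup>2 * (Y w - \<gamma> (X w))\<^sup>2)"
    by (rule *(1)) auto
  have le: "(\<integral>w. (dict_comb b q v (X w) - \<alpha> (X w))\<^sup>2 * (Y w - \<gamma> (X w))\<^sup>2 \<partial>F)
      \<le> Cv * (\<integral>w. (dict_comb b q v (X w) - \<alpha> (X w))\<^sup>2 \<partial>F)"
    by (rule *(2)) auto
  have "(\<integral>\<^sup>+w. ennreal ((t2 (dict_comb b q v) w)\<^sup>2) \<partial>F)
      = ennreal (\<integral>w. (dict_comb b q v (X w) - \<alpha> (X w))\<^sup>2 * (Y w - \<gamma> (X w))\<^sup>2 \<partial>F)"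
    unfolding t2_def power_mult_distrib by (subst nn_integral_eq_integral[OF int]) auto
  also have "\<dots> \<le> ennreal (Cv * (\<integral>w. (\<alpha> (X w) - dict_comb b q v (X w))\<^sup>2 \<partial>F))"
    using le by (intro ennreal_leI) (simp add: power2_commute)
  finally show ?thesis .
qed

text \<open>Cauchy-Schwarz in the form of a weighted arithmetic-geometric mean inequality; the
  weight \<tau> is left free to balance two different rates.\<close>

lemma t3_abs:
  assumes g: "g \<in> \<Gamma>" and "\<tau> > 0"
  shows "(\<integral>\<^sup>+w. ennreal \<bar>t3 g (dict_comb b q v) w\<bar> \<partial>F)
    \<le> ennreal ((\<tau> * (\<integral>w. (\<alpha> (X w) - dict_comb b q v (X w))\<^sup>2 \<partial>F) + (\<integral>w. (g (X w) - \<gamma> (X w))\<^sup>2 \<partial>F) / \<tau>) / 2)"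
proof -
  have int1: "integrable F (\<lambda>w. (\<alpha> (X w) - dict_comb b q v (X w))\<^sup>2)"
    using \<Gamma>_sq[OF \<Gamma>_diff[OF \<alpha>_mem \<Gamma>_dict]] by simp
  have int2: "integrable F (\<lambda>w. (g (X w) - \<gamma> (X w))\<^sup>2)"
    using \<Gamma>_sq[OF \<Gamma>_diff[OF g \<gamma>_mem]] by simp
  have "(\<integral>\<^sup>+w. ennreal \<bar>t3 g (dict_comb b q v) w\<bar> \<partial>F)
      \<le> (\<integral>\<^sup>+w. ennreal ((\<tau> * (\<alpha> (X w) - dict_comb b q v (X w))\<^sup>2 + (g (X w) - \<gamma> (X w))\<^sup>2 / \<tau>) / 2) \<partial>F)"
  proof (intro nn_integral_mono ennreal_leI)
    fix w
    let ?x = "\<bar>\<alpha> (X w) - dict_comb b q v (X w)\<bar>" and ?y = "\<bar>g (X w) - \<gamma> (X w)\<bar>"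
    have "0 \<le> (sqrt \<tau> * ?x - ?y / sqrt \<tau>)\<^sup>2"
      by simp
    also have "\<dots> = \<tau> * ?x\<^sup>2 - 2 * (?x * ?y) + ?y\<^sup>2 / \<tau>"
      using \<open>\<tau> > 0\<close> by (simp add: power2_diff power_mult_distrib power_divide)
    finally have "?x * ?y \<le> (\<tau> * ?x\<^sup>2 + ?y\<^sup>2 / \<tau>) / 2"
      by argo
    moreover have "\<bar>t3 g (dict_comb b q v) w\<bar> = ?x * ?y"
      by (simp add: t3_def abs_mult abs_minus_commute)
    ultimately show "\<bar>t3 g (dict_comb b q v) w\<bar>
        \<le> (\<tau> * (\<alpha> (X w) - dict_comb b q v (X w))\<^sup>2 + (g (X w) - \<gamma> (X w))\<^sup>2 / \<tau>) / 2"
      by simp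
  qed
  also have "\<dots> = ennreal ((\<tau> * (\<integral>w. (\<alpha> (X w) - dict_comb b q v (X w))\<^sup>2 \<partial>F) + (\<integral>w. (g (X w) - \<gamma> (X w))\<^sup>2 \<partial>F) / \<tau>) / 2)"
    using int1 int2 \<open>\<tau> > 0\<close> by (subst nn_integral_eq_integral) auto
  finally show ?thesis .
qed

text \<open>The product of the two errors is not controlled in L2. The difference is therefore split
  so that the error of g is multiplied by the fitted function itself, which the l1 bound
  \<open>K\<close> keeps within \<open>K * Cb\<close>.\<close>

lemma debiased_moment_diff_sq:
  assumes g: "g \<in> \<Gamma>" and K: "(\<Sum>j<q. \<bar>v j\<bar>) \<le> K"
  shows "(\<integral>\<^sup>+w. ennreal ((debiased_moment m X Y g (dict_comb b q v) w - debiased_moment m X Y \<gamma> \<alpha> w)\<^sup>2) \<partial>F)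
    \<le> 3 * (\<integral>\<^sup>+w. ennreal ((m w g - m w \<gamma>)\<^sup>2) \<partial>F)
      + (3 * ennreal (Cv * (\<integral>w. (\<alpha> (X w) - dict_comb b q v (X w))\<^sup>2 \<partial>F))
        + ennreal (3 * (K * Cb)\<^sup>2 * (\<integral>w. (g (X w) - \<gamma> (X w))\<^sup>2 \<partial>F)))"
proof -
  note [measurable] = \<Gamma>_meas[OF g] m_meas[OF g] m_meas[OF \<gamma>_mem]
  let ?f = "dict_comb b q v"
  have [measurable]: "t2 ?f \<in> borel_measurable F"
    unfolding t2_def by measurable
  have int: "integrable F (\<lambda>w. 3 * (K * Cb)\<^sup>2 * (g (X w) - \<gamma> (X w))\<^sup>2)"
    using \<Gamma>_sq[OF \<Gamma>_diff[OF g \<gamma>_mem]] by simp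
  have "(\<integral>\<^sup>+w. ennreal ((debiased_moment m X Y g ?f w - debiased_moment m X Y \<gamma> \<alpha> w)\<^sup>2) \<partial>F)
    \<le> (\<integral>\<^sup>+w. 3 * ennreal ((m w g - m w \<gamma>)\<^sup>2) + (3 * ennreal ((t2 ?f w)\<^sup>2)
        + ennreal (3 * (K * Cb)\<^sup>2 * (g (X w) - \<gamma> (X w))\<^sup>2)) \<partial>F)"
  proof (rule nn_integral_mono_AE)
    show "AE w in F. ennreal ((debiased_moment m X Y g ?f w - debiased_moment m X Y \<gamma> \<alpha> w)\<^sup>2)
       \<le> 3 * ennreal ((m w g - m w \<gamma>)\<^sup>2) + (3 * ennreal ((t2 ?f w)\<^sup>2)
        + ennreal (3 * (K * Cb)\<^sup>2 * (g (X w) - \<gamma> (X w))\<^sup>2))"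
      using dict_bound[of q v]
    proof eventually_elim
      case (elim w)
      let ?y = "g (X w) - \<gamma> (X w)"
      have "(\<Sum>j<q. \<bar>v j\<bar>) * Cb \<le> K * Cb"
        using K b_bound(2) by (intro mult_right_mono) auto
      then have "\<bar>?f (X w)\<bar> \<le> K * Cb"
        using elim by linarith
      from power_mono[OF this abs_ge_zero, of 2] have "(?f (X w))\<^sup>2 * ?y\<^sup>2 \<le> (K * Cb)\<^sup>2 * ?y\<^sup>2"
        by (intro mult_right_mono) auto
      moreover have three: "(x + y - z)\<^sup>2 \<le> 3 * x\<^sup>2 + 3 * y\<^sup>2 + 3 * z\<^sup>2" for x y z :: real
        using zero_le_power2[of "x - y"] zero_le_power2[of "x + z"] zero_le_power2[of "y + z"]
        by (simp add: power2_eq_square algebra_simps)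
      have "debiased_moment m X Y g ?f w - debiased_moment m X Y \<gamma> \<alpha> w
          = (m w g - m w \<gamma>) + t2 ?f w - ?f (X w) * ?y"
        by (simp add: debiased_moment_def t2_def algebra_simps)
      then have "(debiased_moment m X Y g ?f w - debiased_moment m X Y \<gamma> \<alpha> w)\<^sup>2
          \<le> 3 * (m w g - m w \<gamma>)\<^sup>2 + 3 * (t2 ?f w)\<^sup>2 + 3 * (?f (X w) * ?y)\<^sup>2"
        using three by simp
      ultimately have "(debiased_moment m X Y g ?f w - debiased_moment m X Y \<gamma> \<alpha> w)\<^sup>2
          \<le> 3 * (m w g - m w \<gamma>)\<^sup>2 + (3 * (t2 ?f w)\<^sup>2 + 3 * (K * Cb)\<^sup>2 * ?y\<^sup>2)"
        unfolding power_mult_distrib[of "?f (X w)"] by argo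
      then have "ennreal ((debiased_moment m X Y g ?f w - debiased_moment m X Y \<gamma> \<alpha> w)\<^sup>2)
          \<le> ennreal (3 * (m w g - m w \<gamma>)\<^sup>2 + (3 * (t2 ?f w)\<^sup>2 + 3 * (K * Cb)\<^sup>2 * ?y\<^sup>2))"
        by (rule ennreal_leI)
      then show ?case
        by (simp add: ennreal_plus ennreal_mult')
    qed
  qed
  also have "\<dots> = 3 * (\<integral>\<^sup>+w. ennreal ((m w g - m w \<gamma>)\<^sup>2) \<partial>F) + (3 * (\<integral>\<^sup>+w. ennreal ((t2 ?f w)\<^sup>2) \<partial>F)
      + (\<integral>\<^sup>+w. ennreal (3 * (K * Cb)\<^sup>2 * (g (X w) - \<gamma> (X w))\<^sup>2) \<partial>F))"
    by (simp add: nn_integral_add nn_integral_cmult)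
  also have "(\<integral>\<^sup>+w. ennreal (3 * (K * Cb)\<^sup>2 * (g (X w) - \<gamma> (X w))\<^sup>2) \<partial>F)
      = ennreal (3 * (K * Cb)\<^sup>2 * (\<integral>w. (g (X w) - \<gamma> (X w))\<^sup>2 \<partial>F))"
    by (subst nn_integral_eq_integral[OF int]) auto
  also have "(\<integral>\<^sup>+w. ennreal ((t2 ?f w)\<^sup>2) \<partial>F) \<le> ennreal (Cv * (\<integral>w. (\<alpha> (X w) - ?f (X w))\<^sup>2 \<partial>F))"
    by (rule t2_sq)
  finally show ?thesis
    by (simp add: add_left_mono add_right_mono mult_left_mono)
qed

end

section \<open>Negligibility of the three error terms on each fold\<close>

context debiased_crossfit
begin

abbreviation P where "P n l \<equiv> PiM (out_fold I n l) (\<lambda>_. F)"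

abbreviation train where "train n l \<omega> \<equiv> \<lambda>i\<in>out_fold I n l. W i \<omega>"

abbreviation ah where "ah n l d \<equiv> dict_comb b (p n) (($) (lasso n l d))"

lemma fold_disjoint: "out_fold I n l \<inter> I n l = {}"
  and finite_out_fold: "finite (out_fold I n l)"
  by (auto simp: out_fold_def)

lemma fold_subset: "l < L \<Longrightarrow> I n l \<subseteq> {..<n}"
  using folds by (auto simp: cross_fit_folds_def)

lemma finite_fold: "l < L \<Longrightarrow> finite (I n l)"
  using fold_subset finite_subset by blast

lemma card_fold_le: "l < L \<Longrightarrow> card (I n l) \<le> n"
  using card_mono[OF _ fold_subset] by fastforce

lemma sum_folds: "(\<Sum>i<n. f i) = (\<Sum>l<L. \<Sum>i\<in>I n l. f i)" for f :: "nat \<Rightarrow> real"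
proof -
  have "(\<Union>l<L. I n l) = {..<n}" "disjoint_family_on (I n) {..<L}"
    using folds by (auto simp: cross_fit_folds_def)
  then show ?thesis
    using sum.UNION_disjoint_family[of "{..<L}" "I n" f] finite_fold by auto
qed

lemma train_eq: "train_sample W I n l \<omega> = train n l \<omega>"
  by (simp add: train_sample_def)

lemma gamma_hat_eq: "gamma_hat W I learn n l \<omega> = learn n l (train n l \<omega>)"
  by (simp add: gamma_hat_def train_eq)

lemma alpha_hat_eq:
  assumes "n > 0" "l < L"
  shows "alpha_hat b p W I lasso n l \<omega> = ah n l (train n l \<omega>)"
  using assms lasso_meas
  by (auto simp: alpha_hat_def rho_hat_def train_eq measurable_coefficients_def dict_vec_scalar_prod fun_eq_iff)

lemma train_meas [measurable]: "(\<lambda>\<omega>. train n l \<omega>) \<in> measurable M (P n l)"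
  by (auto intro!: measurable_restrict)

lemma learn_meas:
  assumes "n > 0" "l < L"
  shows "(\<lambda>(d, w). learn n l d (X w)) \<in> borel_measurable (P n l \<Otimes>\<^sub>M F)"
    and "(\<lambda>(d, w). m w (learn n l d)) \<in> borel_measurable (P n l \<Otimes>\<^sub>M F)"
proof -
  have 1: "(\<lambda>(d, x). learn n l d x) \<in> borel_measurable (P n l \<Otimes>\<^sub>M borel)"
    and 2: "(\<lambda>(d, w). m w (learn n l d)) \<in> borel_measurable (P n l \<Otimes>\<^sub>M F)"
    using learn assms by (auto simp: measurable_regression_learner_def)
  have "(\<lambda>z. (fst z, X (snd z))) \<in> measurable (P n l \<Otimes>\<^sub>M F) (P n l \<Otimes>\<^sub>M borel)"
    by measurable
  from measurable_compose[OF this 1] show "(\<lambda>(d, w). learn n l d (X w)) \<in> borel_measurable (P n l \<Otimes>\<^sub>M F)"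
    by (simp add: case_prod_beta)
  show "(\<lambda>(d, w). m w (learn n l d)) \<in> borel_measurable (P n l \<Otimes>\<^sub>M F)"
    by (rule 2)
qed

lemma ah_meas:
  assumes "n > 0" "l < L"
  shows "(\<lambda>(d, w). ah n l d (X w)) \<in> borel_measurable (P n l \<Otimes>\<^sub>M F)"
proof -
  have coef: "(\<lambda>d. lasso n l d $ j) \<in> borel_measurable (P n l)" if "j < p n" for j
    using lasso_meas assms that by (auto simp: measurable_coefficients_def)
  have "(\<lambda>z. lasso n l (fst z) $ j * b j (X (snd z))) \<in> borel_measurable (P n l \<Otimes>\<^sub>M F)" if "j < p n" for j
  proof (rule borel_measurable_times)
    show "(\<lambda>z. lasso n l (fst z) $ j) \<in> borel_measurable (P n l \<Otimes>\<^sub>M F)"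
      by (rule measurable_compose[OF measurable_fst coef[OF that]])
  qed measurable
  then show ?thesis
    unfolding dict_comb_def case_prod_beta by (intro borel_measurable_sum) auto
qed

lemma gamma_m_meas: "(\<lambda>w. m w \<gamma>) \<in> borel_measurable F"
  by (rule m_meas[OF \<gamma>_mem])

lemma t_meas:
  assumes "n > 0" "l < L"
  shows "(\<lambda>(d, w). t1 (learn n l d) w) \<in> borel_measurable (P n l \<Otimes>\<^sub>M F)"
    and "(\<lambda>(d, w). t2 (ah n l d) w) \<in> borel_measurable (P n l \<Otimes>\<^sub>M F)"
    and "(\<lambda>(d, w). \<bar>t3 (learn n l d) (ah n l d) w\<bar>) \<in> borel_measurable (P n l \<Otimes>\<^sub>M F)"
    and "(\<lambda>(d, w). debiased_moment m X Y (learn n l d) (ah n l d) w) \<in> borel_measurable (P n l \<Otimes>\<^sub>M F)"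
proof -
  note [measurable] = learn_meas[OF assms, unfolded case_prod_beta] ah_meas[OF assms, unfolded case_prod_beta]
    gamma_m_meas
  show "(\<lambda>(d, w). t1 (learn n l d) w) \<in> borel_measurable (P n l \<Otimes>\<^sub>M F)"
    unfolding t1_def case_prod_beta by measurable
  show "(\<lambda>(d, w). t2 (ah n l d) w) \<in> borel_measurable (P n l \<Otimes>\<^sub>M F)"
    unfolding t2_def case_prod_beta by measurable
  show "(\<lambda>(d, w). \<bar>t3 (learn n l d) (ah n l d) w\<bar>) \<in> borel_measurable (P n l \<Otimes>\<^sub>M F)"
    unfolding t3_def case_prod_beta by measurable
  show "(\<lambda>(d, w). debiased_moment m X Y (learn n l d) (ah n l d) w) \<in> borel_measurable (P n l \<Otimes>\<^sub>M F)"
    unfolding debiased_moment_def case_prod_beta by measurable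
qed

lemma debiased_meas [measurable]: "debiased_moment m X Y \<gamma> \<alpha> \<in> borel_measurable F"
  using gamma_m_meas unfolding debiased_moment_def by measurable

lemma whp_gamma:
  assumes "l < L"
  shows "whp M (\<lambda>n \<omega>. learn n l (train n l \<omega>) \<in> \<Gamma> \<and>
    (\<integral>w. (learn n l (train n l \<omega>) (X w) - \<gamma> (X w))\<^sup>2 \<partial>F) \<le> (real n powr (- c))\<^sup>2)"
  using whp_conj[OF \<gamma>_hat_mem[OF assms] \<gamma>_rate[OF assms]]
  by (rule whp_mono') (auto simp: gamma_hat_eq L2_norm_of_def intro!: sqrt_le_D)

lemma whp_alpha:
  assumes "l < L"
  shows "whp M (\<lambda>n \<omega>. (\<integral>w. (\<alpha> (X w) - ah n l (train n l \<omega>) (X w))\<^sup>2 \<partial>F) \<le> (real n powr (- a))\<^sup>2)"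
  using \<alpha>_rate[OF assms] by (simp add: rho_hat_def train_eq)

lemma whp_m:
  assumes "l < L" "v > 0"
  shows "whp M (\<lambda>n \<omega>. (\<integral>\<^sup>+w. ennreal ((m w (learn n l (train n l \<omega>)) - m w \<gamma>)\<^sup>2) \<partial>F) \<le> ennreal v)"
proof -
  have "whp M (\<lambda>n \<omega>. (\<integral>\<^sup>+w. ennreal ((m w (gamma_hat W I learn n l \<omega>) - m w \<gamma>)\<^sup>2) \<partial>F) \<le> ennreal v)"
  proof (rule whp_of_tendsto_in_prob_0[OF m_conv[OF assms(1)] _ assms(2)])
    fix n :: nat assume "n > 0"
    note [measurable] = learn_meas(2)[OF this assms(1), unfolded case_prod_beta] gamma_m_meas
    have "(\<lambda>d. \<integral>\<^sup>+w. ennreal ((m w (learn n l d) - m w \<gamma>)\<^sup>2) \<partial>F) \<in> borel_measurable (P n l)"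
      by measurable
    from measurable_compose[OF train_meas this]
    show "(\<lambda>\<omega>. \<integral>\<^sup>+w. ennreal ((m w (gamma_hat W I learn n l \<omega>) - m w \<gamma>)\<^sup>2) \<partial>F) \<in> borel_measurable M"
      by (simp add: gamma_hat_eq)
  qed
  then show ?thesis
    by (simp add: gamma_hat_eq)
qed

lemma powr_small:
  assumes "x > 0" "v > 0"
  shows "\<forall>\<^sub>F n in sequentially. K * (real n powr (- x))\<^sup>2 \<le> v"
proof -
  have "(\<lambda>n. real n powr (- x)) \<longlonglongrightarrow> 0"
    using assms(1) by (intro tendsto_neg_powr filterlim_real_sequentially) auto
  then have "(\<lambda>n. K * (real n powr (- x))\<^sup>2) \<longlonglongrightarrow> K * 0\<^sup>2"
    by (intro tendsto_intros)
  then have "\<forall>\<^sub>F n in sequentially. K * (real n powr (- x))\<^sup>2 < v"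
    using assms(2) by (intro order_tendstoD(2)) auto
  then show ?thesis
    by eventually_elim simp
qed

text \<open>Consistency of the regression learner, in its values and through \<open>m\<close>, is
  enough here; its rate plays its part in \<open>whp_t3\<close>.\<close>

lemma whp_t1:
  assumes l: "l < L" and "e > 0"
  shows "whp M (\<lambda>n \<omega>. \<bar>\<Sum>i\<in>I n l. t1 (learn n l (train n l \<omega>)) (W i \<omega>)\<bar> \<le> e * sqrt (real n))"
proof (rule whp_fold_sum_L2[where T = "\<lambda>n. out_fold I n l" and T' = "\<lambda>n. I n l" and h = "\<lambda>n d. t1 (learn n l d)"])
  fix v :: real assume v: "v > 0"
  then have v4: "v / 4 > 0" and v2: "v / 2 > 0"
    by auto
  have ev: "\<forall>\<^sub>F n in sequentially. 2 * C\<alpha>\<^sup>2 * (real n powr (- c))\<^sup>2 \<le> v / 2"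
    by (rule powr_small[OF rates(2) v2])
  show "whp M (\<lambda>n \<omega>. (\<integral>\<^sup>+w. ennreal ((t1 (learn n l (train n l \<omega>)) w)\<^sup>2) \<partial>F) \<le> ennreal v \<and>
      (\<integral>w. t1 (learn n l (train n l \<omega>)) w \<partial>F) = 0)"
    using whp_conj[OF whp_gamma[OF l] whp_m[OF l v4]]
  proof (rule whp_mono_ev[OF _ ev], elim conjE)
    fix n \<omega>
    let ?g = "learn n l (train n l \<omega>)"
    assume small: "2 * C\<alpha>\<^sup>2 * (real n powr (- c))\<^sup>2 \<le> v / 2" and g: "?g \<in> \<Gamma>"
      and g_le: "(\<integral>w. (?g (X w) - \<gamma> (X w))\<^sup>2 \<partial>F) \<le> (real n powr (- c))\<^sup>2"
      and m_le: "(\<integral>\<^sup>+w. ennreal ((m w ?g - m w \<gamma>)\<^sup>2) \<partial>F) \<le> ennreal (v / 4)"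
    have "2 * C\<alpha>\<^sup>2 * (\<integral>w. (?g (X w) - \<gamma> (X w))\<^sup>2 \<partial>F) \<le> 2 * C\<alpha>\<^sup>2 * (real n powr (- c))\<^sup>2"
      using g_le by (intro mult_left_mono) auto
    then have "2 * C\<alpha>\<^sup>2 * (\<integral>w. (?g (X w) - \<gamma> (X w))\<^sup>2 \<partial>F) \<le> v / 2"
      using small by linarith
    then have "(\<integral>\<^sup>+w. ennreal ((t1 ?g w)\<^sup>2) \<partial>F) \<le> 2 * ennreal (v / 4) + ennreal (v / 2)"
      using m_le by (intro order_trans[OF t1_sq[OF g]] add_mono mult_left_mono ennreal_leI) auto
    also have "2 * ennreal (v / 4) = ennreal (2 * (v / 4))"
      using v by (subst ennreal_mult') auto
    also have "ennreal (2 * (v / 4)) + ennreal (v / 2) = ennreal v"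
      using v by (simp flip: ennreal_plus)
    finally have "(\<integral>\<^sup>+w. ennreal ((t1 ?g w)\<^sup>2) \<partial>F) \<le> ennreal v" .
    then show "(\<integral>\<^sup>+w. ennreal ((t1 ?g w)\<^sup>2) \<partial>F) \<le> ennreal v \<and> (\<integral>w. t1 ?g w \<partial>F) = 0"
      using t1_mean[OF g] by (rule conjI)
  qed
qed (use assms fold_disjoint finite_out_fold finite_fold card_fold_le t_meas in auto)

lemma whp_t2_small:
  assumes l: "l < L" and v: "v > 0"
  shows "whp M (\<lambda>n \<omega>. Cv * (\<integral>w. (\<alpha> (X w) - ah n l (train n l \<omega>) (X w))\<^sup>2 \<partial>F) \<le> v)"
  using whp_alpha[OF l]
\<comment> \<open>The upper bound \<open>Cv\<close> carries no sign assumption, hence the absolute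
  value.\<close>
proof (rule whp_mono_ev[OF _ powr_small[OF rates(1) v, of "\<bar>Cv\<bar>"]])
  fix n \<omega>
  let ?D = "\<integral>w. (\<alpha> (X w) - ah n l (train n l \<omega>) (X w))\<^sup>2 \<partial>F"
  assume small: "\<bar>Cv\<bar> * (real n powr (- a))\<^sup>2 \<le> v" and le: "?D \<le> (real n powr (- a))\<^sup>2"
  have "Cv * ?D \<le> \<bar>Cv\<bar> * ?D"
    by (intro mult_right_mono) auto
  also have "\<dots> \<le> \<bar>Cv\<bar> * (real n powr (- a))\<^sup>2"
    using le by (intro mult_left_mono) auto
  finally show "Cv * ?D \<le> v"
    using small by linarith
qed

lemma whp_t2:
  assumes l: "l < L" and "e > 0"
  shows "whp M (\<lambda>n \<omega>. \<bar>\<Sum>i\<in>I n l. t2 (ah n l (train n l \<omega>)) (W i \<omega>)\<bar> \<le> e * sqrt (real n))"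
proof (rule whp_fold_sum_L2[where T = "\<lambda>n. out_fold I n l" and T' = "\<lambda>n. I n l" and h = "\<lambda>n d. t2 (ah n l d)"])
  fix v :: real assume v: "v > 0"
  show "whp M (\<lambda>n \<omega>. (\<integral>\<^sup>+w. ennreal ((t2 (ah n l (train n l \<omega>)) w)\<^sup>2) \<partial>F) \<le> ennreal v \<and>
      (\<integral>w. t2 (ah n l (train n l \<omega>)) w \<partial>F) = 0)"
    using whp_t2_small[OF l v]
    by (rule whp_mono') (auto simp: t2_mean intro!: order_trans[OF t2_sq] ennreal_leI)
qed (use assms fold_disjoint finite_out_fold finite_fold card_fold_le t_meas in auto)

text \<open>The only term with a nonvanishing mean, bounded in L1; a + c > 1/2 makes its size
  o(1/sqrt n) per observation.\<close>

lemma whp_t3: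
  assumes l: "l < L" and "e > 0"
  shows "whp M (\<lambda>n \<omega>. (\<Sum>i\<in>I n l. \<bar>t3 (learn n l (train n l \<omega>)) (ah n l (train n l \<omega>)) (W i \<omega>)\<bar>)
    \<le> e * (real n * (1 / sqrt (real n))))"
proof (rule whp_fold_sum_L1[where T = "\<lambda>n. out_fold I n l" and T' = "\<lambda>n. I n l" and 
      h = "\<lambda>n d w. \<bar>t3 (learn n l d) (ah n l d) w\<bar>" and s = "\<lambda>n. 1 / sqrt (real n)"])
  fix v :: real assume v: "v > 0"
  have "(\<lambda>n. real n powr (- (a + c - 1 / 2))) \<longlonglongrightarrow> 0"
    using rates(3) by (intro tendsto_neg_powr filterlim_real_sequentially) auto
  then have ev: "\<forall>\<^sub>F n in sequentially. real n powr (- (a + c - 1 / 2)) < v"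
    using v by (rule order_tendstoD(2))
  show "whp M (\<lambda>n \<omega>. (\<integral>\<^sup>+w. ennreal \<bar>t3 (learn n l (train n l \<omega>)) (ah n l (train n l \<omega>)) w\<bar> \<partial>F)
      \<le> ennreal (v * (1 / sqrt (real n))))"
    using whp_conj[OF whp_gamma[OF l] whp_alpha[OF l]]
  proof (rule whp_mono_ev[OF _ eventually_conj[OF ev eventually_gt_at_top[of 0]]], elim conjE)
    fix n :: nat and \<omega>
    let ?g = "learn n l (train n l \<omega>)" and ?f = "ah n l (train n l \<omega>)"
    let ?A = "\<integral>w. (\<alpha> (X w) - ?f (X w))\<^sup>2 \<partial>F" and ?G = "\<integral>w. (?g (X w) - \<gamma> (X w))\<^sup>2 \<partial>F"
    assume small: "real n powr (- (a + c - 1 / 2)) < v" and n: "n > 0" and g: "?g \<in> \<Gamma>"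
      and g_le: "?G \<le> (real n powr (- c))\<^sup>2" and a_le: "?A \<le> (real n powr (- a))\<^sup>2"
    \<comment> \<open>Balances the two halves: \<tau> n^(-2a) and n^(-2c)/\<tau> both equal
      n^(-a-c).\<close>
    define \<tau> where "\<tau> = real n powr (a - c)"
    have \<tau>: "\<tau> > 0"
      using n by (simp add: \<tau>_def)
    have "\<tau> * ?A + ?G / \<tau> \<le> \<tau> * (real n powr (- a))\<^sup>2 + (real n powr (- c))\<^sup>2 / \<tau>"
      using a_le g_le \<tau> by (intro add_mono mult_left_mono divide_right_mono) auto
    also have "\<tau> * (real n powr (- a))\<^sup>2 = real n powr (- a - c)"
      using n by (simp add: \<tau>_def powr_power powr_add[symmetric])
    also have "(real n powr (- c))\<^sup>2 / \<tau> = real n powr (- a - c)"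
    proof -
      have "(real n powr (- c))\<^sup>2 / \<tau> = real n powr (- c - a)"
        using n by (simp add: \<tau>_def powr_power powr_diff[symmetric])
      then show ?thesis
        by (simp only: minus_diff_commute[of c a])
    qed
    finally have sum_le: "\<tau> * ?A + ?G / \<tau> \<le> real n powr (- a - c) + real n powr (- a - c)" .
    have "x / 2 \<le> y" if "x \<le> y + y" for x y :: real
      using that by simp
    from this[OF sum_le] have "(\<tau> * ?A + ?G / \<tau>) / 2 \<le> real n powr (- a - c)" .
    also have "\<dots> = real n powr (- (a + c - 1 / 2)) * real n powr (- (1 / 2))"
      using n by (simp add: powr_add[symmetric])
    also have "real n powr (- (1 / 2)) = 1 / sqrt (real n)"
      using n by (simp add: powr_minus_divide powr_half_sqrt)
    also have "real n powr (- (a + c - 1 / 2)) * (1 / sqrt (real n)) \<le> v * (1 / sqrt (real n))"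
      using small by (intro mult_right_mono) auto
    finally show "(\<integral>\<^sup>+w. ennreal \<bar>t3 ?g ?f w\<bar> \<partial>F) \<le> ennreal (v * (1 / sqrt (real n)))"
      by (intro order_trans[OF t3_abs[OF g \<tau>]] ennreal_leI)
  qed
qed (use assms fold_disjoint finite_out_fold finite_fold card_fold_le t_meas in auto)

abbreviation score_hat where
  "score_hat n l \<omega> \<equiv> debiased_moment m X Y (gamma_hat W I learn n l \<omega>) (alpha_hat b p W I lasso n l \<omega>)"

abbreviation score where "score \<equiv> debiased_moment m X Y \<gamma> \<alpha>"

lemma whp_fold_diff:
  assumes l: "l < L" and "e > 0"
  shows "whp M (\<lambda>n \<omega>. \<bar>\<Sum>i\<in>I n l. score_hat n l \<omega> (W i \<omega>) - score (W i \<omega>)\<bar> \<le> e * sqrt (real n))"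
proof -
  have e3: "e / 3 > 0"
    using \<open>e > 0\<close> by simp
  show ?thesis
    using whp_conj[OF whp_conj[OF whp_t1[OF l e3] whp_t2[OF l e3]] whp_t3[OF l e3]]
  proof (rule whp_mono_ev[OF _ eventually_gt_at_top[of 0]], elim conjE)
    fix n :: nat and \<omega>
    let ?g = "learn n l (train n l \<omega>)" and ?f = "ah n l (train n l \<omega>)"
    assume n: "n > 0"
      and 1: "\<bar>\<Sum>i\<in>I n l. t1 ?g (W i \<omega>)\<bar> \<le> e / 3 * sqrt (real n)"
      and 2: "\<bar>\<Sum>i\<in>I n l. t2 ?f (W i \<omega>)\<bar> \<le> e / 3 * sqrt (real n)"
      and 3: "(\<Sum>i\<in>I n l. \<bar>t3 ?g ?f (W i \<omega>)\<bar>) \<le> e / 3 * (real n * (1 / sqrt (real n)))"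
    have "(\<Sum>i\<in>I n l. score_hat n l \<omega> (W i \<omega>) - score (W i \<omega>))
        = (\<Sum>i\<in>I n l. t1 ?g (W i \<omega>)) + (\<Sum>i\<in>I n l. t2 ?f (W i \<omega>)) - (\<Sum>i\<in>I n l. t3 ?g ?f (W i \<omega>))"
      by (simp add: gamma_hat_eq alpha_hat_eq[OF n l] debiased_moment_diff sum.distrib sum_subtractf)
    moreover have "\<bar>\<Sum>i\<in>I n l. t3 ?g ?f (W i \<omega>)\<bar> \<le> e / 3 * sqrt (real n)"
      using order_trans[OF sum_abs 3] by (simp add: real_div_sqrt)
    ultimately show "\<bar>\<Sum>i\<in>I n l. score_hat n l \<omega> (W i \<omega>) - score (W i \<omega>)\<bar> \<le> e * sqrt (real n)"
      using 1 2 by argo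
  qed
qed

section \<open>Expansion of the estimator and its limit law\<close>

abbreviation theta_h where
  "theta_h \<equiv> theta_hat m X Y W L I (gamma_hat W I learn) (alpha_hat b p W I lasso)"

abbreviation psi where "psi w \<equiv> score w - theta_bar F m \<gamma>"

lemma psi_sq: "integrable F (\<lambda>w. (psi w)\<^sup>2)"
proof -
  note [measurable] = gamma_m_meas
  have "integrable F (\<lambda>w. (\<alpha> (X w) * (Y w - \<gamma> (X w)))\<^sup>2)"
  proof (rule Bochner_Integration.integrable_bound)
    show "integrable F (\<lambda>w. C\<alpha>\<^sup>2 * (Y w - \<gamma> (X w))\<^sup>2)"
      using res_sq by simp
    show "AE w in F. norm ((\<alpha> (X w) * (Y w - \<gamma> (X w)))\<^sup>2) \<le> norm (C\<alpha>\<^sup>2 * (Y w - \<gamma> (X w))\<^sup>2)"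
      using \<alpha>_bound
    proof eventually_elim
      case (elim w)
      from power_mono[OF this abs_ge_zero, of 2] show ?case
        by (simp add: power_mult_distrib mult_right_mono)
    qed
  qed measurable
  then have "integrable F (\<lambda>w. (m w \<gamma> + \<alpha> (X w) * (Y w - \<gamma> (X w)))\<^sup>2)"
    using m_sq by (intro integrable_add_square) auto
  then have "integrable F (\<lambda>w. (score w)\<^sup>2)"
    by (simp add: debiased_moment_def)
  then show ?thesis
    by (intro integrable_diff_square) auto
qed

lemma psi_mean: "(\<integral>w. psi w \<partial>F) = 0"
proof -
  have "integrable F (\<lambda>w. (Y w - \<gamma> (X w)) * \<alpha> (X w))"
    by (intro integrable_mult_squares res_sq \<Gamma>_sq \<alpha>_mem) measurable
  then show ?thesis
    using m_int[OF \<gamma>_mem] orth[OF \<alpha>_mem]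
    by (simp add: debiased_moment_def theta_bar_def F.prob_space mult.commute)
qed

lemma psi_var: "(\<integral>w. (psi w)\<^sup>2 \<partial>F) = asym_var F m X Y \<gamma> \<alpha>"
  by (simp add: asym_var_def)

lemma theta_expansion:
  assumes "n > 0"
  shows "theta_h n \<omega> - theta_bar F m \<gamma>
    = (\<Sum>i<n. psi (W i \<omega>)) / n + (\<Sum>l<L. \<Sum>i\<in>I n l. score_hat n l \<omega> (W i \<omega>) - score (W i \<omega>)) / n"
proof -
  have "(\<Sum>i<n. psi (W i \<omega>)) + (\<Sum>l<L. \<Sum>i\<in>I n l. score_hat n l \<omega> (W i \<omega>) - score (W i \<omega>))
      = (\<Sum>l<L. \<Sum>i\<in>I n l. score_hat n l \<omega> (W i \<omega>)) - n * theta_bar F m \<gamma>"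
    using sum_folds[of "\<lambda>i. score (W i \<omega>)" n] by (simp add: sum_subtractf)
  then have "theta_h n \<omega> - theta_bar F m \<gamma>
      = ((\<Sum>i<n. psi (W i \<omega>)) + (\<Sum>l<L. \<Sum>i\<in>I n l. score_hat n l \<omega> (W i \<omega>) - score (W i \<omega>))) / n"
    using assms by (simp add: theta_hat_def diff_divide_distrib)
  then show ?thesis
    by (simp add: add_divide_distrib)
qed

lemma whp_total_diff:
  assumes "e > 0" "L > 0"
  shows "whp M (\<lambda>n \<omega>. \<bar>\<Sum>l<L. \<Sum>i\<in>I n l. score_hat n l \<omega> (W i \<omega>) - score (W i \<omega>)\<bar> \<le> e * sqrt (real n))"
proof -
  have eL: "e / L > 0"
    using assms by simp
  have "whp M (\<lambda>n \<omega>. \<forall>l<L. \<bar>\<Sum>i\<in>I n l. score_hat n l \<omega> (W i \<omega>) - score (W i \<omega>)\<bar> \<le> e / L * sqrt (real n))"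
    by (intro whp_all_less whp_fold_diff eL)
  then show ?thesis
  proof (rule whp_mono')
    fix n \<omega>
    assume *: "\<forall>l<L. \<bar>\<Sum>i\<in>I n l. score_hat n l \<omega> (W i \<omega>) - score (W i \<omega>)\<bar> \<le> e / L * sqrt (real n)"
    have "\<bar>\<Sum>l<L. \<Sum>i\<in>I n l. score_hat n l \<omega> (W i \<omega>) - score (W i \<omega>)\<bar>
        \<le> (\<Sum>l<L. \<bar>\<Sum>i\<in>I n l. score_hat n l \<omega> (W i \<omega>) - score (W i \<omega>)\<bar>)"
      by (rule sum_abs)
    also have "\<dots> \<le> (\<Sum>l<L. e / L * sqrt (real n))"
      using * by (intro sum_mono) auto
    also have "\<dots> = e * sqrt (real n)"
      using \<open>L > 0\<close> by simp
    finally show "\<bar>\<Sum>l<L. \<Sum>i\<in>I n l. score_hat n l \<omega> (W i \<omega>) - score (W i \<omega>)\<bar> \<le> e * sqrt (real n)" .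
  qed
qed

lemma theta_h_meas:
  assumes "n > 0"
  shows "theta_h n \<in> borel_measurable M"
proof -
  have "(\<lambda>\<omega>. score_hat n l \<omega> (W i \<omega>)) \<in> borel_measurable M" if "l < L" for l i
  proof -
    have "(\<lambda>\<omega>. (train n l \<omega>, W i \<omega>)) \<in> measurable M (P n l \<Otimes>\<^sub>M F)"
      by measurable
    from measurable_compose[OF this t_meas(4)[OF assms that]] show ?thesis
      by (simp add: gamma_hat_eq alpha_hat_eq[OF assms that])
  qed
  then show ?thesis
    unfolding theta_hat_def by (intro borel_measurable_divide borel_measurable_sum) auto
qed

theorem asymptotic_normality:
  assumes "L > 0"
  shows "tendsto_in_dist M (\<lambda>n \<omega>. sqrt (real n) * (theta_h n \<omega> - theta_bar F m \<gamma>))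
    (normal_law 0 (asym_var F m X Y \<gamma> \<alpha>))"
  unfolding tendsto_in_dist_def
proof (rule Slutsky)
  show "weak_conv_m (\<lambda>n. distr M borel (\<lambda>\<omega>. (\<Sum>i<n. psi (W i \<omega>)) / sqrt n)) (normal_law 0 (asym_var F m X Y \<gamma> \<alpha>))"
    using clt_normal_law[OF _ psi_sq psi_mean] unfolding psi_var by simp
  show "(\<lambda>\<omega>. (\<Sum>i<n. psi (W i \<omega>)) / sqrt n) \<in> borel_measurable M" for n :: nat
    by measurable
  show "(\<lambda>\<omega>. sqrt (real n) * (theta_h n \<omega> - theta_bar F m \<gamma>)) \<in> borel_measurable M" if "n > 0" for n
    using theta_h_meas[OF that] by measurable
  show "whp M (\<lambda>n \<omega>. \<bar>sqrt (real n) * (theta_h n \<omega> - theta_bar F m \<gamma>) - (\<Sum>i<n. psi (W i \<omega>)) / sqrt n\<bar> \<le> e)"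
    if "e > 0" for e
    using whp_total_diff[OF that \<open>L > 0\<close>]
  proof (rule whp_mono_ev[OF _ eventually_gt_at_top[of 0]])
    fix n :: nat and \<omega>
    let ?R = "\<Sum>l<L. \<Sum>i\<in>I n l. score_hat n l \<omega> (W i \<omega>) - score (W i \<omega>)"
    assume n: "n > 0" and R: "\<bar>?R\<bar> \<le> e * sqrt (real n)"
    have div: "sqrt (real n) * (x / n) = x / sqrt n" for x
      using real_div_sqrt[of "real n"] n by (simp add: field_simps)
    have "sqrt (real n) * (theta_h n \<omega> - theta_bar F m \<gamma>) - (\<Sum>i<n. psi (W i \<omega>)) / sqrt n = ?R / sqrt n"
      unfolding theta_expansion[OF n] distrib_left div by simp
    then show "\<bar>sqrt (real n) * (theta_h n \<omega> - theta_bar F m \<gamma>) - (\<Sum>i<n. psi (W i \<omega>)) / sqrt n\<bar> \<le> e"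
      using R n by (simp add: pos_divide_le_eq)
  qed
  have var: "0 \<le> asym_var F m X Y \<gamma> \<alpha>"
    by (simp add: asym_var_def)
  \<comment> \<open>The radius \<bar>x\<bar> keeps y away from the possible jump at 0. If x = 0 is a
    continuity point, the variance is nonzero and any radius will do.\<close>
  show "\<exists>d>0. \<forall>y. \<bar>y - x\<bar> < d \<longrightarrow> isCont (cdf (normal_law 0 (asym_var F m X Y \<gamma> \<alpha>))) y"
    if "isCont (cdf (normal_law 0 (asym_var F m X Y \<gamma> \<alpha>))) x" for x
    using that unfolding isCont_cdf_normal_law_iff[OF var]
    by (intro exI[of _ "if x = 0 then 1 else \<bar>x\<bar>"]) auto
qed

section \<open>Consistency of the variance estimator\<close>

lemma whp_score_diff_sq:
  assumes l: "l < L" and "e > 0"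
    and bounded: "whp M (\<lambda>n \<omega>. (\<Sum>j<p n. \<bar>rho_hat W I lasso n l \<omega> $ j\<bar>) \<le> K)"
  shows "whp M (\<lambda>n \<omega>. (\<Sum>i\<in>I n l. (score_hat n l \<omega> (W i \<omega>) - score (W i \<omega>))\<^sup>2) \<le> e * (real n * 1))"
proof -
  let ?h = "\<lambda>n d w. (debiased_moment m X Y (learn n l d) (ah n l d) w - score w)\<^sup>2"
  have "whp M (\<lambda>n \<omega>. (\<Sum>i\<in>I n l. ?h n (train n l \<omega>) (W i \<omega>)) \<le> e * (real n * 1))"
  proof (rule whp_fold_sum_L1[where T = "\<lambda>n. out_fold I n l" and T' = "\<lambda>n. I n l" and h = ?h and s = "\<lambda>_. 1"])
    fix v :: real assume v: "v > 0"
    \<comment> \<open>The three contributions carry the factors 3, 3 and 1: 3 v/9 + 3 v/9 + v/3 =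
      v.\<close>
    then have v9: "v / 9 > 0" and v3: "v / 3 > 0"
      by auto
    have "whp M (\<lambda>n \<omega>. (\<Sum>j<p n. \<bar>lasso n l (train n l \<omega>) $ j\<bar>) \<le> K)"
      using bounded by (simp add: rho_hat_def train_eq)
    from whp_conj[OF whp_conj[OF whp_gamma[OF l] whp_m[OF l v9]] whp_conj[OF this whp_t2_small[OF l v9]]]
    show "whp M (\<lambda>n \<omega>. (\<integral>\<^sup>+w. ennreal (?h n (train n l \<omega>) w) \<partial>F) \<le> ennreal (v * 1))"
    proof (rule whp_mono_ev[OF _ powr_small[OF rates(2) v3, of "3 * (K * Cb)\<^sup>2"]], elim conjE)
      fix n \<omega>
      let ?g = "learn n l (train n l \<omega>)" and ?f = "ah n l (train n l \<omega>)"
      assume small: "3 * (K * Cb)\<^sup>2 * (real n powr (- c))\<^sup>2 \<le> v / 3" and g: "?g \<in> \<Gamma>"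
        and g_le: "(\<integral>w. (?g (X w) - \<gamma> (X w))\<^sup>2 \<partial>F) \<le> (real n powr (- c))\<^sup>2"
        and m_le: "(\<integral>\<^sup>+w. ennreal ((m w ?g - m w \<gamma>)\<^sup>2) \<partial>F) \<le> ennreal (v / 9)"
        and K: "(\<Sum>j<p n. \<bar>lasso n l (train n l \<omega>) $ j\<bar>) \<le> K"
        and f_le: "Cv * (\<integral>w. (\<alpha> (X w) - ?f (X w))\<^sup>2 \<partial>F) \<le> v / 9"
      have "3 * (K * Cb)\<^sup>2 * (\<integral>w. (?g (X w) - \<gamma> (X w))\<^sup>2 \<partial>F) \<le> 3 * (K * Cb)\<^sup>2 * (real n powr (- c))\<^sup>2"
        using g_le by (intro mult_left_mono) auto
      then have "3 * (K * Cb)\<^sup>2 * (\<integral>w. (?g (X w) - \<gamma> (X w))\<^sup>2 \<partial>F) \<le> v / 3"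
        using small by linarith
      then have "(\<integral>\<^sup>+w. ennreal (?h n (train n l \<omega>) w) \<partial>F)
          \<le> 3 * ennreal (v / 9) + (3 * ennreal (v / 9) + ennreal (v / 3))"
        using m_le f_le
        by (intro order_trans[OF debiased_moment_diff_sq[OF g K]] add_mono mult_left_mono ennreal_leI) auto
      also have "3 * ennreal (v / 9) = ennreal (3 * (v / 9))"
        using v by (subst ennreal_mult') auto
      also have "ennreal (3 * (v / 9)) + (ennreal (3 * (v / 9)) + ennreal (v / 3)) = ennreal (v * 1)"
        using v by (simp flip: ennreal_plus)
      finally show "(\<integral>\<^sup>+w. ennreal (?h n (train n l \<omega>) w) \<partial>F) \<le> ennreal (v * 1)" .
    qed
  next
    fix n :: nat assume n: "n > 0"
    note [measurable] = t_meas(4)[OF n l, unfolded case_prod_beta]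
    show "(\<lambda>(d, w). ?h n d w) \<in> borel_measurable (P n l \<Otimes>\<^sub>M F)"
      unfolding case_prod_beta by measurable
  qed (use assms fold_disjoint finite_out_fold finite_fold card_fold_le in auto)
  then show ?thesis
    by (rule whp_mono_ev[OF _ eventually_gt_at_top[of 0]]) (simp add: gamma_hat_eq alpha_hat_eq[OF _ l])
qed

lemma whp_theta_consistent:
  assumes "e > 0" "L > 0"
  shows "whp M (\<lambda>n \<omega>. \<bar>theta_h n \<omega> - theta_bar F m \<gamma>\<bar> \<le> e)"
proof -
  have e2: "e / 2 > 0"
    using assms by simp
  let ?V = "\<integral>w. (psi w)\<^sup>2 \<partial>F"
  have "whp M (\<lambda>n \<omega>. \<bar>\<Sum>i<n. psi (W i \<omega>)\<bar> \<le> n * (e / 2))"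
  proof (rule whpI_bound)
    show "(\<lambda>n. ?V / (e / 2)\<^sup>2 / real n) \<longlonglongrightarrow> 0"
      by (rule lim_const_over_n)
    show "\<forall>\<^sub>F n in sequentially. {\<omega> \<in> space M. \<not> \<bar>\<Sum>i<n. psi (W i \<omega>)\<bar> \<le> n * (e / 2)} \<in> events \<and>
        prob {\<omega> \<in> space M. \<not> \<bar>\<Sum>i<n. psi (W i \<omega>)\<bar> \<le> n * (e / 2)} \<le> ?V / (e / 2)\<^sup>2 / real n"
      using eventually_gt_at_top[of 0]
    proof (eventually_elim, intro conjI)
      fix n :: nat assume n: "n > 0"
      show "{\<omega> \<in> space M. \<not> \<bar>\<Sum>i<n. psi (W i \<omega>)\<bar> \<le> n * (e / 2)} \<in> events"
        by measurable
      have t: "n * (e / 2) > 0"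
        using n e2 by simp
      have "prob {\<omega> \<in> space M. n * (e / 2) < \<bar>\<Sum>i<n. psi (W i \<omega>)\<bar>} \<le> card {..<n} * ?V / (n * (e / 2))\<^sup>2"
        by (rule Chebyshev_sum[OF _ psi_sq psi_mean _ t]) auto
      also have "\<dots> = ?V / (e / 2)\<^sup>2 / real n"
        using n by (simp add: power_mult_distrib power2_eq_square)
      finally show "prob {\<omega> \<in> space M. \<not> \<bar>\<Sum>i<n. psi (W i \<omega>)\<bar> \<le> n * (e / 2)} \<le> ?V / (e / 2)\<^sup>2 / real n"
        by (simp add: not_le)
    qed
  qed
  from whp_conj[OF this whp_total_diff[OF e2 \<open>L > 0\<close>]] show ?thesis
  proof (rule whp_mono_ev[OF _ eventually_gt_at_top[of 0]], elim conjE)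
    fix n :: nat and \<omega>
    let ?S = "\<Sum>i<n. psi (W i \<omega>)" and ?R = "\<Sum>l<L. \<Sum>i\<in>I n l. score_hat n l \<omega> (W i \<omega>) - score (W i \<omega>)"
    assume n: "n > 0" and S: "\<bar>?S\<bar> \<le> n * (e / 2)" and R: "\<bar>?R\<bar> \<le> e / 2 * sqrt (real n)"
    have "sqrt (real n) \<le> n"
      using n by (intro real_le_lsqrt) (auto simp: power2_eq_square)
    then have "e / 2 * sqrt (real n) \<le> e / 2 * n"
      using e2 by (intro mult_left_mono) auto
    then have "\<bar>?R\<bar> \<le> n * (e / 2)"
      using R by (simp add: mult.commute)
    then have "\<bar>?R / n\<bar> \<le> e / 2" "\<bar>?S / n\<bar> \<le> e / 2"
      using S n by (simp_all add: pos_divide_le_eq mult.commute)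
    then show "\<bar>theta_h n \<omega> - theta_bar F m \<gamma>\<bar> \<le> e"
      unfolding theta_expansion[OF n] by argo
  qed
qed

text \<open>Each squared estimated score is compared with the square of the true one, up to a
  fraction \<tau> of the latter and a multiple of the squared error. Averages of the true squares
  obey the weak law, and the mean squared error of the scores vanishes by the bounded l1
  norm.\<close>

theorem variance_consistency:
  assumes "L > 0"
    and bounded: "\<And>l. l < L \<Longrightarrow> whp M (\<lambda>n \<omega>. (\<Sum>j<p n. \<bar>rho_hat W I lasso n l \<omega> $ j\<bar>) \<le> K l)"
  shows "tendsto_in_prob M (V_hat m X Y W L I (gamma_hat W I learn) (alpha_hat b p W I lasso)) (asym_var F m X Y \<gamma> \<alpha>)"
proof (rule tendsto_in_prob_whp)
  fix e :: real assume "e > 0"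
  let ?Vh = "V_hat m X Y W L I (gamma_hat W I learn) (alpha_hat b p W I lasso)"
  define V where "V = asym_var F m X Y \<gamma> \<alpha>"
  have V: "V \<ge> 0"
    by (simp add: V_def asym_var_def)
  \<comment> \<open>Half of \<open>e\<close> goes to the weak law and a quarter to each of the two
    error terms: V + 1 eventually bounds the mean of the true squares, which fixes \<tau>; then
    \<open>\<eta>\<close> is fixed by (1 + 1/\<tau>) 4\<eta> = e/4.\<close>
  define \<tau> where "\<tau> = e / 4 / (V + 1)"
  have V1: "V + 1 > 0"
    using V by linarith
  have \<tau>: "\<tau> > 0" "\<tau> * (V + 1) = e / 4"
    unfolding \<tau>_def using V1 \<open>e > 0\<close> nonzero_eq_divide_eq[of "V + 1" "e / 4 / (V + 1)" "e / 4"] by auto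
  define \<eta> where "\<eta> = e / (16 * (1 + 1 / \<tau>))"
  have \<eta>: "\<eta> > 0" "(1 + 1 / \<tau>) * (4 * \<eta>) = e / 4"
  proof -
    have "q * (4 * (e / (16 * q))) = e / 4 \<and> e / (16 * q) > 0" if "q > 0" for q :: real
      using that \<open>e > 0\<close> by simp
    moreover have "1 + 1 / \<tau> > 0"
      using \<tau>(1) by (simp add: add_pos_pos)
    ultimately show "\<eta> > 0" "(1 + 1 / \<tau>) * (4 * \<eta>) = e / 4"
      unfolding \<eta>_def by blast+
  qed
  have mn: "min 1 (e / 2) > 0"
    using \<open>e > 0\<close> by simp
  have \<eta>L: "\<eta> / L > 0"
    using \<eta>(1) \<open>L > 0\<close> by simp
  have sq: "sqrt \<eta> > 0"
    using \<eta>(1) by simp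
  have lln: "whp M (\<lambda>n \<omega>. \<bar>(\<Sum>i<n. (psi (W i \<omega>))\<^sup>2) / n - V\<bar> \<le> min 1 (e / 2))"
    using whp_weak_law[OF psi_sq zero_le_power2 mn] by (simp add: V_def psi_var)
  have diff: "whp M (\<lambda>n \<omega>. \<forall>l<L. (\<Sum>i\<in>I n l. (score_hat n l \<omega> (W i \<omega>) - score (W i \<omega>))\<^sup>2) \<le> \<eta> / L * (real n * 1))"
    by (intro whp_all_less whp_score_diff_sq[OF _ \<eta>L bounded])
  show "whp M (\<lambda>n \<omega>. \<bar>?Vh n \<omega> - asym_var F m X Y \<gamma> \<alpha>\<bar> \<le> e)"
    unfolding V_def[symmetric]
    using whp_conj[OF whp_conj[OF lln diff] whp_theta_consistent[OF sq \<open>L > 0\<close>]]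
  proof (rule whp_mono_ev[OF _ eventually_gt_at_top[of 0]], elim conjE)
    fix n :: nat and \<omega>
    let ?D = "\<lambda>l i. score_hat n l \<omega> (W i \<omega>) - score (W i \<omega>)"
    let ?\<delta> = "theta_h n \<omega> - theta_bar F m \<gamma>"
    let ?S = "\<Sum>i<n. (psi (W i \<omega>))\<^sup>2"
    assume n: "n > 0" and S: "\<bar>?S / n - V\<bar> \<le> min 1 (e / 2)"
      and D: "\<forall>l<L. (\<Sum>i\<in>I n l. (?D l i)\<^sup>2) \<le> \<eta> / L * (real n * 1)"
      and \<delta>: "\<bar>?\<delta>\<bar> \<le> sqrt \<eta>"
    have \<delta>2: "?\<delta>\<^sup>2 \<le> \<eta>"
      using power_mono[OF \<delta> abs_ge_zero, of 2] \<eta>(1) by simp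
    have "(\<Sum>l<L. \<Sum>i\<in>I n l. (?D l i)\<^sup>2) \<le> (\<Sum>l<L. \<eta> / L * (real n * 1))"
      using D by (intro sum_mono) auto
    then have D_total: "(\<Sum>l<L. \<Sum>i\<in>I n l. (?D l i)\<^sup>2) \<le> \<eta> * n"
      using \<open>L > 0\<close> by simp
    let ?z = "\<lambda>l i. (score_hat n l \<omega> (W i \<omega>) - theta_h n \<omega>)\<^sup>2"
    \<comment> \<open>With estimated score y + x, (y + x)^2 - y^2 = 2xy + x^2, and Young's
      inequality gives 2\<bar>xy\<bar> \<le> \<tau> y^2 + x^2/\<tau>. The error x consists of the
      score error and the error in centering.\<close>
    have pointwise: "\<bar>?z l i - (psi (W i \<omega>))\<^sup>2\<bar>
        \<le> \<tau> * (psi (W i \<omega>))\<^sup>2 + (1 + 1 / \<tau>) * (2 * (?D l i)\<^sup>2 + 2 * \<eta>)" for l i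
    proof -
      let ?x = "?D l i - ?\<delta>" and ?y = "psi (W i \<omega>)"
      have z: "?z l i = (?y + ?x)\<^sup>2"
        by (simp add: algebra_simps)
      have "0 \<le> (sqrt \<tau> * \<bar>?y\<bar> - \<bar>?x\<bar> / sqrt \<tau>)\<^sup>2"
        by simp
      also have "\<dots> = \<tau> * ?y\<^sup>2 - 2 * (\<bar>?y\<bar> * \<bar>?x\<bar>) + ?x\<^sup>2 / \<tau>"
        using \<tau>(1) by (simp add: power2_diff power_mult_distrib power_divide)
      finally have cross: "2 * \<bar>?y * ?x\<bar> \<le> \<tau> * ?y\<^sup>2 + ?x\<^sup>2 / \<tau>"
        unfolding abs_mult by argo
      have "(y + x)\<^sup>2 - y\<^sup>2 = 2 * (y * x) + x\<^sup>2" for x y :: real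
        by (simp add: power2_sum)
      then have "\<bar>(?y + ?x)\<^sup>2 - ?y\<^sup>2\<bar> = \<bar>2 * (?y * ?x) + ?x\<^sup>2\<bar>"
        by (simp only:)
      also have "\<dots> \<le> 2 * \<bar>?y * ?x\<bar> + ?x\<^sup>2"
        using abs_triangle_ineq[of "2 * (?y * ?x)" "?x\<^sup>2"] by (simp only: abs_mult abs_numeral abs_power2)
      also have "\<dots> \<le> \<tau> * ?y\<^sup>2 + (1 + 1 / \<tau>) * ?x\<^sup>2"
        using cross by (simp add: distrib_right)
      also have "(1 + 1 / \<tau>) * ?x\<^sup>2 \<le> (1 + 1 / \<tau>) * (2 * (?D l i)\<^sup>2 + 2 * \<eta>)"
      proof (rule mult_left_mono)
        have "(x - y)\<^sup>2 \<le> 2 * x\<^sup>2 + 2 * y\<^sup>2" for x y :: real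
          using zero_le_power2[of "x + y"] by (simp add: power2_sum power2_diff)
        then have "?x\<^sup>2 \<le> 2 * (?D l i)\<^sup>2 + 2 * ?\<delta>\<^sup>2"
          by blast
        then show "?x\<^sup>2 \<le> 2 * (?D l i)\<^sup>2 + 2 * \<eta>"
          using \<delta>2 by linarith
      qed (use \<tau>(1) in simp)
      finally show ?thesis
        unfolding z by simp
    qed
    have Vh: "?Vh n \<omega> = (\<Sum>l<L. \<Sum>i\<in>I n l. ?z l i) / n"
      by (simp add: V_hat_def)
    have S_folds: "?S = (\<Sum>l<L. \<Sum>i\<in>I n l. (psi (W i \<omega>))\<^sup>2)"
      by (rule sum_folds)
    have "\<bar>(\<Sum>l<L. \<Sum>i\<in>I n l. ?z l i) - ?S\<bar> = \<bar>\<Sum>l<L. \<Sum>i\<in>I n l. ?z l i - (psi (W i \<omega>))\<^sup>2\<bar>"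
      unfolding S_folds by (simp only: sum_subtractf)
    also have "\<dots> \<le> (\<Sum>l<L. \<Sum>i\<in>I n l. \<bar>?z l i - (psi (W i \<omega>))\<^sup>2\<bar>)"
      by (intro order_trans[OF sum_abs] sum_mono sum_abs)
    also have "\<dots> \<le> (\<Sum>l<L. \<Sum>i\<in>I n l. \<tau> * (psi (W i \<omega>))\<^sup>2 + (1 + 1 / \<tau>) * (2 * (?D l i)\<^sup>2 + 2 * \<eta>))"
      by (intro sum_mono pointwise)
    also have "\<dots> = \<tau> * ?S + (1 + 1 / \<tau>) * (2 * (\<Sum>l<L. \<Sum>i\<in>I n l. (?D l i)\<^sup>2) + 2 * (n * \<eta>))"
    proof -
      have "(\<Sum>l<L. \<Sum>i\<in>I n l. \<eta>) = n * \<eta>"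
        using sum_folds[of "\<lambda>_. \<eta>" n] by simp
      then show ?thesis
        unfolding S_folds by (simp only: sum.distrib sum_distrib_left[symmetric])
    qed
    also have "\<dots> \<le> \<tau> * (n * (V + 1)) + (1 + 1 / \<tau>) * (2 * (\<eta> * n) + 2 * (n * \<eta>))"
    proof (intro add_mono mult_left_mono)
      have "?S / n \<le> V + 1"
        using S by linarith
      then show "?S \<le> n * (V + 1)"
        using n by (simp add: pos_divide_le_eq mult.commute)
    qed (use D_total \<tau>(1) in auto)
    also have "\<dots> = n * (\<tau> * (V + 1) + (1 + 1 / \<tau>) * (4 * \<eta>))"
      by (simp add: algebra_simps)
    also have "\<dots> = n * (e / 2)"
      unfolding \<tau>(2) \<eta>(2) by simp
    finally have "\<bar>(\<Sum>l<L. \<Sum>i\<in>I n l. ?z l i) - ?S\<bar> / n \<le> e / 2"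
      using n by (simp add: pos_divide_le_eq mult.commute)
    then have "\<bar>((\<Sum>l<L. \<Sum>i\<in>I n l. ?z l i) - ?S) / n\<bar> \<le> e / 2"
      by simp
    then have "\<bar>?Vh n \<omega> - ?S / n\<bar> \<le> e / 2"
      unfolding Vh by (simp only: diff_divide_distrib)
    then show "\<bar>?Vh n \<omega> - V\<bar> \<le> e"
      using S by linarith
  qed
qed

end

section \<open>From the hypotheses to the two abstract settings\<close>

theorem theorem3:
  fixes M :: "'a measure" and F :: "'w measure" and W :: "nat \<Rightarrow> 'a \<Rightarrow> 'w"
    and X :: "'w \<Rightarrow> 'x::euclidean_space" and Y :: "'w \<Rightarrow> real"
    and \<Gamma> :: "('x \<Rightarrow> real) set" and m :: "'w \<Rightarrow> ('x \<Rightarrow> real) \<Rightarrow> real"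
    and \<alpha>0 \<alpha>bar \<gamma>bar :: "'x \<Rightarrow> real"
    and b :: "nat \<Rightarrow> 'x \<Rightarrow> real" and p :: "nat \<Rightarrow> nat" and r :: "nat \<Rightarrow> real"
    and L :: nat and I :: "nat \<Rightarrow> nat \<Rightarrow> nat set"
    and learn :: "nat \<Rightarrow> nat \<Rightarrow> (nat \<Rightarrow> 'w) \<Rightarrow> 'x \<Rightarrow> real"
    and lasso :: "nat \<Rightarrow> nat \<Rightarrow> (nat \<Rightarrow> 'w) \<Rightarrow> real Matrix.vec"
  assumes prob: "prob_space M"
    and indep: "prob_space.indep_vars M (\<lambda>_. F) W UNIV"
    and ident: "\<And>i. distr M F (W i) = F"
    and meas_X: "X \<in> measurable F borel"
    and meas_Y: "Y \<in> borel_measurable F"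
    and Y_sq: "integrable F (\<lambda>w. (Y w)\<^sup>2)"
    and \<Gamma>: "closed_linear_subspace F X \<Gamma>"
    and m_linear: "\<And>w. w \<in> space F \<Longrightarrow> linear_functional_on (L2_fun F X) (m w)"
    and \<alpha>0: "\<alpha>0 \<in> L2_fun F X"
    and riesz: "\<And>\<gamma>. \<gamma> \<in> L2_fun F X \<Longrightarrow>
       integrable F (\<lambda>w. m w \<gamma>) \<and> (\<integral>w. m w \<gamma> \<partial>F) = (\<integral>w. \<alpha>0 (X w) * \<gamma> (X w) \<partial>F)"
    and \<alpha>bar: "is_arg_min (\<lambda>\<alpha>. \<integral>w. (\<alpha>0 (X w) - \<alpha> (X w))\<^sup>2 \<partial>F) (\<lambda>\<alpha>. \<alpha> \<in> \<Gamma>) \<alpha>bar"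
    and \<gamma>bar: "is_arg_min (\<lambda>\<gamma>. \<integral>w. (Y w - \<gamma> (X w))\<^sup>2 \<partial>F) (\<lambda>\<gamma>. \<gamma> \<in> \<Gamma>) \<gamma>bar"
    and p_ge: "\<And>n. n > 0 \<Longrightarrow> p n \<ge> 2"
    and r_pos: "\<And>n. n > 0 \<Longrightarrow> r n > 0"
    and L_ge: "L \<ge> 2"
    and folds: "cross_fit_folds L I"
    and learn: "measurable_regression_learner F m I L learn"
    and lasso_meas: "measurable_coefficients F p I L lasso"
    and lasso: "\<And>l. l < L \<Longrightarrow> wp_approaching_one M (\<lambda>n \<omega>.
       is_arg_min (lasso_objective (M_hat m b p W I n l \<omega>) (G_hat X b p W I n l \<omega>) (r n))
         (\<lambda>\<rho>. \<rho> \<in> carrier_vec (p n)) (rho_hat W I lasso n l \<omega>))"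
    and c1_mem: "\<And>j. b j \<in> \<Gamma>"
    and c1_dense: "\<And>\<alpha> \<epsilon>. \<alpha> \<in> \<Gamma> \<Longrightarrow> \<epsilon> > 0 \<Longrightarrow>
       \<exists>q. \<exists>\<rho> \<in> carrier_vec q. (\<integral>w. (\<alpha> (X w) - (\<Sum>j<q. \<rho> $ j * b j (X w)))\<^sup>2 \<partial>F) < \<epsilon>"
    and c2: "\<exists>\<xi>>0. sparse_approximation F X b p \<alpha>bar \<xi>"
    and c3: "gram_conditions M F X b p W L I"
    and c4: "\<exists>C>0. AE w in F. \<forall>j. \<bar>b j (X w)\<bar> \<le> C"
    and c5_lower: "eps p \<in> o(r)"
    and c5_upper: "\<And>c. c > 0 \<Longrightarrow> r \<in> o(\<lambda>n. real n powr c * eps p n)"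
    and c5_poly: "\<exists>C>0. \<forall>n>0. real (p n) \<le> C * real n powr C"
    and c6: "\<exists>C>0. \<forall>n>0. AE w in F. \<forall>j<p n. \<bar>m w (b j)\<bar> \<le> C"
    and c7_var: "\<exists>C. AE w in F.
       real_cond_exp F (vimage_algebra (space F) X borel) (\<lambda>w. (Y w - \<gamma>bar (X w))\<^sup>2) w \<le> C"
    and c7_\<alpha>: "\<exists>C. AE w in F. \<bar>\<alpha>bar (X w)\<bar> \<le> C"
    and c8_sq: "integrable F (\<lambda>w. (m w \<gamma>bar)\<^sup>2)"
    and c8_conv: "\<And>l. l < L \<Longrightarrow> tendsto_in_prob_0 M (\<lambda>n \<omega>.
       \<integral>\<^sup>+w. ennreal ((m w (gamma_hat W I learn n l \<omega>) - m w \<gamma>bar)\<^sup>2) \<partial>F)"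
    and c9_mem: "\<And>l. l < L \<Longrightarrow> wp_approaching_one M (\<lambda>n \<omega>. gamma_hat W I learn n l \<omega> \<in> \<Gamma>)"
    and c9_rate: "\<exists>d\<^sub>\<gamma>>0.
       (\<forall>l<L. bigo_in_prob M
          (\<lambda>n \<omega>. L2_norm_of F (\<lambda>w. gamma_hat W I learn n l \<omega> (X w) - \<gamma>bar (X w)))
          (\<lambda>n. real n powr (- d\<^sub>\<gamma>))) \<and>
       ((\<exists>\<xi>>0. sparse_approximation F X b p \<alpha>bar \<xi> \<and> gram_conditions M F X b p W L I \<and>
            \<xi> / (2 * \<xi> + 1) + d\<^sub>\<gamma> > 1 / 2)
        \<or> (abs_summable_representation F X b p \<alpha>bar \<and> d\<^sub>\<gamma> > 1 / 4))"
  shows "tendsto_in_dist M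
      (\<lambda>n \<omega>. sqrt (real n) *
         (theta_hat m X Y W L I (gamma_hat W I learn) (alpha_hat b p W I lasso) n \<omega>
          - theta_bar F m \<gamma>bar))
      (normal_law 0 (asym_var F m X Y \<gamma>bar \<alpha>bar))
    \<and> (abs_summable_representation F X b p \<alpha>bar \<longrightarrow>
      tendsto_in_prob M
        (V_hat m X Y W L I (gamma_hat W I learn) (alpha_hat b p W I lasso))
        (asym_var F m X Y \<gamma>bar \<alpha>bar))"
proof -
  have iid: "iid_sample M F W"
    using prob indep ident by (simp add: iid_sample_def iid_sample_axioms_def)
  interpret iid_sample M F W
    by (rule iid)
  interpret F: prob_space F
    by (rule prob_space_F)
  have \<alpha>_mem: "\<alpha>bar \<in> \<Gamma>" and \<gamma>_mem: "\<gamma>bar \<in> \<Gamma>"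
    using \<alpha>bar \<gamma>bar by (auto simp: is_arg_min_def)
  have L2: "g \<in> L2_fun F X" if "g \<in> \<Gamma>" for g
    using \<Gamma> that by (auto simp: closed_linear_subspace_def)
  have \<Gamma>_meas: "g \<in> borel_measurable borel" and \<Gamma>_sq: "integrable F (\<lambda>w. (g (X w))\<^sup>2)" if "g \<in> \<Gamma>" for g
    using L2[OF that] by (auto simp: L2_fun_def)
  note [measurable] = meas_X meas_Y \<Gamma>_meas[OF \<alpha>_mem] \<Gamma>_meas[OF \<gamma>_mem] \<Gamma>_meas[OF c1_mem]
  have \<alpha>0_meas [measurable]: "\<alpha>0 \<in> borel_measurable borel" and \<alpha>0_sq: "integrable F (\<lambda>w. (\<alpha>0 (X w))\<^sup>2)"
    using \<alpha>0 by (auto simp: L2_fun_def)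
  have orth: "(\<integral>w. (Y w - \<gamma>bar (X w)) * g (X w) \<partial>F) = 0" if "g \<in> \<Gamma>" for g
    by (rule projection_orthogonal[OF meas_X meas_Y Y_sq \<Gamma> \<gamma>bar that])
  have m_int: "integrable F (\<lambda>w. m w g)" if "g \<in> \<Gamma>" for g
    using riesz[OF L2[OF that]] by simp
  \<comment> \<open>On \<Gamma> the representer \<open>\<alpha>0\<close> may be replaced by its
    projection, since their difference is orthogonal to \<Gamma>.\<close>
  have m_riesz: "(\<integral>w. m w g \<partial>F) = (\<integral>w. \<alpha>bar (X w) * g (X w) \<partial>F)" if "g \<in> \<Gamma>" for g
  proof -
    note [measurable] = \<Gamma>_meas[OF that]
    have "(\<integral>w. (\<alpha>0 (X w) - \<alpha>bar (X w)) * g (X w) \<partial>F) = 0"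
      by (rule projection_orthogonal[OF meas_X _ \<alpha>0_sq \<Gamma> \<alpha>bar that]) measurable
    moreover have "integrable F (\<lambda>w. \<alpha>0 (X w) * g (X w))" "integrable F (\<lambda>w. \<alpha>bar (X w) * g (X w))"
      by (intro integrable_mult_squares \<alpha>0_sq \<Gamma>_sq \<alpha>_mem that; measurable)+
    ultimately show ?thesis
      using riesz[OF L2[OF that]] by (simp add: left_diff_distrib)
  qed
  obtain Cb where Cb: "Cb > 0" "AE w in F. \<forall>j. \<bar>b j (X w)\<bar> \<le> Cb"
    using c4 by blast
  obtain Cm where Cm: "Cm > 0" "\<And>n. n > 0 \<Longrightarrow> AE w in F. \<forall>j<p n. \<bar>m w (b j)\<bar> \<le> Cm"
    using c6 by blast
  obtain C' where C': "AE w in F. \<bar>\<alpha>bar (X w)\<bar> \<le> C'"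
    using c7_\<alpha> by blast
  define C\<alpha> where "C\<alpha> = max C' 1"
  have C\<alpha>: "C\<alpha> > 0" "AE w in F. \<bar>\<alpha>bar (X w)\<bar> \<le> C\<alpha>"
    using C' by (auto simp: C\<alpha>_def elim!: eventually_mono)
  obtain Cv where Cv: "AE w in F.
       real_cond_exp F (vimage_algebra (space F) X borel) (\<lambda>w. (Y w - \<gamma>bar (X w))\<^sup>2) w \<le> Cv"
    using c7_var by blast
  obtain \<Lambda>' where "\<forall>n>0. \<forall>k. eigenvalue (pop_gram F X b (p n)) k \<longrightarrow> k \<le> \<Lambda>'"
    using c3 unfolding gram_conditions_def by blast
  then have eig: "\<And>n k. n > 0 \<Longrightarrow> eigenvalue (pop_gram F X b (p n)) k \<Longrightarrow> k \<le> max \<Lambda>' 0"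
    by (meson max.coboundedI1)
  obtain C0 c0 where C0: "C0 > 0" "c0 > 0" and RE: "\<And>l s. l < L \<Longrightarrow>
      (\<lambda>n. real (s n) * (eps p n)\<^sup>2) \<longlonglongrightarrow> C0 \<Longrightarrow>
        wp_approaching_one M (\<lambda>n \<omega>. restricted_eig_ge (G_hat X b p W I n l \<omega>) (p n) (s n) c0)"
    using c3 unfolding gram_conditions_def by blast
  \<comment> \<open>The limiting share of a fold is 1/L \<le> 1/2 < 3/4, which leaves at least a
    quarter of the sample for training.\<close>
  have train_large: "\<forall>\<^sub>F n in sequentially. 1 / 4 * real n \<le> card (out_fold I n l)" if l: "l < L" for l
  proof -
    have "(\<lambda>n. real (card (I n l)) / real n) \<longlonglongrightarrow> 1 / real L"
      using folds l by (auto simp: cross_fit_folds_def)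
    moreover have "1 / real L < 3 / 4"
      using L_ge by (simp add: field_simps)
    ultimately have "\<forall>\<^sub>F n in sequentially. real (card (I n l)) / real n < 3 / 4"
      by (rule order_tendstoD(2))
    then show ?thesis
      using eventually_gt_at_top[of 0]
    proof eventually_elim
      case (elim n)
      have "I n l \<subseteq> {..<n}"
        using folds l by (auto simp: cross_fit_folds_def)
      then have "card (out_fold I n l) = n - card (I n l)" "card (I n l) \<le> n"
        using card_mono[of "{..<n}" "I n l"] by (auto simp: out_fold_def card_Diff_subset finite_subset)
      then show ?case
        using elim by (simp add: pos_divide_less_eq of_nat_diff)
    qed
  qed
  have fold: "riesz_lasso M F W X m \<alpha>bar b p r (\<lambda>n. out_fold I n l) (\<lambda>n \<omega>. rho_hat W I lasso n l \<omega>)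
      Cb Cm C\<alpha> (max \<Lambda>' 0) (1 / 4)" if l: "l < L" for l
  proof (intro riesz_lasso.intro iid riesz_lasso_axioms.intro)
    show "whp M (\<lambda>n \<omega>. is_arg_min
        (lasso_objective (emp_moment m b (p n) (out_fold I n l) (\<lambda>i. W i \<omega>))
          (emp_gram X b (p n) (out_fold I n l) (\<lambda>i. W i \<omega>)) (r n))
        (\<lambda>\<rho>. \<rho> \<in> carrier_vec (p n)) (rho_hat W I lasso n l \<omega>))"
      using whp_of_wp_approaching_one[OF lasso[OF l]] by (simp add: M_hat_def G_hat_def)
    show "\<forall>\<^sub>F n in sequentially. 1 / 4 * real n \<le> card (out_fold I n l)"
      by (rule train_large[OF l])
  qed (use Cb Cm C\<alpha> m_int m_riesz c1_mem p_ge r_pos c5_lower eig \<Gamma>_meas \<alpha>_mem meas_X in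
      \<open>auto simp: out_fold_def\<close>)
  obtain d where d: "d > 0" "\<And>l. l < L \<Longrightarrow> bigo_in_prob M
          (\<lambda>n \<omega>. L2_norm_of F (\<lambda>w. gamma_hat W I learn n l \<omega> (X w) - \<gamma>bar (X w)))
          (\<lambda>n. real n powr (- d))"
    and cases: "(\<exists>\<xi>>0. sparse_approximation F X b p \<alpha>bar \<xi> \<and> gram_conditions M F X b p W L I \<and>
            \<xi> / (2 * \<xi> + 1) + d > 1 / 2)
        \<or> (abs_summable_representation F X b p \<alpha>bar \<and> d > 1 / 4)"
    using c9_rate by blast
  let ?err = "\<lambda>n l \<omega>. \<integral>w. (\<alpha>bar (X w) - dict_comb b (p n) (($) (rho_hat W I lasso n l \<omega>)) (X w))\<^sup>2 \<partial>F"
  have slow: "\<exists>K>0. whp M (\<lambda>n \<omega>. (\<Sum>j<p n. \<bar>rho_hat W I lasso n l \<omega> $ j\<bar>) \<le> K \<and> ?err n l \<omega> \<le> K * r n)"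
    if "abs_summable_representation F X b p \<alpha>bar" "l < L" for l
    by (rule riesz_lasso.whp_slow_rate[OF fold[OF that(2)] that(1)])
  \<comment> \<open>\<open>A\<close> is the critical exponent of the regime, \<xi>/(2\<xi>+1) or
    1/4; the bounds hold for every exponent strictly below it.\<close>
  have "\<exists>A>0. A + d > 1 / 2 \<and> (\<forall>a<A. \<forall>l<L. whp M (\<lambda>n \<omega>. ?err n l \<omega> \<le> (real n powr (- a))\<^sup>2))"
    using cases
  proof (elim disjE exE conjE)
    fix \<xi> :: real
    assume \<xi>: "\<xi> > 0" "sparse_approximation F X b p \<alpha>bar \<xi>" "\<xi> / (2 * \<xi> + 1) + d > 1 / 2"
    have "whp M (\<lambda>n \<omega>. ?err n l \<omega> \<le> (real n powr (- a))\<^sup>2)" if a: "a < \<xi> / (2 * \<xi> + 1)" and l: "l < L" for a l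
    proof -
      have RE': "whp M (\<lambda>n \<omega>. restricted_eig_ge (emp_gram X b (p n) (out_fold I n l) (\<lambda>i. W i \<omega>)) (p n) (s n) c0)"
        if "(\<lambda>n. real (s n) * (eps p n)\<^sup>2) \<longlonglongrightarrow> C0" for s
        using whp_of_wp_approaching_one[OF RE[OF l that]] by (simp add: G_hat_def)
      obtain K where K: "whp M (\<lambda>n \<omega>. ?err n l \<omega> \<le> K * ((r n)\<^sup>2 * eps p n powr (- 2 / (2 * \<xi> + 1))))"
        using riesz_lasso.whp_fast_rate[OF fold[OF l] \<xi>(2,1) eps_tendsto_0[OF p_ge c5_poly] C0 RE'] by blast
      have expo: "\<forall>\<^sub>F n in sequentially. K * ((r n)\<^sup>2 * eps p n powr (- 2 / (2 * \<xi> + 1))) \<le> (real n powr (- a))\<^sup>2"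
        using p_ge c5_poly r_pos c5_upper \<xi>(1) a by (rule fast_rate_exponent)
      show ?thesis
        by (rule whp_mono_ev[OF K expo]) auto
    qed
    then show ?thesis
      using \<xi> by (intro exI[of _ "\<xi> / (2 * \<xi> + 1)"]) auto
  next
    assume S: "abs_summable_representation F X b p \<alpha>bar" "d > 1 / 4"
    have "whp M (\<lambda>n \<omega>. ?err n l \<omega> \<le> (real n powr (- a))\<^sup>2)" if a: "a < 1 / 4" and l: "l < L" for a l
    proof -
      obtain K where K: "whp M (\<lambda>n \<omega>. (\<Sum>j<p n. \<bar>rho_hat W I lasso n l \<omega> $ j\<bar>) \<le> K \<and> ?err n l \<omega> \<le> K * r n)"
        using slow[OF S(1) l] by blast
      have expo: "\<forall>\<^sub>F n in sequentially. K * r n \<le> (real n powr (- a))\<^sup>2"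
        using p_ge c5_poly r_pos c5_upper a by (rule slow_rate_exponent)
      show ?thesis
        by (rule whp_mono_ev[OF K expo]) auto
    qed
    then show ?thesis
      using S by (intro exI[of _ "1 / 4"]) auto
  qed
  then obtain A where A: "A > 0" "A + d > 1 / 2"
    and \<alpha>_rate: "\<And>a l. a < A \<Longrightarrow> l < L \<Longrightarrow> whp M (\<lambda>n \<omega>. ?err n l \<omega> \<le> (real n powr (- a))\<^sup>2)"
    by blast
  \<comment> \<open>Both exponents must be lowered strictly, for the lasso by
    \<open>\<alpha>_rate\<close> and for the regression to absorb the stochastic order. The midpoint
    of 1 and 1/(2(A+d)) as common factor keeps their sum above 1/2.\<close>
  define q where "q = (1 + 1 / (2 * (A + d))) / 2"
  have q: "0 < q" "q < 1" "q * (A + d) > 1 / 2"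
  proof -
    have "(1 + 1 / (2 * t)) / 2 > 0 \<and> (1 + 1 / (2 * t)) / 2 < 1 \<and> (1 + 1 / (2 * t)) / 2 * t > 1 / 2"
      if "t > 1 / 2" for t :: real
      using that by (simp add: field_simps)
    from this[OF A(2)] show "0 < q" "q < 1" "q * (A + d) > 1 / 2"
      unfolding q_def by blast+
  qed
  have a: "0 < q * A" "q * A < A" and c: "0 < q * d" "q * d < d" and ac: "q * A + q * d > 1 / 2"
    using q A(1) d(1) by (simp_all add: distrib_left)
  have crossfit: "debiased_crossfit M F W X Y \<Gamma> m \<alpha>bar \<gamma>bar b p L I learn lasso C\<alpha> Cv Cb (q * A) (q * d)"
  proof (intro debiased_crossfit.intro iid debiased_crossfit_axioms.intro)
    fix l assume l: "l < L"
    show "whp M (\<lambda>n \<omega>. gamma_hat W I learn n l \<omega> \<in> \<Gamma>)"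
      by (rule whp_of_wp_approaching_one[OF c9_mem[OF l]])
    show "whp M (\<lambda>n \<omega>. ?err n l \<omega> \<le> (real n powr (- (q * A)))\<^sup>2)"
      by (rule \<alpha>_rate[OF a(2) l])
    show "whp M (\<lambda>n \<omega>. \<bar>L2_norm_of F (\<lambda>w. gamma_hat W I learn n l \<omega> (X w) - \<gamma>bar (X w))\<bar> \<le> real n powr (- (q * d)))"
    proof (rule whp_of_bigo_in_prob[OF d(2)[OF l] _ c(2)])
      fix n :: nat assume "n > 0"
      let ?P = "PiM (out_fold I n l) (\<lambda>_. F)"
      have learn_meas: "(\<lambda>(d, x). learn n l d x) \<in> borel_measurable (?P \<Otimes>\<^sub>M borel)"
        using learn \<open>n > 0\<close> l by (auto simp: measurable_regression_learner_def)
      have "(\<lambda>z. (fst z, X (snd z))) \<in> measurable (?P \<Otimes>\<^sub>M F) (?P \<Otimes>\<^sub>M borel)"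
        by measurable
      from measurable_compose[OF this learn_meas]
      have [measurable]: "(\<lambda>z. learn n l (fst z) (X (snd z))) \<in> borel_measurable (?P \<Otimes>\<^sub>M F)"
        by simp
      have "(\<lambda>d. L2_norm_of F (\<lambda>w. learn n l d (X w) - \<gamma>bar (X w))) \<in> borel_measurable ?P"
        unfolding L2_norm_of_def by measurable
      moreover have "train_sample W I n l \<in> measurable M ?P"
        unfolding train_sample_def by (auto intro!: measurable_restrict)
      ultimately show "(\<lambda>\<omega>. L2_norm_of F (\<lambda>w. gamma_hat W I learn n l \<omega> (X w) - \<gamma>bar (X w))) \<in> borel_measurable M"
        unfolding gamma_hat_def by (rule measurable_compose[rotated])
    qed
  qed (use meas_X meas_Y Y_sq \<Gamma> \<alpha>_mem \<gamma>_mem c1_mem m_int m_riesz c8_sq orth C\<alpha> Cb Cv folds learn lasso_meas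
      c8_conv a c ac in auto)
  have "L > 0"
    using L_ge by simp
  have normal: "tendsto_in_dist M
      (\<lambda>n \<omega>. sqrt (real n) *
         (theta_hat m X Y W L I (gamma_hat W I learn) (alpha_hat b p W I lasso) n \<omega>
          - theta_bar F m \<gamma>bar))
      (normal_law 0 (asym_var F m X Y \<gamma>bar \<alpha>bar))"
    by (rule debiased_crossfit.asymptotic_normality[OF crossfit \<open>L > 0\<close>])
  have "tendsto_in_prob M
        (V_hat m X Y W L I (gamma_hat W I learn) (alpha_hat b p W I lasso))
        (asym_var F m X Y \<gamma>bar \<alpha>bar)"
    if S: "abs_summable_representation F X b p \<alpha>bar"
  proof -
    \<comment> \<open>The l1 bound comes from absolute summability itself, whichever regime provided
      the rates above.\<close>
    have "\<forall>l. \<exists>K. l < L \<longrightarrow> whp M (\<lambda>n \<omega>. (\<Sum>j<p n. \<bar>rho_hat W I lasso n l \<omega> $ j\<bar>) \<le> K)"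
    proof (intro allI)
      fix l
      show "\<exists>K. l < L \<longrightarrow> whp M (\<lambda>n \<omega>. (\<Sum>j<p n. \<bar>rho_hat W I lasso n l \<omega> $ j\<bar>) \<le> K)"
      proof (cases "l < L")
        case True
        then obtain K where "whp M (\<lambda>n \<omega>. (\<Sum>j<p n. \<bar>rho_hat W I lasso n l \<omega> $ j\<bar>) \<le> K \<and> ?err n l \<omega> \<le> K * r n)"
          using slow[OF S] by blast
        then have "whp M (\<lambda>n \<omega>. (\<Sum>j<p n. \<bar>rho_hat W I lasso n l \<omega> $ j\<bar>) \<le> K)"
          by (rule whp_mono') simp
        then show ?thesis by blast
      qed simp
    qed
    from choice[OF this] obtain K
      where "\<forall>l. l < L \<longrightarrow> whp M (\<lambda>n \<omega>. (\<Sum>j<p n. \<bar>rho_hat W I lasso n l \<omega> $ j\<bar>) \<le> K l)" ..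
    then show ?thesis
      by (intro debiased_crossfit.variance_consistency[OF crossfit \<open>L > 0\<close>]) auto
  qed
  with normal show ?thesis
    by blast
qed

end
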